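(* Let $n>2$ be an integer and let $1<p\le\infty$. Suppose $\max(2^{-1},p^{-1})<\beta<1$ (with $p^{-1}=0$ if $p=\infty$). Then there exists some $T_0>0$ such that for any $T\ge T_0$ the map $U:B^n\setminus\{0\}\to\mathbb{R}^{n+2}$ defined by $$U(x)=\left(\cos\bigl(t^{1-\beta}\bigr),\ \sin\bigl(t^{1-\beta}\bigr),\ t^{-(\beta+1/2)}\frac{x}{|x|}\right),\qquad t=T+\log\frac{1}{|x|},$$ satisfies $$\nabla U\in L^{(n,p)}(B^n),\qquad U\in L^\infty(B^n),$$ but $U$ is discontinuous at the origin. Furthermore, there exists a potential $$\Omega\in\bigcap_{q>2}L^{(n,q)}\bigl(B^n,so(n+2)\otimes\mathbb{R}^n\bigr)$$ such that $$-\operatorname{div}\bigl(|\nabla U|^{n-2}\nabla U\bigr)=\Omega\cdot|\nabla U|^{n-2}\nabla U\qquad\text{in }\mathcal{D}'(B^n).$$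
   Context: $B^n\subset\mathbb{R}^n$ is the open unit ball centered at the origin. $so(m)$ denotes the real antisymmetric $m\times m$ matrices. An element $\Omega$ of a function space of maps $B^n\to so(m)\otimes\mathbb{R}^n$ is a tuple $\Omega=(\Omega_\alpha)_{\alpha=1}^n$ of measurable $so(m)$-valued functions. The product in the equation is the $\mathbb{R}^m$-valued function with components $$\bigl(\Omega\cdot|\nabla u|^{n-2}\nabla u\bigr)^i=\sum_{\alpha=1}^n\sum_{j=1}^m\Omega^{ij}_\alpha\,|\nabla u|^{n-2}\,\partial_\alpha u^j,\qquad i=1,\dots,m,$$ and here $m=n+2$. The divergence is taken componentwise, $|\nabla U|$ is the Euclidean (Hilbert–Schmidt) norm of the Jacobian, and $\nabla U$ is the weak gradient on $B^n$. The equation in $\mathcal D'(B^n)$ means that for all $\varphi\in C_c^\infty(B^n,\mathbb{R}^{n+2})$, $\int_{B^n}|\nabla U|^{n-2}\nabla U\cdot\nabla\varphi\,dx=\int_{B^n}(\Omega\cdot|\nabla U|^{n-2}\nabla U)\cdot\varphi\,dx$. $U$ being discontinuous at the origin means that $\lim_{x\to0}U(x)$ does not exist, so no choice of value at $0$ makes $U$ continuous there. $L^{(n,q)}$ is the Lorentz space: with $f^*$ the decreasing rearrangement of $|f|$ on $B^n$, $f\in L^{(n,q)}(B^n)$ iff $\int_0^\infty\bigl(s^{1/n}f^*(s)\bigr)^q\frac{ds}{s}<\infty$ when $q<\infty$, and iff $\sup_{s>0}s^{1/n}f^*(s)<\infty$ when $q=\infty$. *)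

theory Defs
  imports "HOL-Analysis.Analysis"
begin

section \<open>Lorentz spaces\<close>

text \<open>The rearrangement takes values in the extended half line, so that it is \<open>\<infinity>\<close> (and not an
  unspecified infimum) at those \<open>s\<close> for which no finite level is admissible.\<close>

definition decreasing_rearrangement ::
  "'a::euclidean_space set \<Rightarrow> ('a \<Rightarrow> 'b::real_normed_vector) \<Rightarrow> real \<Rightarrow> ennreal" where
  "decreasing_rearrangement S f s =
     Inf {l. emeasure lebesgue {x \<in> S. l < ennreal (norm (f x))} \<le> ennreal s}"

definition epowr :: "ennreal \<Rightarrow> real \<Rightarrow> ennreal" where
  "epowr x q = (if x = \<infinity> then \<infinity> else ennreal (enn2real x powr q))"

definition lorentz_space ::
  "real \<Rightarrow> ennreal \<Rightarrow> 'a::euclidean_space set \<Rightarrow> ('a \<Rightarrow> 'b::real_normed_vector) set" where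
  "lorentz_space r q S = {f. f \<in> borel_measurable (lebesgue_on S) \<and>
     (if q = \<infinity>
      then (SUP s\<in>{0<..}. ennreal (s powr (1 / r)) * decreasing_rearrangement S f s) < \<infinity>
      else (\<integral>\<^sup>+s\<in>{0<..}. epowr (ennreal (s powr (1 / r)) * decreasing_rearrangement S f s)
                           (enn2real q) * ennreal (1 / s) \<partial>lborel) < \<infinity>)}"

definition L_infinity :: "'a::euclidean_space set \<Rightarrow> ('a \<Rightarrow> 'b::real_normed_vector) set" where
  "L_infinity S = {f. f \<in> borel_measurable (lebesgue_on S) \<and>
     (\<exists>C::real. AE x in lebesgue_on S. norm (f x) \<le> C)}"


section \<open>Distributions\<close>

text \<open>Membership in \<open>C\<^sup>k\<close> on the whole space, by iterating directional derivatives.\<close>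

primrec continuously_differentiable ::
  "nat \<Rightarrow> ('a::euclidean_space \<Rightarrow> 'b::real_normed_vector) \<Rightarrow> bool" where
  "continuously_differentiable 0 f \<longleftrightarrow> continuous_on UNIV f"
| "continuously_differentiable (Suc k) f \<longleftrightarrow> (\<forall>x. f differentiable (at x)) \<and>
     (\<forall>v. continuously_differentiable k (\<lambda>x. frechet_derivative f (at x) v))"

text \<open>For open \<open>S\<close>, elements of \<open>C\<^sub>c\<^sup>\<infinity>(S)\<close> are represented by their extensions by zero.\<close>

definition test_function ::
  "'a::euclidean_space set \<Rightarrow> ('a \<Rightarrow> 'b::real_normed_vector) \<Rightarrow> bool" where
  "test_function S \<phi> \<longleftrightarrow> (\<forall>k. continuously_differentiable k \<phi>) \<and>
     compact (closure {x. \<phi> x \<noteq> 0}) \<and> closure {x. \<phi> x \<noteq> 0} \<subseteq> S"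

definition locally_integrable_on ::
  "('a::euclidean_space \<Rightarrow> 'b::euclidean_space) \<Rightarrow> 'a set \<Rightarrow> bool" (infixr "locally'_integrable'_on" 46)
  where
  "f locally_integrable_on S \<longleftrightarrow> (\<forall>K. compact K \<and> K \<subseteq> S \<longrightarrow> f absolutely_integrable_on K)"

text \<open>A gradient is a Jacobian matrix: \<open>G x $ i $ \<alpha>\<close> is the weak derivative of the \<open>i\<close>-th component
  in direction \<open>\<alpha>\<close>. The library norm and inner product on \<open>real^'n^'m\<close> are the Hilbert--Schmidt
  ones. Weak gradients are unique up to null sets.\<close>

definition has_weak_gradient_on ::
  "(real^'n \<Rightarrow> real^'m) \<Rightarrow> (real^'n \<Rightarrow> real^'n^'m) \<Rightarrow> (real^'n) set \<Rightarrow> bool" where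
  "has_weak_gradient_on u G S \<longleftrightarrow> u locally_integrable_on S \<and> G locally_integrable_on S \<and>
     (\<forall>\<phi>::real^'n \<Rightarrow> real. test_function S \<phi> \<longrightarrow>
       (\<forall>i \<alpha>. (LINT x:S|lebesgue. u x $ i * frechet_derivative \<phi> (at x) (axis \<alpha> 1)) =
              - (LINT x:S|lebesgue. G x $ i $ \<alpha> * \<phi> x)))"

text \<open>\<open>- div V = F\<close> in \<open>\<D>'(S)\<close>, the divergence being taken row by row. Both sides are required to be
  locally integrable, so that they define distributions and the integrals are meaningful.\<close>

definition minus_div_eq_distrib ::
  "(real^'n \<Rightarrow> real^'n^'m) \<Rightarrow> (real^'n \<Rightarrow> real^'m) \<Rightarrow> (real^'n) set \<Rightarrow> bool" where
  "minus_div_eq_distrib V F S \<longleftrightarrow> V locally_integrable_on S \<and> F locally_integrable_on S \<and>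
     (\<forall>\<phi>::real^'n \<Rightarrow> real^'m. test_function S \<phi> \<longrightarrow>
       (LINT x:S|lebesgue. V x \<bullet> jacobian \<phi> (at x)) = (LINT x:S|lebesgue. F x \<bullet> \<phi> x))"


section \<open>The map and the potential term\<close>

definition so_matrices :: "(real^'m^'m) set" where
  "so_matrices = {A. transpose A = - A}"

text \<open>For \<open>\<Omega> :: (real^'m^'m)^'n\<close>, the matrix \<open>\<Omega> $ \<alpha>\<close> is \<open>\<Omega>\<^sub>\<alpha>\<close>.\<close>

definition potential_apply :: "(real^'m^'m)^'n \<Rightarrow> real^'n^'m \<Rightarrow> real^'m" where
  "potential_apply \<Omega> G = (\<chi> i. \<Sum>\<alpha>\<in>UNIV. \<Sum>j\<in>UNIV. \<Omega> $ \<alpha> $ i $ j * G $ j $ \<alpha>)"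

text \<open>\<open>real^(2 + 'n)\<close> plays the role of \<open>\<real>\<^sup>n\<^sup>+\<^sup>2\<close>: the indices \<open>Inl 1\<close>, \<open>Inl 2\<close> are the first two
  coordinates and \<open>Inr a\<close> are the remaining \<open>n\<close> ones. The value at the origin is irrelevant.\<close>

definition U_map :: "real \<Rightarrow> real \<Rightarrow> real^'n \<Rightarrow> real^(2 + 'n)" where
  "U_map \<beta> T x =
     (let t = T + ln (1 / norm x) in
      \<chi> i. case i of
             Inl k \<Rightarrow> if k = 1 then cos (t powr (1 - \<beta>)) else sin (t powr (1 - \<beta>))
           | Inr a \<Rightarrow> t powr (- (\<beta> + 1 / 2)) * (x $ a / norm x))"

end

theory Submission
  imports Defs
begin

text \<open>
  Write \<open>r = |x|\<close>, \<open>\<omega> = x / r\<close> and \<open>t = T - ln r\<close>, so that \<open>U = (cos a, sin a, f \<omega>)\<close> with \<open>a = t^(1 - \<beta>)\<close>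
  and \<open>f = t^(-\<beta> - 1/2)\<close>. Then \<open>|\<nabla>U| = sqrt Q / r\<close> with \<open>Q = a'^2 + f'^2 + (n - 1) f^2\<close>. This is of order
  \<open>t^(-\<beta>) / r\<close>, and such a function lies in \<open>L^(n,p)\<close> as soon as \<open>\<beta> p > 1\<close>.

  Put \<open>N = Q^((n-2)/2)\<close>, \<open>\<kappa> = N' / N\<close>, and let \<open>\<nu> = (cos a, sin a, 0)\<close> and \<open>\<theta> = (- sin a, cos a, 0)\<close> be the
  rotating frame; vectors of dimension \<open>n\<close> are padded by two zeros. Away from the origin,
  \<open>- div (|\<nabla>U|^(n-2) \<nabla>U) = N r^(-n) (a'^2 \<nu> - (a'' + \<kappa> a') \<theta> + ((n - 1) f - f'' - \<kappa> f') \<omega>)\<close>.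
  The \<open>\<alpha>\<close>-th column of \<open>\<nabla>U\<close> is \<open>(- \<omega>\<^sub>\<alpha> (a' \<theta> + f' \<omega>) + f P\<^sub>\<alpha>) / r\<close> with \<open>P\<^sub>\<alpha> = e\<^sub>\<alpha> - \<omega>\<^sub>\<alpha> \<omega>\<close>, so
  the ansatz \<open>\<Omega>\<^sub>\<alpha> = (\<omega>\<^sub>\<alpha> (- a' \<nu> \<and> \<theta> + \<gamma> \<omega> \<and> \<theta>) + \<delta> \<theta> \<and> P\<^sub>\<alpha>) / r\<close> turns the equation into two scalar
  equations for \<open>\<gamma>\<close> and \<open>\<delta>\<close>. The exponent \<open>\<beta> + 1/2\<close> in \<open>f\<close> makes both of order \<open>t^(-1/2)\<close>, hence
  \<open>\<Omega>\<close> lies in \<open>L^(n,q)\<close> for all \<open>q > 2\<close>.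

  The origin does not contribute to the divergence: all terms that a cut-off near \<open>0\<close> produces in the
  weak formulation are dominated by \<open>t^(-2\<beta>) / r^n\<close>, which is integrable because \<open>2 \<beta> > 1\<close>.
\<close>

section \<open>Radial integrals and Lorentz norms\<close>

text \<open>The circle part alone cannot solve such an equation: its gradient columns are multiples
  of \<theta>, and an antisymmetric matrix sends \<theta> into its orthogonal complement, while the
  divergence has a component along \<theta>. The sphere part supplies columns along P_\<alpha>, from
  which \<delta> \<theta> \<and> P_\<alpha> produces \<theta>. The price is a divergence along
  \<omega>, which \<gamma> accounts for. If f were t^(-\<beta>-s), the coefficients would have sizes
  f / a' = t^(-s) and (a' / t) / f = t^(s-1); they balance at s = 1/2.

  Everything is estimated for t >= 1, which T >= 1 guarantees on the ball. All functions involved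
  are built from A(t), powers of r and components of \<omega>, and a derivative costs one factor
  1/r. Hence one majorant, t^(-2\<beta>) / r^n, serves for U, its gradient, the field
  |\<nabla>U|^(n-2) \<nabla>U and the derivatives of that field.

  Rearrangements are never computed: the pointwise bounds t^(-\<sigma>) / r decrease in r, so
  superlevel sets lie in balls. The gradient uses \<sigma> = \<beta>, the potential \<sigma> =
  1/2.\<close>

lemma nn_integral_log_powr_finite:
  fixes c L T \<tau> :: real
  assumes "c > 0" "L > 0" "T > 0" "\<tau> > 1"
  shows "(\<integral>\<^sup>+s\<in>{0<..<L}. ennreal ((T - c * ln (s / L)) powr (- \<tau>) / s) \<partial>lborel) < \<infinity>"
proof -
  define f where "f s = (T - c * ln (s / L)) powr (- \<tau>) / s" for s
  \<comment> \<open>\<open>F\<close> is an antiderivative of \<open>f\<close>, as the inner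
    expression has derivative -c / s. It tends to 0 at the left end because \<tau> > 1. Radial
    integrals use c = L = 1; Lorentz norms, whose variable is a volume, use c = 1/n and the volume
    of the unit ball for \<open>L\<close>.\<close>
  define F where "F s = (T - c * ln (s / L)) powr (1 - \<tau>) / (c * (\<tau> - 1))" for s
  have pos: "T - c * ln (s / L) > 0" if "0 < s" "s < L" for s
  proof -
    have "ln (s / L) < 0" using that assms by (simp add: ln_less_zero)
    then have "c * ln (s / L) < 0" using assms by (simp add: mult_pos_neg)
    then show ?thesis using assms by linarith
  qed
  have der: "DERIV F s :> f s" if "0 < s" "s < L" for s
  proof -
    have "((\<lambda>s. T - c * ln (s / L)) has_real_derivative - (c / s)) (at s)"
      using that assms by (auto intro!: derivative_eq_intros simp: field_simps)
    from DERIV_fun_powr[OF this pos[OF that], of "1 - \<tau>"]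
    have "((\<lambda>s. (T - c * ln (s / L)) powr (1 - \<tau>)) has_real_derivative
        f s * (c * (\<tau> - 1))) (at s)"
      by (rule DERIV_cong) (use that in \<open>simp add: f_def field_simps\<close>)
    from DERIV_cdivide[OF this, of "c * (\<tau> - 1)"]
    show ?thesis unfolding F_def using assms by simp
  qed
  have cont: "isCont f s" if "0 < s" "s < L" for s
    unfolding f_def using that assms pos[OF that] by (intro continuous_intros) auto
  have lim0: "(F \<longlongrightarrow> 0) (at_right 0)"
  proof -
    have "((\<lambda>s. s / L) \<longlongrightarrow> 0 / L) (at_right 0)"
      by (intro tendsto_intros) (use assms in auto)
    then have "filterlim (\<lambda>s. s / L) (at_right 0) (at_right 0)"
      unfolding filterlim_at using assms by (auto simp: eventually_at_filter)
    then have "filterlim (\<lambda>s. ln (s / L)) at_bot (at_right 0)"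
      by (rule filterlim_compose[OF ln_at_0])
    then have "filterlim (\<lambda>s. c * ln (s / L)) at_bot (at_right 0)"
      using assms by (simp add: filterlim_tendsto_pos_mult_at_bot[OF tendsto_const])
    then have "filterlim (\<lambda>s. - (c * ln (s / L))) at_top (at_right 0)"
      by (simp add: filterlim_uminus_at_top)
    then have "filterlim (\<lambda>s. T + - (c * ln (s / L))) at_top (at_right 0)"
      by (rule filterlim_tendsto_add_at_top[OF tendsto_const])
    then have "filterlim (\<lambda>s. T - c * ln (s / L)) at_top (at_right 0)" by simp
    then have "((\<lambda>s. (T - c * ln (s / L)) powr (1 - \<tau>)) \<longlongrightarrow> 0) (at_right 0)"
      by (rule tendsto_neg_powr[rotated]) (use assms in auto)
    then show ?thesis unfolding F_def by (rule tendsto_divide_zero)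
  qed
  have limL: "(F \<longlongrightarrow> F L) (at_left L)"
  proof -
    have "isCont F L" unfolding F_def using assms by (intro continuous_intros) auto
    then show ?thesis by (simp add: isCont_def filterlim_at_split)
  qed
  have "set_integrable lborel (einterval (ereal 0) (ereal L)) f"
  proof (rule interval_integral_FTC_nonneg)
    show "AE x in lborel. ereal 0 < ereal x \<longrightarrow> ereal x < ereal L \<longrightarrow> 0 \<le> f x"
      by (auto simp: f_def)
    show "((F \<circ> real_of_ereal) \<longlongrightarrow> 0) (at_right (ereal 0))"
      "((F \<circ> real_of_ereal) \<longlongrightarrow> F L) (at_left (ereal L))"
      using lim0 limL by (simp_all add: ereal_tendsto_simps1)
  qed (use assms der cont in auto)
  then have *: "integrable lborel (\<lambda>x. indicator {0<..<L} x *\<^sub>R f x)"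
    by (simp add: set_integrable_def)
  have "(\<integral>\<^sup>+s\<in>{0<..<L}. ennreal (f s) \<partial>lborel)
      = (\<integral>\<^sup>+x. ennreal (norm (indicator {0<..<L} x *\<^sub>R f x)) \<partial>lborel)"
    by (intro nn_integral_cong) (auto simp: f_def indicator_def)
  also have "\<dots> < \<infinity>" using * by (simp add: integrable_iff_bounded)
  finally show ?thesis by (simp add: f_def)
qed

text \<open>Both sides integrate \<open>g\<close> against a measure on the line: the image of
  Lebesgue measure on the ball under \<open>norm\<close>, and the one with the stated density.
  Measures that are finite and equal on all half-lines \<open>{a<..}\<close> coincide, so only
  volumes of balls have to be compared and no measure on the sphere enters.\<close>

lemma nn_integral_radial_unit_ball:
  fixes g :: "real \<Rightarrow> ennreal"
  assumes [measurable]: "g \<in> borel_measurable borel"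
  defines "n \<equiv> DIM('a::euclidean_space)"
  shows "(\<integral>\<^sup>+x\<in>ball (0::'a) 1. g (norm x) \<partial>lborel) =
    (\<integral>\<^sup>+\<rho>\<in>{0<..<1}. g \<rho> * ennreal (real n * unit_ball_vol n * \<rho> ^ (n - 1)) \<partial>lborel)"
proof -
  define h where "h \<rho> = indicator {0<..<1} \<rho> * ennreal (real n * unit_ball_vol n * \<rho> ^ (n - 1))" for \<rho> :: real
  have [measurable]: "h \<in> borel_measurable borel" unfolding h_def by measurable
  define M where "M = distr (density lborel (indicator (ball (0::'a) 1))) borel norm"
  define N where "N = density lborel h"
  have n: "n > 0" by (simp add: n_def)
  have eqM: "emeasure M {a<..} = emeasure lborel {x::'a. norm x < 1 \<and> a < norm x}" for a
  proof -
    have "emeasure M {a<..} = emeasure (density lborel (indicator (ball (0::'a) 1))) {x. a < norm x}"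
      unfolding M_def by (subst emeasure_distr) (auto simp: vimage_def)
    also have "\<dots> = (\<integral>\<^sup>+x. indicator (ball (0::'a) 1) x * indicator {x. a < norm x} x \<partial>lborel)"
      by (subst emeasure_density) (auto intro!: borel_measurable_indicator)
    also have "\<dots> = (\<integral>\<^sup>+x. indicator {x::'a. norm x < 1 \<and> a < norm x} x \<partial>lborel)"
      by (intro nn_integral_cong) (auto simp: indicator_def)
    finally show ?thesis by simp
  qed
  have shell: "emeasure lborel {x::'a. norm x < 1 \<and> a < norm x} = ennreal (unit_ball_vol n * (1 - a ^ n))"
    if "0 \<le> a" "a < 1" for a
  proof -
    have "{x::'a. norm x < 1 \<and> a < norm x} = ball 0 1 - cball 0 a" by auto
    also have "emeasure lborel \<dots> = emeasure lborel (ball (0::'a) 1) - emeasure lborel (cball (0::'a) a)"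
      by (rule emeasure_Diff) (use that in \<open>auto simp: emeasure_cball\<close>)
    also have "\<dots> = ennreal (unit_ball_vol n * (1 - a ^ n))"
      using that by (simp add: emeasure_ball emeasure_cball n_def ennreal_minus algebra_simps)
    finally show ?thesis .
  qed
  have eqN: "emeasure N {a<..} = ennreal (unit_ball_vol n * (1 - a ^ n))" if "0 \<le> a" "a < 1" for a
  proof -
    have "emeasure N {a<..} = (\<integral>\<^sup>+\<rho>. h \<rho> * indicator {a<..} \<rho> \<partial>lborel)"
      unfolding N_def by (subst emeasure_density) auto
    \<comment> \<open>The two endpoints are null, which gives the closed interval that the
      fundamental theorem of calculus asks for.\<close>
    also have "\<dots> = (\<integral>\<^sup>+\<rho>. ennreal (real n * unit_ball_vol n * \<rho> ^ (n - 1)) * indicator {a..1} \<rho> \<partial>lborel)"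
    proof (rule nn_integral_cong_AE)
      have "AE \<rho> in lborel. \<rho> \<noteq> a \<and> \<rho> \<noteq> 1"
        using AE_lborel_singleton[of a] AE_lborel_singleton[of 1] by auto
      then show "AE \<rho> in lborel. h \<rho> * indicator {a<..} \<rho> =
          ennreal (real n * unit_ball_vol n * \<rho> ^ (n - 1)) * indicator {a..1} \<rho>"
        using that by (auto simp: h_def indicator_def)
    qed
    also have "\<dots> = ennreal (unit_ball_vol n * 1 ^ n - unit_ball_vol n * a ^ n)"
    proof (rule nn_integral_FTC_Icc)
      show "DERIV (\<lambda>\<rho>. unit_ball_vol (real n) * \<rho> ^ n) x :> real n * unit_ball_vol n * x ^ (n - 1)" for x
        by (auto intro!: derivative_eq_intros)
    qed (use that in auto)
    finally show ?thesis by (simp add: algebra_simps)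
  qed
  have "M = N"
  proof (rule measure_eqI_lessThan)
    show "sets M = sets borel" "sets N = sets borel" by (simp_all add: M_def N_def)
    have "emeasure M {a<..} \<le> emeasure lborel (ball (0::'a) 1)" for a
      unfolding eqM by (rule emeasure_mono) auto
    also have "emeasure lborel (ball (0::'a) 1) < \<infinity>" by (simp add: emeasure_ball)
    finally show "emeasure M {a<..} < \<infinity>" for a .
    show "emeasure M {a<..} = emeasure N {a<..}" for a
    proof -
      consider "0 \<le> a" "a < 1" | "a \<ge> 1" | "a < 0" by linarith
      then show ?thesis
      proof cases
        case 1
        then show ?thesis by (simp add: eqM shell eqN)
      next
        case 2
        then have "{x::'a. norm x < 1 \<and> a < norm x} = {}" by auto
        then have "emeasure M {a<..} = 0" unfolding eqM by (metis emeasure_empty)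
        moreover have "emeasure N {a<..} = (\<integral>\<^sup>+\<rho>. 0 \<partial>(lborel::real measure))"
          unfolding N_def by (subst emeasure_density, simp, simp, intro nn_integral_cong)
            (use 2 in \<open>auto simp: h_def indicator_def\<close>)
        ultimately show ?thesis by simp
      next
        case 3
        have "{x::'a. norm x < 1 \<and> a < norm x} = ball 0 1"
          using 3 by (auto intro: less_le_trans[OF _ norm_ge_zero])
        then have "emeasure M {a<..} = ennreal (unit_ball_vol n)"
          by (simp add: eqM emeasure_ball n_def)
        also have "\<dots> = emeasure N {0<..}" using n by (simp add: eqN zero_power)
        also have "\<dots> = emeasure N {a<..}"
          unfolding N_def by (subst (1 2) emeasure_density, simp_all, intro nn_integral_cong)
            (use 3 in \<open>auto simp: h_def indicator_def\<close>)
        finally show ?thesis .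
      qed
    qed
  qed
  have "(\<integral>\<^sup>+x\<in>ball (0::'a) 1. g (norm x) \<partial>lborel) = (\<integral>\<^sup>+x. g (norm x) \<partial>density lborel (indicator (ball (0::'a) 1)))"
    by (subst nn_integral_density) (auto simp: mult.commute intro!: borel_measurable_indicator)
  also have "\<dots> = (\<integral>\<^sup>+\<rho>. g \<rho> \<partial>M)"
    unfolding M_def by (subst nn_integral_distr) auto
  also have "\<dots> = (\<integral>\<^sup>+\<rho>. h \<rho> * g \<rho> \<partial>lborel)"
    unfolding \<open>M = N\<close> N_def by (subst nn_integral_density) auto
  also have "\<dots> = (\<integral>\<^sup>+\<rho>\<in>{0<..<1}. g \<rho> * ennreal (real n * unit_ball_vol n * \<rho> ^ (n - 1)) \<partial>lborel)"
    by (intro nn_integral_cong) (auto simp: h_def mult_ac)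
  finally show ?thesis .
qed

text \<open>With t = T - ln r this is t^(-\<tau>) / r^n: the borderline power of r, made integrable
  at the origin by the logarithm when \<tau> > 1. Division by zero gives the value 0 at the
  origin.\<close>

definition log_weight :: "real \<Rightarrow> real \<Rightarrow> 'a::euclidean_space \<Rightarrow> real" where
  "log_weight T \<tau> x = (T - ln (norm x)) powr (- \<tau>) / norm x ^ DIM('a)"

lemma log_weight_nonneg: "log_weight T \<tau> x \<ge> 0"
  by (simp add: log_weight_def)

lemma borel_measurable_log_weight [measurable]: "log_weight T \<tau> \<in> borel_measurable borel"
  unfolding log_weight_def[abs_def] by measurable

lemma set_integrable_log_weight:
  assumes "T > 0" "\<tau> > 1"
  shows "set_integrable lborel (ball (0::'a::euclidean_space) 1) (log_weight T \<tau>)"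
proof -
  define n where "n = DIM('a)"
  define c where "c = real n * unit_ball_vol n"
  have c: "c \<ge> 0" by (simp add: c_def)
  have n: "n > 0" by (simp add: n_def)
  define g where "g \<rho> = ennreal ((T - ln \<rho>) powr (- \<tau>) / \<rho> ^ n)" for \<rho> :: real
  have [measurable]: "g \<in> borel_measurable borel" unfolding g_def by measurable
  have "(\<integral>\<^sup>+x. ennreal (norm (indicator (ball (0::'a) 1) x *\<^sub>R log_weight T \<tau> x)) \<partial>lborel)
      = (\<integral>\<^sup>+x\<in>ball (0::'a) 1. g (norm x) \<partial>lborel)"
    by (intro nn_integral_cong) (auto simp: g_def log_weight_def n_def indicator_def)
  also have "\<dots> = (\<integral>\<^sup>+\<rho>\<in>{0<..<1}. g \<rho> * ennreal (c * \<rho> ^ (n - 1)) \<partial>lborel)"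
    unfolding c_def n_def by (rule nn_integral_radial_unit_ball) simp
  also have "\<dots> = (\<integral>\<^sup>+\<rho>. ennreal c * (ennreal ((T - 1 * ln (\<rho> / 1)) powr (- \<tau>) / \<rho>) * indicator {0<..<1} \<rho>) \<partial>lborel)"
  proof (intro nn_integral_cong)
    fix \<rho> :: real
    show "g \<rho> * ennreal (c * \<rho> ^ (n - 1)) * indicator {0<..<1} \<rho> =
      ennreal c * (ennreal ((T - 1 * ln (\<rho> / 1)) powr (- \<tau>) / \<rho>) * indicator {0<..<1} \<rho>)"
    proof (cases "\<rho> \<in> {0<..<1}")
      case True
      have "\<rho> ^ n = \<rho> * \<rho> ^ (n - 1)" using n by (metis power_minus_mult mult.commute)
      then show ?thesis using True c
        by (simp add: g_def ennreal_mult[symmetric])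
    qed auto
  qed
  also have "\<dots> = ennreal c * (\<integral>\<^sup>+\<rho>\<in>{0<..<1}. ennreal ((T - 1 * ln (\<rho> / 1)) powr (- \<tau>) / \<rho>) \<partial>lborel)"
    by (rule nn_integral_cmult) measurable
  also have "\<dots> < \<infinity>"
    using nn_integral_log_powr_finite[of 1 1 T \<tau>] assms by (simp add: ennreal_mult_less_top)
  finally show ?thesis
    unfolding set_integrable_def integrable_iff_bounded
    by (intro conjI borel_measurable_scaleR borel_measurable_indicator) auto
qed

section \<open>Lorentz membership from a pointwise logarithmic bound\<close>

lemma epowr_le:
  assumes "x \<le> ennreal y" "y \<ge> 0" "q \<ge> 0"
  shows "epowr x q \<le> ennreal (y powr q)"
proof -
  have "x \<noteq> \<infinity>" using assms(1) by (auto simp: top_unique)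
  moreover have "enn2real x \<le> y" using assms(1,2) by (rule enn2real_leI[rotated])
  ultimately show ?thesis
    using assms by (auto simp: epowr_def intro!: ennreal_leI powr_mono2)
qed

text \<open>Passing from radius s down to r multiplies t by p = 1 + ln (s / r) / t(s). Since t(s) >=
  1, p is at most 1 + ln (s / r), hence at most s / r; and \<sigma> <= 1 gives p^\<sigma> <= p. So
  the loss in the logarithm is paid for by the gain in 1/r.\<close>

lemma log_profile_antimono:
  fixes r s T \<sigma> :: real
  assumes "0 < r" "r \<le> s" "s \<le> 1" "0 \<le> \<sigma>" "\<sigma> \<le> 1" "1 \<le> T"
  shows "(T - ln s) powr (- \<sigma>) / s \<le> (T - ln r) powr (- \<sigma>) / r"
proof -
  have ls: "ln s \<le> 0" "ln r \<le> 0" using assms by auto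
  define p where "p = (T - ln r) / (T - ln s)"
  have Ts: "T - ln s > 0" using ls assms by linarith
  have "ln s \<ge> ln r" using assms by simp
  then have "T - ln s \<le> T - ln r" by linarith
  then have p1: "p \<ge> 1" unfolding p_def by (simp only: le_divide_eq_1_pos[OF Ts])
  have pp: "T - ln r = p * (T - ln s)" using Ts by (simp add: p_def)
  have "p = 1 + ln (s / r) / (T - ln s)"
    using Ts assms by (simp add: p_def ln_div field_simps)
  also have "ln (s / r) / (T - ln s) \<le> ln (s / r) / 1"
  proof (rule divide_left_mono)
    show "1 \<le> T - ln s" using ls assms by linarith
  qed (use Ts assms in simp_all)
  also have "1 + ln (s / r) / 1 \<le> s / r"
    using ln_add_one_self_le_self2[of "s / r - 1"] assms by (simp add: field_simps)
  finally have "p \<le> s / r" by simp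
  moreover have "p powr \<sigma> \<le> p powr 1" using p1 assms by (intro powr_mono) auto
  ultimately have "p powr \<sigma> \<le> s / r" using p1 by simp
  then have "r * p powr \<sigma> \<le> s" using assms by (simp add: field_simps)
  then have *: "inverse s \<le> inverse (r * p powr \<sigma>)" using assms p1 by (intro le_imp_inverse_le) auto
  have "(T - ln r) powr (- \<sigma>) = p powr (- \<sigma>) * (T - ln s) powr (- \<sigma>)"
    unfolding pp by (rule powr_mult)
  then have "(T - ln r) powr (- \<sigma>) / r = (T - ln s) powr (- \<sigma>) * inverse (r * p powr \<sigma>)"
    by (simp add: powr_minus divide_inverse)
  moreover have "(T - ln s) powr (- \<sigma>) * inverse s \<le> (T - ln s) powr (- \<sigma>) * inverse (r * p powr \<sigma>)"
    using * by (rule mult_left_mono) simp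
  ultimately show ?thesis by (simp only: divide_inverse)
qed

text \<open>The bound is radially decreasing, so it controls the rearrangement by its value on the
  sphere enclosing volume s. After multiplication by s^(1/n) only a power of the logarithm of s is
  left, and its q-th power is integrable against ds / s when \<sigma> q > 1; for q = \<infinity>
  boundedness is enough.\<close>

lemma lorentz_space_log_bound:
  fixes f :: "'a::euclidean_space \<Rightarrow> 'b::real_normed_vector"
  assumes meas: "f \<in> borel_measurable (lebesgue_on (ball 0 1))"
    and bound: "\<And>x. x \<in> ball 0 1 \<Longrightarrow> norm (f x) \<le> C * ((T - ln (norm x)) powr (- \<sigma>) / norm x)"
    and C: "C \<ge> 0" and \<sigma>: "0 \<le> \<sigma>" "\<sigma> \<le> 1" and T: "1 \<le> T"
    and q: "q = \<infinity> \<or> 1 < \<sigma> * enn2real q"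
  shows "f \<in> lorentz_space (real DIM('a)) q (ball 0 1)"
proof -
  define n where "n = DIM('a)"
  have n: "n > 0" by (simp add: n_def)
  define \<omega> where "\<omega> = unit_ball_vol (real n)"
  have \<omega>: "\<omega> > 0" by (simp add: \<omega>_def)
  define K where "K = C * \<omega> powr (1 / n)"
  have K: "K \<ge> 0" using C by (simp add: K_def)
  define \<phi> where "\<phi> s = (T - 1 / n * ln (s / \<omega>)) powr (- \<sigma>)" for s
  define y where "y s = (if s < \<omega> then K * \<phi> s else 0)" for s
  have y0: "y s \<ge> 0" for s using K by (simp add: y_def \<phi>_def)
  have main: "ennreal (s powr (1 / n)) * decreasing_rearrangement (ball 0 1) f s \<le> ennreal (y s)"
    if s: "s > 0" for s
  proof (cases "s < \<omega>")
    \<comment> \<open>Once \<open>s\<close> reaches the volume of the ball, level 0 is admissible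
      and the rearrangement vanishes.\<close>
    case False
    have "emeasure lebesgue {x \<in> ball 0 1. 0 < ennreal (norm (f x))} \<le> emeasure lebesgue (ball (0::'a) 1)"
      by (rule emeasure_mono) auto
    also have "\<dots> = ennreal \<omega>" by (simp add: emeasure_ball \<omega>_def n_def)
    also have "\<dots> \<le> ennreal s" using False by (intro ennreal_leI) simp
    finally have "decreasing_rearrangement (ball 0 1) f s \<le> 0"
      unfolding decreasing_rearrangement_def by (intro Inf_lower) simp
    then show ?thesis by simp
  next
    case True
    \<comment> \<open>\<rho> is the radius of the ball of volume \<open>s\<close>. By monotonicity
      the set where |f| exceeds the level \<open>l\<close> found at this radius lies inside that
      ball.\<close>
    define \<rho> where "\<rho> = (s / \<omega>) powr (1 / n)"
    have \<rho>: "\<rho> > 0" using s \<omega> by (simp add: \<rho>_def)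
    have \<rho>1: "\<rho> < 1"
      unfolding \<rho>_def using powr_less_mono2[of "1 / n" "s / \<omega>" 1] s \<omega> True n by simp
    have \<rho>n: "\<omega> * \<rho> ^ n = s"
      using s \<omega> n by (simp add: \<rho>_def powr_power)
    have ln\<rho>: "ln \<rho> = 1 / n * ln (s / \<omega>)" using s \<omega> by (simp add: \<rho>_def ln_powr)
    define l where "l = C * ((T - ln \<rho>) powr (- \<sigma>) / \<rho>)"
    have l0: "l \<ge> 0" using C \<rho> by (simp add: l_def)
    have "{x \<in> ball 0 1. ennreal l < ennreal (norm (f x))} \<subseteq> ball 0 \<rho>"
    proof safe
      fix x :: 'a assume x: "x \<in> ball 0 1" "ennreal l < ennreal (norm (f x))"
      have "\<not> \<rho> \<le> norm x"
      proof
        assume "\<rho> \<le> norm x"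
        then have "norm (f x) \<le> l"
          unfolding l_def using bound[OF x(1)] x(1) \<rho> \<sigma> T C
          by (elim order_trans, intro mult_left_mono log_profile_antimono) auto
        with x(2) l0 show False by (simp add: ennreal_less_iff)
      qed
      then show "x \<in> ball 0 \<rho>" by simp
    qed
    then have "emeasure lebesgue {x \<in> ball 0 1. ennreal l < ennreal (norm (f x))} \<le> emeasure lebesgue (ball (0::'a) \<rho>)"
      by (rule emeasure_mono) auto
    also have "\<dots> = ennreal s" using \<rho> \<rho>n by (simp add: emeasure_ball \<omega>_def n_def)
    finally have "decreasing_rearrangement (ball 0 1) f s \<le> ennreal l"
      unfolding decreasing_rearrangement_def by (intro Inf_lower) simp
    then have "ennreal (s powr (1 / n)) * decreasing_rearrangement (ball 0 1) f s \<le> ennreal (s powr (1 / n)) * ennreal l"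
      by (rule mult_left_mono) simp
    also have "\<dots> = ennreal (s powr (1 / n) * l)" using l0 by (simp add: ennreal_mult)
    \<comment> \<open>The factor s^(1/n) cancels the 1/\<rho> in the level.\<close>
    also have "s powr (1 / n) * l = K * \<phi> s"
    proof -
      have "s powr (1 / n) = \<omega> powr (1 / n) * \<rho>" using s \<omega> by (simp add: \<rho>_def powr_divide)
      then show ?thesis using \<rho> by (simp add: l_def K_def \<phi>_def ln\<rho>)
    qed
    finally show ?thesis using True by (simp add: y_def)
  qed
  have pos: "T - 1 / n * ln (s / \<omega>) \<ge> 1" if "0 < s" "s < \<omega>" for s
  proof -
    have "ln (s / \<omega>) < 0" using that \<omega> by (simp add: ln_less_zero)
    then have "1 / n * ln (s / \<omega>) \<le> 0" using n by (simp add: mult_nonneg_nonpos divide_nonpos_nonneg)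
    then show ?thesis using T by linarith
  qed
  show ?thesis
  proof (cases "q = \<infinity>")
    case True
    have "ennreal (s powr (1 / n)) * decreasing_rearrangement (ball 0 1) f s \<le> ennreal K" if "s > 0" for s
    proof -
      have "\<phi> s \<le> 1" if "s < \<omega>"
        unfolding \<phi>_def using pos[OF \<open>s > 0\<close> that] \<sigma> by (auto simp: powr_minus ge_one_powr_ge_zero inverse_le_1_iff)
      then have "y s \<le> K" using K by (auto simp: y_def mult_left_le)
      then show ?thesis using main[OF that] by (elim order_trans) (rule ennreal_leI)
    qed
    then have "(SUP s\<in>{0<..}. ennreal (s powr (1 / n)) * decreasing_rearrangement (ball 0 1) f s) \<le> ennreal K"
      by (intro SUP_least) auto
    also have "\<dots> < \<infinity>" by simp
    finally show ?thesis using meas True by (simp add: lorentz_space_def n_def)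
  next
    case False
    define q' where "q' = enn2real q"
    have q': "1 < \<sigma> * q'" using q False by (simp add: q'_def)
    then have q0: "q' > 0" using \<sigma> by (smt (verit) mult_nonneg_nonpos)
    have "(\<integral>\<^sup>+s\<in>{0<..}. epowr (ennreal (s powr (1 / n)) * decreasing_rearrangement (ball 0 1) f s) q' * ennreal (1 / s) \<partial>lborel)
       \<le> (\<integral>\<^sup>+s. ennreal (K powr q') * (ennreal ((T - 1 / n * ln (s / \<omega>)) powr (- (\<sigma> * q')) / s) * indicator {0<..<\<omega>} s) \<partial>lborel)"
    proof (intro nn_integral_mono)
      fix s :: real
      show "epowr (ennreal (s powr (1 / n)) * decreasing_rearrangement (ball 0 1) f s) q' * ennreal (1 / s) * indicator {0<..} s
        \<le> ennreal (K powr q') * (ennreal ((T - 1 / n * ln (s / \<omega>)) powr (- (\<sigma> * q')) / s) * indicator {0<..<\<omega>} s)"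
      proof (cases "s > 0")
        case True
        have "epowr (ennreal (s powr (1 / n)) * decreasing_rearrangement (ball 0 1) f s) q' * ennreal (1 / s)
           \<le> ennreal (y s powr q') * ennreal (1 / s)"
          using epowr_le[OF main[OF True] y0] q0 by (intro mult_right_mono) auto
        also have "\<dots> = ennreal (y s powr q' / s)" using True by (simp add: ennreal_mult[symmetric])
        also have "\<dots> = ennreal (K powr q') * (ennreal ((T - 1 / n * ln (s / \<omega>)) powr (- (\<sigma> * q')) / s) * indicator {0<..<\<omega>} s)"
        proof (cases "s < \<omega>")
          case True
          then show ?thesis
            using \<open>s > 0\<close> K by (simp add: y_def \<phi>_def powr_mult powr_powr ennreal_mult[symmetric])
        qed (simp add: y_def)
        finally show ?thesis using True by simp
      qed simp
    qed
    also have "\<dots> = ennreal (K powr q') * (\<integral>\<^sup>+s\<in>{0<..<\<omega>}. ennreal ((T - 1 / n * ln (s / \<omega>)) powr (- (\<sigma> * q')) / s) \<partial>lborel)"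
      by (rule nn_integral_cmult) measurable
    also have "\<dots> < \<infinity>"
      using nn_integral_log_powr_finite[of "1 / n" \<omega> T "\<sigma> * q'"] n \<omega> T q' by (simp add: ennreal_mult_less_top)
    finally show ?thesis using meas False by (simp add: lorentz_space_def n_def q'_def)
  qed
qed

section \<open>Integration by parts across a point singularity\<close>

text \<open>Difference quotients have integral \<open>0\<close> by translation invariance, so no Fubini argument is needed.\<close>

lemma integral_directional_derivative_eq_0:
  fixes \<psi> d :: "'a::euclidean_space \<Rightarrow> real"
  assumes der: "\<And>x. ((\<lambda>s. \<psi> (x + s *\<^sub>R e)) has_real_derivative d x) (at 0)"
    and bdd: "\<And>x. \<bar>d x\<bar> \<le> M"
    and supp: "\<And>x. norm x > R \<Longrightarrow> \<psi> x = 0"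
    and int: "integrable lborel \<psi>"
  shows "integral\<^sup>L lborel d = 0"
proof -
  have [measurable]: "\<psi> \<in> borel_measurable borel"
    using int by (auto dest: borel_measurable_integrable)
  define h where "h k = 1 / real (Suc k)" for k
  have h: "0 < h k" "h k \<le> 1" for k by (auto simp: h_def field_simps)
  define D where "D k x = (\<psi> (x + h k *\<^sub>R e) - \<psi> x) / h k" for k x
  have [measurable]: "D k \<in> borel_measurable borel" for k
    unfolding D_def by measurable
  have h0: "h \<longlonglongrightarrow> 0" unfolding h_def by (rule LIMSEQ_Suc[OF lim_1_over_n])
  have lim: "(\<lambda>k. D k x) \<longlonglongrightarrow> d x" for x
  proof -
    have "((\<lambda>s. (\<psi> (x + s *\<^sub>R e) - \<psi> x) / s) \<longlongrightarrow> d x) (at 0)"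
      using der[of x] by (simp add: DERIV_def)
    moreover have "filterlim h (at 0) sequentially"
      unfolding filterlim_at using h0 h(1) by (auto simp: less_le)
    ultimately show ?thesis unfolding D_def by (rule filterlim_compose)
  qed
  have D_le: "\<bar>D k x\<bar> \<le> M" for k x
  proof -
    \<comment> \<open>The hypothesis speaks of s = 0 only; moving the base point along
      \<open>e\<close> gives the derivative along the whole line, as the mean value theorem
      requires.\<close>
    have "((\<lambda>s. \<psi> (x + s *\<^sub>R e)) has_real_derivative d (x + s *\<^sub>R e)) (at s)" for s
      using der[of "x + s *\<^sub>R e"] DERIV_shift[of "\<lambda>s. \<psi> (x + s *\<^sub>R e)" _ 0 s]
      by (simp add: algebra_simps)
    from MVT2[OF h(1)[of k], of "\<lambda>s. \<psi> (x + s *\<^sub>R e)" "\<lambda>s. d (x + s *\<^sub>R e)"] this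
    obtain z where "\<psi> (x + h k *\<^sub>R e) - \<psi> x = h k * d (x + z *\<^sub>R e)" by auto
    then show ?thesis using h(1)[of k] bdd by (simp add: D_def)
  qed
  have M: "M \<ge> 0" using bdd[of 0] by linarith
  \<comment> \<open>Since \<open>h k\<close> <= 1, the quotients vanish outside the ball enlarged by
    the length of \<open>e\<close>; inside it the mean value bound \<open>M\<close> is the
    majorant.\<close>
  have bound: "norm (D k x) \<le> indicator (cball 0 (R + norm e)) x *\<^sub>R M" for k x
  proof (cases "x \<in> cball 0 (R + norm e)")
    case False
    have "norm x \<le> norm (x + h k *\<^sub>R e) + norm (h k *\<^sub>R e)"
      using norm_triangle_ineq4[of "x + h k *\<^sub>R e" "h k *\<^sub>R e"] by simp
    moreover have "norm (h k *\<^sub>R e) \<le> norm e" using h[of k] by (simp add: mult_left_le_one_le)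
    moreover have "norm e \<ge> 0" by simp
    moreover have "norm x > R + norm e" using False by simp
    ultimately have "norm (x + h k *\<^sub>R e) > R" "norm x > R" by linarith+
    then show ?thesis using supp M by (simp add: D_def)
  qed (use D_le in auto)
  have "(\<lambda>k. integral\<^sup>L lborel (D k)) \<longlonglongrightarrow> integral\<^sup>L lborel d"
  proof (rule integral_dominated_convergence[where w = "\<lambda>x. indicator (cball 0 (R + norm e)) x *\<^sub>R M"])
    show "d \<in> borel_measurable lborel"
      by (rule borel_measurable_LIMSEQ_real[OF lim]) simp
    show "integrable lborel (\<lambda>x. indicator (cball (0::'a) (R + norm e)) x *\<^sub>R M)"
      by (intro integrable_indicator) (use emeasure_bounded_finite[OF bounded_cball] in simp_all)
  qed (use lim bound in auto)
  moreover have "integral\<^sup>L lborel (D k) = 0" for k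
  proof -
    have eq: "integrable lborel (\<lambda>x. \<psi> (h k *\<^sub>R e + x))" "(\<integral>x. \<psi> (h k *\<^sub>R e + x) \<partial>lborel) = integral\<^sup>L lborel \<psi>"
    proof -
      have "integrable (distr lborel borel ((+) (h k *\<^sub>R e))) \<psi>"
        using int by (simp only: lborel_distr_plus)
      then show "integrable lborel (\<lambda>x. \<psi> (h k *\<^sub>R e + x))"
        by (subst (asm) integrable_distr_eq) auto
      have "integral\<^sup>L (distr lborel borel ((+) (h k *\<^sub>R e))) \<psi> = (\<integral>x. \<psi> (h k *\<^sub>R e + x) \<partial>lborel)"
        by (rule integral_distr) auto
      then show "(\<integral>x. \<psi> (h k *\<^sub>R e + x) \<partial>lborel) = integral\<^sup>L lborel \<psi>"
        by (simp only: lborel_distr_plus)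
    qed
    have "integral\<^sup>L lborel (D k) = ((\<integral>x. \<psi> (h k *\<^sub>R e + x) \<partial>lborel) - integral\<^sup>L lborel \<psi>) / h k"
      unfolding D_def using eq(1) int by (simp add: add.commute)
    then show ?thesis using eq(2) by simp
  qed
  ultimately show ?thesis by (simp add: LIMSEQ_const_iff)
qed

text \<open>\<open>(max 0 (r\<^sup>2 - \<epsilon>\<^sup>2) / r\<^sup>2)\<^sup>2\<close> is continuously differentiable with gradient of size at most \<open>4 / r\<close> uniformly in
  \<open>\<epsilon>\<close>. The quotient is arranged so that division by zero gives the right value \<open>0\<close> at the origin.\<close>

definition cutoff :: "real \<Rightarrow> 'a::euclidean_space \<Rightarrow> real" where
  "cutoff \<epsilon> x = (max 0 ((norm x)\<^sup>2 - \<epsilon>\<^sup>2) / (norm x)\<^sup>2)\<^sup>2"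

definition cutoff_deriv :: "real \<Rightarrow> 'a::euclidean_space \<Rightarrow> 'a \<Rightarrow> real" where
  "cutoff_deriv \<epsilon> e x = 4 * (x \<bullet> e) * max 0 ((norm x)\<^sup>2 - \<epsilon>\<^sup>2) * \<epsilon>\<^sup>2 / (norm x) ^ 6"

lemma borel_measurable_cutoff [measurable]:
  "cutoff \<epsilon> \<in> borel_measurable borel" "cutoff_deriv \<epsilon> e \<in> borel_measurable borel"
  unfolding cutoff_def[abs_def] cutoff_deriv_def[abs_def] by measurable

lemma cutoff_bounds: "0 \<le> cutoff \<epsilon> x" "cutoff \<epsilon> x \<le> 1"
proof -
  show "0 \<le> cutoff \<epsilon> x" by (simp add: cutoff_def)
  have "max 0 ((norm x)\<^sup>2 - \<epsilon>\<^sup>2) / (norm x)\<^sup>2 \<le> 1"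
    by (cases "x = 0") (auto simp: divide_le_eq)
  then show "cutoff \<epsilon> x \<le> 1"
    unfolding cutoff_def by (intro power_le_one) auto
qed

lemma cutoff_eq_0:
  assumes "norm x \<le> \<epsilon>"
  shows "cutoff \<epsilon> x = 0" "cutoff_deriv \<epsilon> e x = 0"
proof -
  have "(norm x)\<^sup>2 \<le> \<epsilon>\<^sup>2" using assms by (intro power_mono) auto
  then show "cutoff \<epsilon> x = 0" "cutoff_deriv \<epsilon> e x = 0"
    by (simp_all add: cutoff_def cutoff_deriv_def max_def)
qed

text \<open>Where the derivative is not 0 one has r > \<epsilon>, so both r^2 - \<epsilon>^2 and
  \<epsilon>^2 are at most r^2 and the numerator is at most 4 r^5. The absence of \<epsilon> in the
  bound is what makes dominated convergence possible as \<epsilon> tends to 0.\<close>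

lemma cutoff_deriv_bound:
  assumes "norm e = 1" "\<epsilon> > 0"
  shows "\<bar>cutoff_deriv \<epsilon> e x\<bar> \<le> 4 / norm x"
proof (cases "norm x \<le> \<epsilon>")
  case False
  define r where "r = norm x"
  have r: "r > \<epsilon>" "r > 0" using False assms by (auto simp: r_def)
  then have sq: "\<epsilon>\<^sup>2 \<le> r\<^sup>2" using assms by (intro power_mono) auto
  have xe: "\<bar>x \<bullet> e\<bar> \<le> r" using Cauchy_Schwarz_ineq2[of x e] assms by (simp add: r_def)
  have "\<bar>cutoff_deriv \<epsilon> e x\<bar> = 4 * \<bar>x \<bullet> e\<bar> * max 0 (r\<^sup>2 - \<epsilon>\<^sup>2) * \<epsilon>\<^sup>2 / r ^ 6"
    unfolding cutoff_deriv_def r_def[symmetric] using r by (simp add: abs_mult)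
  also have "\<dots> \<le> 4 * r * r\<^sup>2 * r\<^sup>2 / r ^ 6"
    using xe sq r by (intro divide_right_mono mult_mono) auto
  also have "\<dots> = 4 / r" using r by (simp add: field_simps power_numeral_reduce)
  finally show ?thesis by (simp add: r_def)
qed (simp add: cutoff_eq_0)

lemma has_real_derivative_max_0_power2:
  "((\<lambda>z::real. (max 0 z)\<^sup>2) has_real_derivative 2 * max 0 z) (at z)"
proof -
  consider "z > 0" | "z < 0" | "z = 0" by linarith
  then show ?thesis
  proof cases
    case 1
    have "((\<lambda>z::real. z\<^sup>2) has_real_derivative 2 * max 0 z) (at z)"
      using 1 by (auto intro!: derivative_eq_intros)
    then show ?thesis
      by (rule has_field_derivative_transform_within_open[where S = "{0<..}"]) (use 1 in auto)
  next
    case 2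
    have "((\<lambda>z::real. 0) has_real_derivative 2 * max 0 z) (at z)"
      using 2 by auto
    then show ?thesis
      by (rule has_field_derivative_transform_within_open[where S = "{..<0}"]) (use 2 in auto)
  next
    case 3
    have "((\<lambda>h::real. (max 0 h)\<^sup>2 / h) \<longlongrightarrow> 0) (at 0)"
    proof (rule Lim_null_comparison)
      show "\<forall>\<^sub>F h in at 0. norm ((max 0 h)\<^sup>2 / h) \<le> \<bar>h::real\<bar>"
        by (auto simp: max_def power2_eq_square intro!: always_eventually)
      show "((\<lambda>h::real. \<bar>h\<bar>) \<longlongrightarrow> 0) (at 0)" by (intro tendsto_rabs_zero tendsto_ident_at)
    qed
    then show ?thesis using 3 by (simp add: DERIV_def)
  qed
qed

text \<open>With p = |x + s e|^2 and z = max 0 (p - \<epsilon>^2) the cutoff is z^2 / p^2. The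
  quotient rule collapses because z p - z^2 = \<epsilon>^2 z in both cases of the maximum.\<close>

lemma cutoff_has_directional_derivative:
  assumes "x \<noteq> 0"
  shows "((\<lambda>s. cutoff \<epsilon> (x + s *\<^sub>R e)) has_real_derivative cutoff_deriv \<epsilon> e x) (at 0)"
proof -
  define p where "p s = (x + s *\<^sub>R e) \<bullet> (x + s *\<^sub>R e)" for s
  have p0: "p 0 > 0" using assms by (simp add: p_def)
  have dp: "(p has_real_derivative 2 * (x \<bullet> e)) (at 0)"
    unfolding p_def
    by (auto simp: inner_add_left inner_add_right inner_commute intro!: derivative_eq_intros)
  have "((\<lambda>s. (max 0 (p s - \<epsilon>\<^sup>2))\<^sup>2) has_real_derivative 2 * max 0 (p 0 - \<epsilon>\<^sup>2) * (2 * (x \<bullet> e))) (at 0)"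
    by (rule DERIV_chain2[OF has_real_derivative_max_0_power2]) (auto intro!: derivative_eq_intros dp)
  moreover have "((\<lambda>s. (p s)\<^sup>2) has_real_derivative 2 * p 0 * (2 * (x \<bullet> e))) (at 0)"
    by (auto intro!: derivative_eq_intros dp)
  ultimately have "((\<lambda>s. (max 0 (p s - \<epsilon>\<^sup>2))\<^sup>2 / (p s)\<^sup>2) has_real_derivative
      (2 * max 0 (p 0 - \<epsilon>\<^sup>2) * (2 * (x \<bullet> e)) * (p 0)\<^sup>2
        - (max 0 (p 0 - \<epsilon>\<^sup>2))\<^sup>2 * (2 * p 0 * (2 * (x \<bullet> e)))) / ((p 0)\<^sup>2 * (p 0)\<^sup>2)) (at 0)"
    by (rule DERIV_divide) (use p0 in auto)
  moreover have "(2 * max 0 (p 0 - \<epsilon>\<^sup>2) * (2 * (x \<bullet> e)) * (p 0)\<^sup>2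
        - (max 0 (p 0 - \<epsilon>\<^sup>2))\<^sup>2 * (2 * p 0 * (2 * (x \<bullet> e)))) / ((p 0)\<^sup>2 * (p 0)\<^sup>2) =
      4 * (x \<bullet> e) * max 0 (p 0 - \<epsilon>\<^sup>2) * \<epsilon>\<^sup>2 / (p 0) ^ 3"
    using p0 by (auto simp: max_def field_simps power_numeral_reduce)
  moreover have "p s = (norm (x + s *\<^sub>R e))\<^sup>2" for s by (simp add: p_def dot_square_norm)
  ultimately show ?thesis
    by (simp add: cutoff_def cutoff_deriv_def power_divide)
qed

lemma cutoff_limits:
  assumes "x \<noteq> 0" "h \<longlonglongrightarrow> 0"
  shows "(\<lambda>k. cutoff (h k) x) \<longlonglongrightarrow> 1" "(\<lambda>k. cutoff_deriv (h k) e x) \<longlonglongrightarrow> 0"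
proof -
  have "(\<lambda>k. cutoff (h k) x) \<longlonglongrightarrow> (max 0 ((norm x)\<^sup>2 - 0\<^sup>2) / (norm x)\<^sup>2)\<^sup>2"
    unfolding cutoff_def by (intro tendsto_intros assms) (use assms in auto)
  then show "(\<lambda>k. cutoff (h k) x) \<longlonglongrightarrow> 1" using assms by simp
  have "(\<lambda>k. cutoff_deriv (h k) e x) \<longlonglongrightarrow> 4 * (x \<bullet> e) * max 0 ((norm x)\<^sup>2 - 0\<^sup>2) * 0\<^sup>2 / (norm x) ^ 6"
    unfolding cutoff_deriv_def by (intro tendsto_intros assms) (use assms in auto)
  then show "(\<lambda>k. cutoff_deriv (h k) e x) \<longlonglongrightarrow> 0" by simp
qed

text \<open>The integral of the derivative of v times cutoff times \<phi> is 0; then \<epsilon>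
  tends to 0. The dangerous term, with the derivative of the cutoff, is harmless because v is
  smaller than the majorant \<open>w\<close> by one factor r, which offsets the bound 4 / r.\<close>

lemma punctured_ball_integration_by_parts:
  fixes v dv \<phi> d\<phi> w :: "'a::euclidean_space \<Rightarrow> real"
  assumes e: "norm e = 1"
    and v: "\<And>x. x \<in> ball 0 1 - {0} \<Longrightarrow> ((\<lambda>s. v (x + s *\<^sub>R e)) has_real_derivative dv x) (at 0)"
    and v_le: "\<And>x. x \<in> ball 0 1 - {0} \<Longrightarrow> \<bar>v x\<bar> \<le> norm x * w x"
    and dv_le: "\<And>x. x \<in> ball 0 1 - {0} \<Longrightarrow> \<bar>dv x\<bar> \<le> w x"
    and w: "set_integrable lborel (ball 0 1) w"
    and w_le: "\<And>\<epsilon>. \<epsilon> > 0 \<Longrightarrow> \<exists>D. \<forall>x. \<epsilon> \<le> norm x \<and> norm x < 1 \<longrightarrow> w x \<le> D"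
    and \<phi>: "\<And>x. ((\<lambda>s. \<phi> (x + s *\<^sub>R e)) has_real_derivative d\<phi> x) (at 0)"
    and \<phi>_le: "\<And>x. \<bar>\<phi> x\<bar> \<le> M" and d\<phi>_le: "\<And>x. \<bar>d\<phi> x\<bar> \<le> M"
    and K: "closed K" "K \<subseteq> ball 0 1" and supp: "\<And>x. x \<notin> K \<Longrightarrow> \<phi> x = 0"
    and [measurable]: "v \<in> borel_measurable borel" "dv \<in> borel_measurable borel"
      "\<phi> \<in> borel_measurable borel" "d\<phi> \<in> borel_measurable borel"
  shows "(LINT x:ball 0 1|lborel. v x * d\<phi> x) = - (LINT x:ball 0 1|lborel. dv x * \<phi> x)"
proof -
  let ?B = "ball (0::'a) 1"
  have M: "M \<ge> 0" using \<phi>_le[of 0] by linarith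
  have d\<phi>_supp: "d\<phi> x = 0" if "x \<notin> K" for x
  proof -
    have "open ((\<lambda>s. x + s *\<^sub>R e) -` (- K))"
      by (intro open_vimage continuous_intros) (use K in auto)
    from has_field_derivative_transform_within_open[OF \<phi>[of x] this, of "\<lambda>_. 0"]
    have "((\<lambda>s. 0) has_real_derivative d\<phi> x) (at 0)"
      using supp that by auto
    then show ?thesis using DERIV_const DERIV_unique by blast
  qed
  have w0: "w x \<ge> 0" if "x \<in> ?B - {0}" for x
    using dv_le[OF that] by linarith
  define \<psi> where "\<psi> \<epsilon> x = v x * cutoff \<epsilon> x * \<phi> x" for \<epsilon> x
  define d\<psi> where "d\<psi> \<epsilon> x = dv x * cutoff \<epsilon> x * \<phi> x + v x * cutoff_deriv \<epsilon> e x * \<phi> x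
    + v x * cutoff \<epsilon> x * d\<phi> x" for \<epsilon> x
  have [measurable]: "\<psi> \<epsilon> \<in> borel_measurable borel" "d\<psi> \<epsilon> \<in> borel_measurable borel" for \<epsilon>
    unfolding \<psi>_def d\<psi>_def by measurable
  have der: "((\<lambda>s. \<psi> \<epsilon> (x + s *\<^sub>R e)) has_real_derivative d\<psi> \<epsilon> x) (at 0)" if \<epsilon>: "\<epsilon> > 0" for \<epsilon> x
  proof -
    consider "x = 0" | "x \<notin> K" | "x \<in> K" "x \<noteq> 0" by blast
    then show ?thesis
    proof cases
      case 1
      \<comment> \<open>Nothing is known about \<open>v\<close> at the origin, but the cutoff makes
        \<psi> vanish in a whole neighbourhood.\<close>
      then have "d\<psi> \<epsilon> x = 0" using \<epsilon> by (simp add: d\<psi>_def cutoff_eq_0)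
      moreover have "((\<lambda>s. \<psi> \<epsilon> (x + s *\<^sub>R e)) has_real_derivative 0) (at 0)"
        by (rule has_field_derivative_transform_within_open[OF DERIV_const[of 0], where S = "{- \<epsilon><..<\<epsilon>}"])
          (use \<epsilon> e 1 in \<open>auto simp: \<psi>_def cutoff_eq_0\<close>)
      ultimately show ?thesis by simp
    next
      case 2
      have o: "open ((\<lambda>s. x + s *\<^sub>R e) -` (- K))"
        by (intro open_vimage continuous_intros) (use K in auto)
      have "((\<lambda>s. \<psi> \<epsilon> (x + s *\<^sub>R e)) has_real_derivative 0) (at 0)"
        by (rule has_field_derivative_transform_within_open[OF DERIV_const[of 0] o])
          (use 2 supp in \<open>auto simp: \<psi>_def\<close>)
      then show ?thesis using 2 supp d\<phi>_supp by (simp add: d\<psi>_def)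
    next
      case 3
      then have x: "x \<in> ?B - {0}" using K by auto
      show ?thesis unfolding \<psi>_def d\<psi>_def
        by (rule DERIV_cong[OF DERIV_mult[OF DERIV_mult[OF v[OF x] cutoff_has_directional_derivative[OF 3(2)]] \<phi>]])
          (simp add: algebra_simps)
    qed
  qed
  \<comment> \<open>The factor 6 is 1 + 4 + 1: the terms with \<open>dv\<close>, with the derivative
    of the cutoff, and with \<open>d\<phi>\<close>. The bound on \<psi> depends on \<epsilon>
    through \<open>D\<close>; the one on its derivative does not.\<close>
  have \<psi>_bound: "\<bar>\<psi> \<epsilon> x\<bar> \<le> indicator ?B x *\<^sub>R (D * M)"
    and d\<psi>_bound: "\<bar>d\<psi> \<epsilon> x\<bar> \<le> indicator ?B x *\<^sub>R (6 * M * w x)"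
    if \<epsilon>: "\<epsilon> > 0" and D: "\<forall>x. \<epsilon> \<le> norm x \<and> norm x < 1 \<longrightarrow> w x \<le> D" "D \<ge> 0" and x0: "x \<noteq> 0" for \<epsilon> D x
  proof -
    have "\<bar>\<psi> \<epsilon> x\<bar> \<le> indicator ?B x *\<^sub>R (D * M) \<and> \<bar>d\<psi> \<epsilon> x\<bar> \<le> indicator ?B x *\<^sub>R (6 * M * w x)"
    proof (cases "x \<in> K")
      case False
      then have "\<psi> \<epsilon> x = 0" "d\<psi> \<epsilon> x = 0" using supp d\<phi>_supp by (simp_all add: \<psi>_def d\<psi>_def)
      moreover have "x \<in> ?B \<Longrightarrow> w x \<ge> 0" using w0 x0 by auto
      ultimately show ?thesis using M D by (auto simp: indicator_def)
    next
      case True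
      then have x: "x \<in> ?B - {0}" "x \<in> ?B" "norm x < 1" using K x0 by auto
      have v1: "\<bar>v x\<bar> \<le> w x"
        using v_le[OF x(1)] w0[OF x(1)] x by (elim order_trans) (auto intro: mult_left_le_one_le)
      have c: "\<bar>cutoff \<epsilon> x\<bar> \<le> 1" using cutoff_bounds[of \<epsilon> x] by auto
      have "\<bar>\<psi> \<epsilon> x\<bar> \<le> D * M"
      proof (cases "norm x \<le> \<epsilon>")
        case True
        then show ?thesis using M D by (simp add: \<psi>_def cutoff_eq_0)
      next
        case False
        then have "\<bar>v x\<bar> \<le> D" using v1 D(1)[rule_format, of x] x by simp
        then have "\<bar>v x\<bar> * \<bar>cutoff \<epsilon> x\<bar> * \<bar>\<phi> x\<bar> \<le> D * 1 * M"
          using \<phi>_le M D c by (intro mult_mono) auto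
        then show ?thesis by (simp add: \<psi>_def abs_mult)
      qed
      moreover have "\<bar>d\<psi> \<epsilon> x\<bar> \<le> 6 * M * w x"
      proof -
        have "\<bar>dv x\<bar> * \<bar>cutoff \<epsilon> x\<bar> * \<bar>\<phi> x\<bar> \<le> w x * 1 * M"
          using \<phi>_le M w0[OF x(1)] c dv_le[OF x(1)] by (intro mult_mono) auto
        moreover have "\<bar>v x\<bar> * \<bar>cutoff \<epsilon> x\<bar> * \<bar>d\<phi> x\<bar> \<le> w x * 1 * M"
          using d\<phi>_le M w0[OF x(1)] c v1 by (intro mult_mono) auto
        moreover have "\<bar>v x\<bar> * \<bar>cutoff_deriv \<epsilon> e x\<bar> * \<bar>\<phi> x\<bar> \<le> (norm x * w x) * (4 / norm x) * M"
          using \<phi>_le M w0[OF x(1)] v_le[OF x(1)] cutoff_deriv_bound[OF e \<epsilon>, of x] by (intro mult_mono) auto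
        moreover have "(norm x * w x) * (4 / norm x) * M = 4 * (w x * M)" "6 * M * w x = 6 * (w x * M)"
          "w x * 1 * M = w x * M" using x0 by simp_all
        moreover have "\<bar>d\<psi> \<epsilon> x\<bar> \<le> \<bar>dv x\<bar> * \<bar>cutoff \<epsilon> x\<bar> * \<bar>\<phi> x\<bar>
            + \<bar>v x\<bar> * \<bar>cutoff_deriv \<epsilon> e x\<bar> * \<bar>\<phi> x\<bar> + \<bar>v x\<bar> * \<bar>cutoff \<epsilon> x\<bar> * \<bar>d\<phi> x\<bar>"
          unfolding d\<psi>_def abs_mult[symmetric] by linarith
        ultimately show ?thesis by linarith
      qed
      ultimately show ?thesis using x by simp
    qed
    then show "\<bar>\<psi> \<epsilon> x\<bar> \<le> indicator ?B x *\<^sub>R (D * M)"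
      "\<bar>d\<psi> \<epsilon> x\<bar> \<le> indicator ?B x *\<^sub>R (6 * M * w x)" by auto
  qed
  have zero: "integral\<^sup>L lborel (d\<psi> \<epsilon>) = 0" if \<epsilon>: "\<epsilon> > 0" for \<epsilon>
  proof -
    \<comment> \<open>For fixed \<epsilon> the product has a bounded derivative: it vanishes for |x|
      <= \<epsilon>, and on the rest of the ball \<open>w\<close> is bounded.\<close>
    obtain D0 where D0: "\<forall>x. \<epsilon> \<le> norm x \<and> norm x < 1 \<longrightarrow> w x \<le> D0" using w_le[OF \<epsilon>] by blast
    define D where "D = max D0 0"
    have D: "\<forall>x. \<epsilon> \<le> norm x \<and> norm x < 1 \<longrightarrow> w x \<le> D" using D0 by (auto simp: D_def le_max_iff_disj)
    have D1: "D \<ge> 0" by (simp add: D_def)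
    note b = \<psi>_bound[OF \<epsilon> D D1] d\<psi>_bound[OF \<epsilon> D D1]
    have small: "\<psi> \<epsilon> x = 0" "d\<psi> \<epsilon> x = 0" if "norm x \<le> \<epsilon>" for x
      using that by (simp_all add: \<psi>_def d\<psi>_def cutoff_eq_0)
    show ?thesis
    proof (rule integral_directional_derivative_eq_0[where \<psi> = "\<psi> \<epsilon>" and R = 1])
      show "((\<lambda>s. \<psi> \<epsilon> (x + s *\<^sub>R e)) has_real_derivative d\<psi> \<epsilon> x) (at 0)" for x by (rule der[OF \<epsilon>])
      show "\<bar>d\<psi> \<epsilon> x\<bar> \<le> 6 * M * D" for x
      proof (cases "norm x \<le> \<epsilon>")
        case True
        then show ?thesis using M D1 by (simp add: small)
      next
        case False
        then have "x \<noteq> 0" using \<epsilon> by auto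
        show ?thesis
        proof (cases "x \<in> ?B")
          case True
          then show ?thesis using b(2)[OF \<open>x \<noteq> 0\<close>] D[rule_format, of x] False M
            by simp (smt (verit) mult_left_mono)
        next
          case False
          then show ?thesis using b(2)[OF \<open>x \<noteq> 0\<close>] M D1 by simp
        qed
      qed
      show "norm x > 1 \<Longrightarrow> \<psi> \<epsilon> x = 0" for x using b(1)[of x] by (cases "x = 0") (auto simp: small)
      show "integrable lborel (\<psi> \<epsilon>)"
      proof (rule Bochner_Integration.integrable_bound)
        show "integrable lborel (\<lambda>x. indicator ?B x *\<^sub>R (D * M))"
          by (intro integrable_indicator) (use emeasure_bounded_finite[OF bounded_ball] in simp_all)
        show "AE x in lborel. norm (\<psi> \<epsilon> x) \<le> norm (indicator ?B x *\<^sub>R (D * M))"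
        proof (rule AE_I2)
          show "norm (\<psi> \<epsilon> x) \<le> norm (indicator ?B x *\<^sub>R (D * M))" for x
            using b(1)[of x] small(1)[of x] \<epsilon> D1 M by (cases "x = 0") auto
        qed
      qed simp
    qed
  qed
  define h where "h k = 1 / real (Suc k)" for k
  have h: "0 < h k" for k by (auto simp: h_def field_simps)
  have h0: "h \<longlonglongrightarrow> 0" unfolding h_def by (rule LIMSEQ_Suc[OF lim_1_over_n])
  define F where "F x = dv x * \<phi> x + v x * d\<phi> x" for x
  have [measurable]: "F \<in> borel_measurable borel" unfolding F_def by measurable
  have ae: "AE x in lborel. x \<noteq> (0::'a)" by (rule AE_lborel_singleton)
  have intw: "integrable lborel (\<lambda>x. indicator ?B x *\<^sub>R (6 * M * w x))"
    using set_integrable_mult_right[of "6 * M", OF w] by (simp add: set_integrable_def)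
  \<comment> \<open>Off the origin the cutoff tends to 1 and its derivative to 0, so only the two
    terms of the integration by parts survive in the limit \<open>F\<close>.\<close>
  have "(\<lambda>k. integral\<^sup>L lborel (d\<psi> (h k))) \<longlonglongrightarrow> integral\<^sup>L lborel F"
  proof (rule integral_dominated_convergence[OF _ _ intw])
    show "AE x in lborel. norm (d\<psi> (h k) x) \<le> indicator ?B x *\<^sub>R (6 * M * w x)" for k
    proof -
      obtain D0 where "\<forall>x. h k \<le> norm x \<and> norm x < 1 \<longrightarrow> w x \<le> D0" using w_le[OF h[of k]] by blast
      then have "\<forall>x. h k \<le> norm x \<and> norm x < 1 \<longrightarrow> w x \<le> max D0 0" by (auto simp: le_max_iff_disj)
      from d\<psi>_bound[OF h this] ae show ?thesis by auto
    qed
    show "AE x in lborel. (\<lambda>k. d\<psi> (h k) x) \<longlonglongrightarrow> F x"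
      using ae
    proof eventually_elim
      case (elim x)
      have "(\<lambda>k. d\<psi> (h k) x) \<longlonglongrightarrow> dv x * 1 * \<phi> x + v x * 0 * \<phi> x + v x * 1 * d\<phi> x"
        unfolding d\<psi>_def by (intro tendsto_intros cutoff_limits[OF elim h0])
      then show ?case by (simp add: F_def)
    qed
  qed auto
  then have F0: "integral\<^sup>L lborel F = 0" by (simp add: zero[OF h] LIMSEQ_const_iff)
  have i1: "integrable lborel (\<lambda>x. indicator ?B x *\<^sub>R (dv x * \<phi> x))"
  proof (rule Bochner_Integration.integrable_bound[OF intw])
    show "AE x in lborel. norm (indicator ?B x *\<^sub>R (dv x * \<phi> x)) \<le> norm (indicator ?B x *\<^sub>R (6 * M * w x))"
      using ae
    proof eventually_elim
      case (elim x)
      have "\<bar>dv x\<bar> * \<bar>\<phi> x\<bar> \<le> w x * M" if "x \<in> ?B"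
        using \<phi>_le M w0[of x] dv_le[of x] that elim by (intro mult_mono) auto
      moreover have "w x * M \<ge> 0" if "x \<in> ?B" using w0[of x] elim M that by auto
      moreover have "6 * M * w x = 6 * (w x * M)" by simp
      ultimately have "\<bar>dv x * \<phi> x\<bar> \<le> \<bar>6 * M * w x\<bar>" if "x \<in> ?B" using that unfolding abs_mult[of _ "\<phi> x"]
        by linarith
      then show ?case by (simp add: indicator_def)
    qed
  qed (intro borel_measurable_scaleR borel_measurable_indicator; simp)
  have i2: "integrable lborel (\<lambda>x. indicator ?B x *\<^sub>R (v x * d\<phi> x))"
  proof (rule Bochner_Integration.integrable_bound[OF intw])
    show "AE x in lborel. norm (indicator ?B x *\<^sub>R (v x * d\<phi> x)) \<le> norm (indicator ?B x *\<^sub>R (6 * M * w x))"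
      using ae
    proof eventually_elim
      case (elim x)
      have "\<bar>v x\<bar> \<le> w x" if "x \<in> ?B"
        using order_trans[OF v_le[of x] mult_left_le_one_le[of "w x" "norm x"]] w0[of x] elim that by auto
      then have "\<bar>v x\<bar> * \<bar>d\<phi> x\<bar> \<le> w x * M" if "x \<in> ?B"
        using d\<phi>_le M w0[of x] that elim by (intro mult_mono) auto
      moreover have "w x * M \<ge> 0" if "x \<in> ?B" using w0[of x] elim M that by auto
      moreover have "6 * M * w x = 6 * (w x * M)" by simp
      ultimately have "\<bar>v x * d\<phi> x\<bar> \<le> \<bar>6 * M * w x\<bar>" if "x \<in> ?B" using that unfolding abs_mult[of _ "d\<phi> x"]
        by linarith
      then show ?case by (simp add: indicator_def)
    qed
  qed (intro borel_measurable_scaleR borel_measurable_indicator; simp)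
  \<comment> \<open>\<phi> and its derivative vanish off \<open>K\<close>, which lies in the ball,
    so the integral over the whole space is one over the ball.\<close>
  have "F x = indicator ?B x *\<^sub>R (dv x * \<phi> x) + indicator ?B x *\<^sub>R (v x * d\<phi> x)" for x
    using supp[of x] d\<phi>_supp[of x] K by (cases "x \<in> K"; cases "x \<in> ?B") (auto simp: F_def)
  then have "F = (\<lambda>x. indicator ?B x *\<^sub>R (dv x * \<phi> x) + indicator ?B x *\<^sub>R (v x * d\<phi> x))" by auto
  then show ?thesis
    using F0 i1 i2 by (simp add: set_lebesgue_integral_def)
qed

section \<open>Symbols in the logarithmic variable\<close>

text \<open>The derivative is only asked to have the same order as the function, not a better one as
  for classical symbols. This admits the oscillating factors cos(a) and sin(a), whose derivatives
  gain less than a full power of t, and it keeps the class closed under products. The region t < 1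
  never occurs, but measurability is kept on the whole line.\<close>

definition log_symbol :: "real \<Rightarrow> (real \<Rightarrow> real) \<Rightarrow> (real \<Rightarrow> real) \<Rightarrow> bool" where
  "log_symbol \<sigma> A A' \<longleftrightarrow> A \<in> borel_measurable borel \<and> A' \<in> borel_measurable borel \<and>
     (\<forall>t\<ge>1. (A has_real_derivative A' t) (at t)) \<and>
     (\<exists>C. \<forall>t\<ge>1. \<bar>A t\<bar> \<le> C * t powr (- \<sigma>) \<and> \<bar>A' t\<bar> \<le> C * t powr (- \<sigma>))"

lemma log_symbolI:
  assumes "A \<in> borel_measurable borel" "A' \<in> borel_measurable borel"
    and "\<And>t. t \<ge> 1 \<Longrightarrow> (A has_real_derivative A' t) (at t)"
    and "\<And>t. t \<ge> 1 \<Longrightarrow> \<bar>A t\<bar> \<le> C * t powr (- \<sigma>)"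
    and "\<And>t. t \<ge> 1 \<Longrightarrow> \<bar>A' t\<bar> \<le> D * t powr (- \<sigma>)"
  shows "log_symbol \<sigma> A A'"
  unfolding log_symbol_def
proof (intro conjI exI[of _ "max C D"] allI impI)
  fix t :: real assume "t \<ge> 1"
  then show "\<bar>A t\<bar> \<le> max C D * t powr (- \<sigma>)" "\<bar>A' t\<bar> \<le> max C D * t powr (- \<sigma>)"
    using assms(4,5)[of t] by (smt (verit) mult_right_mono powr_ge_zero)+
qed (use assms in auto)

lemma log_symbol_boundE:
  assumes "log_symbol \<sigma> A A'"
  obtains C where "C \<ge> 0" "\<And>t. t \<ge> 1 \<Longrightarrow> \<bar>A t\<bar> \<le> C * t powr (- \<sigma>)"
    "\<And>t. t \<ge> 1 \<Longrightarrow> \<bar>A' t\<bar> \<le> C * t powr (- \<sigma>)"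
proof -
  obtain C where C: "\<forall>t\<ge>1. \<bar>A t\<bar> \<le> C * t powr (- \<sigma>) \<and> \<bar>A' t\<bar> \<le> C * t powr (- \<sigma>)"
    using assms by (auto simp: log_symbol_def)
  have "C \<ge> 0" using C[rule_format, of 1] by auto
  with C that show ?thesis by blast
qed

lemma log_symbol_mono:
  assumes "log_symbol \<sigma> A A'" "\<tau> \<le> \<sigma>"
  shows "log_symbol \<tau> A A'"
proof -
  from assms(1) obtain C where C: "C \<ge> 0" "\<And>t. t \<ge> 1 \<Longrightarrow> \<bar>A t\<bar> \<le> C * t powr (- \<sigma>)"
    "\<And>t. t \<ge> 1 \<Longrightarrow> \<bar>A' t\<bar> \<le> C * t powr (- \<sigma>)" by (rule log_symbol_boundE) blast
  have "C * t powr (- \<sigma>) \<le> C * t powr (- \<tau>)" if "t \<ge> 1" for t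
    using that assms(2) C(1) by (intro mult_left_mono powr_mono) auto
  then show ?thesis using assms(1) C(2,3)
    by (intro log_symbolI[of _ _ C _ C]) (auto simp: log_symbol_def intro: order_trans)
qed

text \<open>Both terms of the product rule have order \<sigma> + \<tau>, since differentiation does
  not change the order of a factor.\<close>

lemma log_symbol_mult:
  assumes A: "log_symbol \<sigma> A A'" and B: "log_symbol \<tau> B B'"
  shows "log_symbol (\<sigma> + \<tau>) (\<lambda>t. A t * B t) (\<lambda>t. A' t * B t + A t * B' t)"
proof -
  from A obtain C where C: "C \<ge> 0" "\<And>t. t \<ge> 1 \<Longrightarrow> \<bar>A t\<bar> \<le> C * t powr (- \<sigma>)"
    "\<And>t. t \<ge> 1 \<Longrightarrow> \<bar>A' t\<bar> \<le> C * t powr (- \<sigma>)" by (rule log_symbol_boundE) blast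
  from B obtain D where D: "D \<ge> 0" "\<And>t. t \<ge> 1 \<Longrightarrow> \<bar>B t\<bar> \<le> D * t powr (- \<tau>)"
    "\<And>t. t \<ge> 1 \<Longrightarrow> \<bar>B' t\<bar> \<le> D * t powr (- \<tau>)" by (rule log_symbol_boundE) blast
  have prod: "\<bar>a * b\<bar> \<le> C * D * t powr (- (\<sigma> + \<tau>))"
    if "\<bar>a\<bar> \<le> C * t powr (- \<sigma>)" "\<bar>b\<bar> \<le> D * t powr (- \<tau>)" for a b t
  proof -
    have "\<bar>a\<bar> * \<bar>b\<bar> \<le> (C * t powr (- \<sigma>)) * (D * t powr (- \<tau>))"
      using that C D by (intro mult_mono) auto
    also have "\<dots> = C * D * t powr (- (\<sigma> + \<tau>))" by (simp add: powr_add[symmetric] mult_ac)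
    finally show ?thesis by (simp add: abs_mult)
  qed
  show ?thesis
  proof (rule log_symbolI[of _ _ "C * D" _ "2 * (C * D)"])
    fix t :: real assume t: "t \<ge> 1"
    show "((\<lambda>t. A t * B t) has_real_derivative A' t * B t + A t * B' t) (at t)"
      using A B t by (auto simp: log_symbol_def intro!: derivative_eq_intros)
    show "\<bar>A t * B t\<bar> \<le> C * D * t powr (- (\<sigma> + \<tau>))" using prod C D t by blast
    have "\<bar>A' t * B t\<bar> \<le> C * D * t powr (- (\<sigma> + \<tau>))" "\<bar>A t * B' t\<bar> \<le> C * D * t powr (- (\<sigma> + \<tau>))"
      using prod C D t by blast+
    then show "\<bar>A' t * B t + A t * B' t\<bar> \<le> 2 * (C * D) * t powr (- (\<sigma> + \<tau>))"
      by linarith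
  qed (use A B in \<open>auto simp: log_symbol_def\<close>)
qed

lemma log_symbol_add:
  assumes A: "log_symbol \<sigma> A A'" and B: "log_symbol \<sigma> B B'"
  shows "log_symbol \<sigma> (\<lambda>t. A t + B t) (\<lambda>t. A' t + B' t)"
proof -
  from A obtain C where C: "C \<ge> 0" "\<And>t. t \<ge> 1 \<Longrightarrow> \<bar>A t\<bar> \<le> C * t powr (- \<sigma>)"
    "\<And>t. t \<ge> 1 \<Longrightarrow> \<bar>A' t\<bar> \<le> C * t powr (- \<sigma>)" by (rule log_symbol_boundE) blast
  from B obtain D where D: "D \<ge> 0" "\<And>t. t \<ge> 1 \<Longrightarrow> \<bar>B t\<bar> \<le> D * t powr (- \<sigma>)"
    "\<And>t. t \<ge> 1 \<Longrightarrow> \<bar>B' t\<bar> \<le> D * t powr (- \<sigma>)" by (rule log_symbol_boundE) blast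
  show ?thesis
  proof (rule log_symbolI[of _ _ "C + D" _ "C + D"])
    fix t :: real assume t: "t \<ge> 1"
    show "((\<lambda>t. A t + B t) has_real_derivative A' t + B' t) (at t)"
      using A B t by (auto simp: log_symbol_def intro!: derivative_eq_intros)
    show "\<bar>A t + B t\<bar> \<le> (C + D) * t powr - \<sigma>" "\<bar>A' t + B' t\<bar> \<le> (C + D) * t powr - \<sigma>"
      unfolding distrib_right using C(2,3)[OF t] D(2,3)[OF t] by linarith+
  qed (use A B in \<open>auto simp: log_symbol_def\<close>)
qed

lemma log_symbol_const: "log_symbol 0 (\<lambda>_. c) (\<lambda>_. 0)"
  by (rule log_symbolI[of _ _ "\<bar>c\<bar>" _ 0]) auto

lemma log_symbol_cmult:
  assumes "log_symbol \<sigma> A A'"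
  shows "log_symbol \<sigma> (\<lambda>t. c * A t) (\<lambda>t. c * A' t)"
  using log_symbol_mult[OF log_symbol_const assms, of c] by simp

lemma log_symbol_powr: "log_symbol \<sigma> (\<lambda>t. t powr (- \<sigma>)) (\<lambda>t. - \<sigma> * t powr (- \<sigma>) / t)"
proof (rule log_symbolI[of _ _ 1 _ "\<bar>\<sigma>\<bar>"])
  fix t :: real assume t: "t \<ge> 1"
  show "((\<lambda>t. t powr (- \<sigma>)) has_real_derivative - \<sigma> * t powr (- \<sigma>) / t) (at t)"
    using t by (auto intro!: derivative_eq_intros simp: powr_diff)
  show "\<bar>- \<sigma> * t powr (- \<sigma>) / t\<bar> \<le> \<bar>\<sigma>\<bar> * t powr (- \<sigma>)"
    using t divide_left_mono[of 1 t "\<bar>\<sigma>\<bar> * t powr (- \<sigma>)"] by (simp add: abs_mult)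
qed auto

text \<open>The size conditions on \<open>v\<close> and on its \<open>\<alpha>\<close>-th partial derivative \<open>dv\<close> under which
  \<open>punctured_ball_integration_by_parts\<close> applies with a multiple of \<open>log_weight\<close> as majorant.\<close>

definition punctured_adm :: "real \<Rightarrow> real \<Rightarrow> 'n \<Rightarrow> (real^'n \<Rightarrow> real) \<Rightarrow> (real^'n \<Rightarrow> real) \<Rightarrow> bool" where
  "punctured_adm T \<tau> \<alpha> v dv \<longleftrightarrow> v \<in> borel_measurable borel \<and> dv \<in> borel_measurable borel \<and>
     (\<forall>x\<in>ball 0 1 - {0}. ((\<lambda>s. v (x + s *\<^sub>R axis \<alpha> 1)) has_real_derivative dv x) (at 0)) \<and>
     (\<exists>C. \<forall>x\<in>ball 0 1 - {0}. \<bar>v x\<bar> \<le> C * (norm x * log_weight T \<tau> x) \<and> \<bar>dv x\<bar> \<le> C * log_weight T \<tau> x)"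

lemma punctured_admI:
  assumes "v \<in> borel_measurable borel" "dv \<in> borel_measurable borel"
    and "\<And>x. x \<in> ball 0 1 - {0} \<Longrightarrow> ((\<lambda>s. v (x + s *\<^sub>R axis \<alpha> 1)) has_real_derivative dv x) (at 0)"
    and "\<And>x. x \<in> ball 0 1 - {0} \<Longrightarrow> \<bar>v x\<bar> \<le> C * (norm x * log_weight T \<tau> x)"
    and "\<And>x. x \<in> ball 0 1 - {0} \<Longrightarrow> \<bar>dv x\<bar> \<le> D * log_weight T \<tau> x"
  shows "punctured_adm T \<tau> \<alpha> v dv"
  unfolding punctured_adm_def
proof (intro conjI exI[of _ "max C D"] ballI)
  fix x :: "real^'a" assume "x \<in> ball 0 1 - {0}"
  moreover have "norm x * log_weight T \<tau> x \<ge> 0" "log_weight T \<tau> x \<ge> 0" by (auto simp: log_weight_nonneg)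
  ultimately show "\<bar>v x\<bar> \<le> max C D * (norm x * log_weight T \<tau> x)" "\<bar>dv x\<bar> \<le> max C D * log_weight T \<tau> x"
    using assms(4,5)[of x] by (smt (verit) mult_right_mono)+
qed (use assms in auto)

lemma punctured_adm_boundE:
  assumes "punctured_adm T \<tau> \<alpha> v dv"
  obtains C where "C \<ge> 0" "\<And>x. x \<in> ball 0 1 - {0} \<Longrightarrow> \<bar>v x\<bar> \<le> C * (norm x * log_weight T \<tau> x)"
    "\<And>x. x \<in> ball 0 1 - {0} \<Longrightarrow> \<bar>dv x\<bar> \<le> C * log_weight T \<tau> x"
proof -
  obtain C where C: "\<forall>x\<in>ball 0 1 - {0}. \<bar>v x\<bar> \<le> C * (norm x * log_weight T \<tau> x) \<and> \<bar>dv x\<bar> \<le> C * log_weight T \<tau> x"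
    using assms by (auto simp: punctured_adm_def)
  have "\<bar>v x\<bar> \<le> max C 0 * (norm x * log_weight T \<tau> x)" "\<bar>dv x\<bar> \<le> max C 0 * log_weight T \<tau> x"
    if "x \<in> ball 0 1 - {0}" for x
  proof -
    have "norm x * log_weight T \<tau> x \<ge> 0" "log_weight T \<tau> x \<ge> 0" by (auto simp: log_weight_nonneg)
    then show "\<bar>v x\<bar> \<le> max C 0 * (norm x * log_weight T \<tau> x)" "\<bar>dv x\<bar> \<le> max C 0 * log_weight T \<tau> x"
      using C[rule_format, OF that] by (smt (verit) mult_right_mono)+
  qed
  then show ?thesis by (intro that[of "max C 0"]) auto
qed

section \<open>Differentiating radial functions and directions away from the origin\<close>

lemma norm_directional_derivative:
  fixes x :: "real^'n"
  assumes "x \<noteq> 0"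
  shows "((\<lambda>s. norm (x + s *\<^sub>R axis \<alpha> 1)) has_real_derivative x $ \<alpha> / norm x) (at 0)"
proof -
  have "(norm has_derivative (\<lambda>h. h \<bullet> sgn x)) (at x)"
    using assms by (rule has_derivative_norm)
  then have "((\<lambda>s. norm (x + s *\<^sub>R axis \<alpha> 1)) has_derivative (\<lambda>s. (s *\<^sub>R axis \<alpha> 1) \<bullet> sgn x)) (at 0)"
    by (intro has_derivative_compose[of "\<lambda>s. x + s *\<^sub>R axis \<alpha> 1" "\<lambda>s. s *\<^sub>R axis \<alpha> 1" 0 UNIV norm])
      (auto intro!: derivative_eq_intros)
  moreover have "(\<lambda>s. (s *\<^sub>R axis \<alpha> 1) \<bullet> sgn x) = (*) (x $ \<alpha> / norm x)"
    by (auto simp: sgn_div_norm inner_axis' fun_eq_iff divide_inverse)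
  ultimately show ?thesis by (simp add: has_field_derivative_def)
qed

text \<open>In terms of r the variable t has derivative -1/r, so A(t) and r^(-j) both lose exactly
  one power of r when differentiated.\<close>

lemma radial_directional_derivative:
  fixes x :: "real^'n"
  assumes x: "x \<in> ball 0 1 - {0}" and T: "T \<ge> 1"
    and A: "\<And>t. t \<ge> 1 \<Longrightarrow> (A has_real_derivative A' t) (at t)"
  shows "((\<lambda>s. A (T - ln (norm (x + s *\<^sub>R axis \<alpha> 1))) / norm (x + s *\<^sub>R axis \<alpha> 1) ^ j) has_real_derivative
    (- A' (T - ln (norm x)) - real j * A (T - ln (norm x))) * x $ \<alpha> / norm x ^ (j + 2)) (at 0)"
proof -
  define r where "r s = norm (x + s *\<^sub>R axis \<alpha> 1)" for s
  define t where "t = T - ln (norm x)"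
  have r0: "r 0 = norm x" by (simp add: r_def)
  have pos: "norm x > 0" using x by simp
  have "ln (norm x) \<le> 0" using x by simp
  then have t: "t \<ge> 1" using T unfolding t_def by linarith
  have dr: "(r has_real_derivative x $ \<alpha> / norm x) (at 0)"
    unfolding r_def using x by (intro norm_directional_derivative) auto
  have "((\<lambda>s. T - ln (r s)) has_real_derivative - (x $ \<alpha> / norm x ^ 2)) (at 0)"
    by (use x in \<open>auto intro!: derivative_eq_intros dr simp: r0 power2_eq_square\<close>)
  then have dA: "((\<lambda>s. A (T - ln (r s))) has_real_derivative A' t * (- (x $ \<alpha> / norm x ^ 2))) (at 0)"
    by (intro DERIV_chain2[where f = A and g = "\<lambda>s. T - ln (r s)"]) (use A[OF t] in \<open>auto simp: r0 t_def\<close>)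
  have dj: "((\<lambda>s. r s ^ j) has_real_derivative real j * norm x ^ (j - 1) * (x $ \<alpha> / norm x)) (at 0)"
    by (auto intro!: derivative_eq_intros dr simp: r0)
  have "((\<lambda>s. A (T - ln (r s)) / r s ^ j) has_real_derivative
     (A' t * (- (x $ \<alpha> / norm x ^ 2)) * norm x ^ j - A t * (real j * norm x ^ (j - 1) * (x $ \<alpha> / norm x)))
       / (norm x ^ j * norm x ^ j)) (at 0)"
    using DERIV_divide[OF dA dj] pos by (simp add: r0 t_def)
  moreover have "(A' t * (- (x $ \<alpha> / norm x ^ 2)) * norm x ^ j - A t * (real j * norm x ^ (j - 1) * (x $ \<alpha> / norm x)))
       / (norm x ^ j * norm x ^ j) = (- A' t - real j * A t) * x $ \<alpha> / norm x ^ (j + 2)"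
    using pos by (cases j) (simp_all add: field_simps power2_eq_square)
  ultimately show ?thesis by (simp add: r_def t_def)
qed

text \<open>One size hypothesis covers both bounds: the derivative is larger by at most a constant
  times 1/r, and that is exactly the gap between the two majorants.\<close>

lemma punctured_adm_radial:
  fixes \<alpha> :: "'n::finite"
  assumes A: "log_symbol \<sigma> A A'" and T: "T \<ge> 1"
    and C: "C \<ge> 0" "\<And>x. x \<in> ball (0::real^'n) 1 - {0} \<Longrightarrow>
      (T - ln (norm x)) powr (- \<sigma>) / norm x ^ j \<le> C * (norm x * log_weight T \<tau> x)"
  shows "punctured_adm T \<tau> \<alpha> (\<lambda>x. A (T - ln (norm x)) / norm x ^ j)
    (\<lambda>x. (- A' (T - ln (norm x)) - real j * A (T - ln (norm x))) * x $ \<alpha> / norm x ^ (j + 2))"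
proof -
  have [measurable]: "A \<in> borel_measurable borel" "A' \<in> borel_measurable borel"
    using A by (auto simp: log_symbol_def)
  from A obtain D where D: "D \<ge> 0" "\<And>t. t \<ge> 1 \<Longrightarrow> \<bar>A t\<bar> \<le> D * t powr (- \<sigma>)"
    "\<And>t. t \<ge> 1 \<Longrightarrow> \<bar>A' t\<bar> \<le> D * t powr (- \<sigma>)" by (rule log_symbol_boundE) blast
  show ?thesis
  proof (rule punctured_admI[of _ _ _ "D * C" _ _ "(1 + real j) * D * C"])
    fix x :: "real^'n" assume x: "x \<in> ball 0 1 - {0}"
    define t where "t = T - ln (norm x)"
    have pos: "norm x > 0" using x by simp
    have "ln (norm x) \<le> 0" using x by simp
    then have t: "t \<ge> 1" using T unfolding t_def by linarith
    show "((\<lambda>s. A (T - ln (norm (x + s *\<^sub>R axis \<alpha> 1))) / norm (x + s *\<^sub>R axis \<alpha> 1) ^ j) has_real_derivative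
      (- A' (T - ln (norm x)) - real j * A (T - ln (norm x))) * x $ \<alpha> / norm x ^ (j + 2)) (at 0)"
      using A by (intro radial_directional_derivative[OF x T]) (auto simp: log_symbol_def)
    have "\<bar>A t\<bar> / norm x ^ j \<le> D * (t powr (- \<sigma>) / norm x ^ j)"
      using D(2)[OF t] pos by (simp add: divide_right_mono)
    also have "\<dots> \<le> D * (C * (norm x * log_weight T \<tau> x))"
      using C(2)[OF x] D(1) unfolding t_def by (intro mult_left_mono)
    finally show "\<bar>A (T - ln (norm x)) / norm x ^ j\<bar> \<le> D * C * (norm x * log_weight T \<tau> x)"
      by (simp add: t_def mult_ac)
    have "\<bar>- A' t - real j * A t\<bar> \<le> \<bar>A' t\<bar> + real j * \<bar>A t\<bar>"
      by (metis abs_minus abs_mult abs_of_nat abs_triangle_ineq4)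
    also have "\<dots> \<le> D * t powr (- \<sigma>) + real j * (D * t powr (- \<sigma>))"
      using D(2,3)[OF t] by (intro add_mono mult_left_mono) auto
    finally have 1: "\<bar>- A' t - real j * A t\<bar> \<le> (1 + real j) * D * t powr (- \<sigma>)" by (simp add: algebra_simps)
    have "\<bar>(- A' t - real j * A t) * x $ \<alpha> / norm x ^ (j + 2)\<bar>
        = \<bar>- A' t - real j * A t\<bar> * \<bar>x $ \<alpha>\<bar> / norm x ^ (j + 2)" by (simp add: abs_mult)
    also have "\<dots> \<le> ((1 + real j) * D * t powr (- \<sigma>)) * norm x / norm x ^ (j + 2)"
      using 1 D(1) by (intro divide_right_mono mult_mono component_le_norm_cart) auto
    also have "\<dots> = (1 + real j) * D * (t powr (- \<sigma>) / norm x ^ j) / norm x"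
      using pos by (simp add: field_simps)
    also have "\<dots> \<le> (1 + real j) * D * (C * (norm x * log_weight T \<tau> x)) / norm x"
      using C(2)[OF x] D(1) unfolding t_def by (intro mult_left_mono divide_right_mono) auto
    also have "\<dots> = (1 + real j) * D * C * log_weight T \<tau> x" using pos by simp
    finally show "\<bar>(- A' (T - ln (norm x)) - real j * A (T - ln (norm x))) * x $ \<alpha> / norm x ^ (j + 2)\<bar>
      \<le> (1 + real j) * D * C * log_weight T \<tau> x" by (simp add: t_def)
  qed measurable
qed

lemma direction_directional_derivative:
  fixes x :: "real^'n"
  assumes "x \<noteq> 0"
  shows "((\<lambda>s. (x + s *\<^sub>R axis \<alpha> 1) $ b / norm (x + s *\<^sub>R axis \<alpha> 1)) has_real_derivative
    ((if b = \<alpha> then 1 else 0) - x $ b * x $ \<alpha> / (norm x)\<^sup>2) / norm x) (at 0)"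
proof -
  have "((\<lambda>s. (x + s *\<^sub>R axis \<alpha> 1) $ b) has_real_derivative (if b = \<alpha> then 1 else 0)) (at 0)"
    by (auto simp: axis_def intro!: derivative_eq_intros)
  from DERIV_divide[OF this norm_directional_derivative[OF assms]] assms
  show ?thesis by (simp add: field_simps power2_eq_square)
qed

text \<open>A component of x / |x| is bounded by 1 and its partial derivatives by 2 / r. The product
  rule therefore keeps the class, the constant growing to C + 2 C.\<close>

lemma punctured_adm_direction:
  assumes v: "punctured_adm T \<tau> \<alpha> v dv"
  shows "punctured_adm T \<tau> \<alpha> (\<lambda>x. v x * (x $ b / norm x))
    (\<lambda>x. dv x * (x $ b / norm x) + v x * (((if b = \<alpha> then 1 else 0) - x $ b * x $ \<alpha> / (norm x)\<^sup>2) / norm x))"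
proof -
  have [measurable]: "v \<in> borel_measurable borel" "dv \<in> borel_measurable borel"
    using v by (auto simp: punctured_adm_def)
  from v obtain C where C: "C \<ge> 0" "\<And>x. x \<in> ball 0 1 - {0} \<Longrightarrow> \<bar>v x\<bar> \<le> C * (norm x * log_weight T \<tau> x)"
    "\<And>x. x \<in> ball 0 1 - {0} \<Longrightarrow> \<bar>dv x\<bar> \<le> C * log_weight T \<tau> x" by (rule punctured_adm_boundE) blast
  show ?thesis
  proof (rule punctured_admI[of _ _ _ C _ _ "3 * C"])
    fix x :: "real^'a" assume x: "x \<in> ball 0 1 - {0}"
    then have x0: "x \<noteq> 0" by simp
    have w: "log_weight T \<tau> x \<ge> 0" by (rule log_weight_nonneg)
    have d: "\<bar>x $ i / norm x\<bar> \<le> 1" for i using x0 component_le_norm_cart[of x i] by simp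
    show "((\<lambda>s. v (x + s *\<^sub>R axis \<alpha> 1) * ((x + s *\<^sub>R axis \<alpha> 1) $ b / norm (x + s *\<^sub>R axis \<alpha> 1))) has_real_derivative
      dv x * (x $ b / norm x) + v x * (((if b = \<alpha> then 1 else 0) - x $ b * x $ \<alpha> / (norm x)\<^sup>2) / norm x)) (at 0)"
      using v x direction_directional_derivative[OF x0, of \<alpha> b]
      by (intro DERIV_cong[OF DERIV_mult]) (auto simp: punctured_adm_def)
    have "\<bar>v x\<bar> * \<bar>x $ b / norm x\<bar> \<le> C * (norm x * log_weight T \<tau> x) * 1"
      using C(2)[OF x] d C(1) w by (intro mult_mono) auto
    then show "\<bar>v x * (x $ b / norm x)\<bar> \<le> C * (norm x * log_weight T \<tau> x)" by (simp add: abs_mult)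
    have 1: "\<bar>dv x\<bar> * \<bar>x $ b / norm x\<bar> \<le> C * log_weight T \<tau> x * 1"
      using C(3)[OF x] d C(1) w by (intro mult_mono) auto
    have add: "\<bar>a + b\<bar> \<le> 3 * C * log_weight T \<tau> x"
      if "\<bar>b\<bar> \<le> 2 * C * log_weight T \<tau> x" "\<bar>a\<bar> \<le> C * log_weight T \<tau> x" for a b
      using that by linarith
    have kron: "\<bar>(if P then 1 else 0) - z\<bar> \<le> 2" if "\<bar>z\<bar> \<le> 1" for P and z :: real
      using that by (cases P) auto
    have "\<bar>x $ b * x $ \<alpha> / (norm x)\<^sup>2\<bar> \<le> 1"
      using mult_mono[OF d[of b] d[of \<alpha>]] by (simp add: abs_mult power2_eq_square)
    then have "\<bar>(if b = \<alpha> then 1 else 0) - x $ b * x $ \<alpha> / (norm x)\<^sup>2\<bar> \<le> 2"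
      by (rule kron)
    then have "\<bar>v x\<bar> * (\<bar>(if b = \<alpha> then 1 else 0) - x $ b * x $ \<alpha> / (norm x)\<^sup>2\<bar> / norm x)
        \<le> C * (norm x * log_weight T \<tau> x) * (2 / norm x)"
      using C(2)[OF x] C(1) w by (intro mult_mono divide_right_mono) auto
    also have "\<dots> = 2 * C * log_weight T \<tau> x" using x0 by simp
    finally have 2: "\<bar>v x * (((if b = \<alpha> then 1 else 0) - x $ b * x $ \<alpha> / (norm x)\<^sup>2) / norm x)\<bar> \<le> 2 * C * log_weight T \<tau> x"
      by (simp add: abs_mult)
    from 1 have "\<bar>dv x * (x $ b / norm x)\<bar> \<le> C * log_weight T \<tau> x" by (simp add: abs_mult)
    with 2 show "\<bar>dv x * (x $ b / norm x) + v x * (((if b = \<alpha> then 1 else 0) - x $ b * x $ \<alpha> / (norm x)\<^sup>2) / norm x)\<bar>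
      \<le> 3 * C * log_weight T \<tau> x" using add by blast
  qed measurable
qed

lemma punctured_adm_add:
  assumes u: "punctured_adm T \<tau> \<alpha> u du" and v: "punctured_adm T \<tau> \<alpha> v dv"
  shows "punctured_adm T \<tau> \<alpha> (\<lambda>x. u x + v x) (\<lambda>x. du x + dv x)"
proof -
  from u obtain C where C: "C \<ge> 0" "\<And>x. x \<in> ball 0 1 - {0} \<Longrightarrow> \<bar>u x\<bar> \<le> C * (norm x * log_weight T \<tau> x)"
    "\<And>x. x \<in> ball 0 1 - {0} \<Longrightarrow> \<bar>du x\<bar> \<le> C * log_weight T \<tau> x" by (rule punctured_adm_boundE) blast
  from v obtain D where D: "D \<ge> 0" "\<And>x. x \<in> ball 0 1 - {0} \<Longrightarrow> \<bar>v x\<bar> \<le> D * (norm x * log_weight T \<tau> x)"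
    "\<And>x. x \<in> ball 0 1 - {0} \<Longrightarrow> \<bar>dv x\<bar> \<le> D * log_weight T \<tau> x" by (rule punctured_adm_boundE) blast
  show ?thesis
  proof (rule punctured_admI[of _ _ _ "C + D" _ _ "C + D"])
    fix x :: "real^'a" assume x: "x \<in> ball 0 1 - {0}"
    show "((\<lambda>s. u (x + s *\<^sub>R axis \<alpha> 1) + v (x + s *\<^sub>R axis \<alpha> 1)) has_real_derivative du x + dv x) (at 0)"
      using u v x by (intro DERIV_add) (auto simp: punctured_adm_def)
    show "\<bar>u x + v x\<bar> \<le> (C + D) * (norm x * log_weight T \<tau> x)" "\<bar>du x + dv x\<bar> \<le> (C + D) * log_weight T \<tau> x"
      unfolding distrib_right using C(2,3)[OF x] D(2,3)[OF x] by linarith+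
  qed (use u v in \<open>auto simp: punctured_adm_def\<close>)
qed

lemma punctured_adm_cmult:
  assumes u: "punctured_adm T \<tau> \<alpha> u du"
  shows "punctured_adm T \<tau> \<alpha> (\<lambda>x. c * u x) (\<lambda>x. c * du x)"
proof -
  from u obtain C where C: "C \<ge> 0" "\<And>x. x \<in> ball 0 1 - {0} \<Longrightarrow> \<bar>u x\<bar> \<le> C * (norm x * log_weight T \<tau> x)"
    "\<And>x. x \<in> ball 0 1 - {0} \<Longrightarrow> \<bar>du x\<bar> \<le> C * log_weight T \<tau> x" by (rule punctured_adm_boundE) blast
  show ?thesis
  proof (rule punctured_admI[of _ _ _ "\<bar>c\<bar> * C" _ _ "\<bar>c\<bar> * C"])
    fix x :: "real^'a" assume x: "x \<in> ball 0 1 - {0}"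
    show "((\<lambda>s. c * u (x + s *\<^sub>R axis \<alpha> 1)) has_real_derivative c * du x) (at 0)"
      using u x by (intro DERIV_cmult) (auto simp: punctured_adm_def)
    show "\<bar>c * u x\<bar> \<le> \<bar>c\<bar> * C * (norm x * log_weight T \<tau> x)" "\<bar>c * du x\<bar> \<le> \<bar>c\<bar> * C * log_weight T \<tau> x"
      unfolding abs_mult mult.assoc using C(2,3)[OF x] by (auto intro!: mult_left_mono)
  qed (use u in \<open>auto simp: punctured_adm_def\<close>)
qed

text \<open>A power of r beats the logarithm. With y = -ln r one has t = T + y <= 2 T (1 + y/2) <= 2
  T exp(y/2), hence t^2 <= 4 T^2 / r; as n - 1 >= 2, multiplying by r^(n-1) leaves at most 4 T^2.
  Thus merely bounded functions, such as the components of \<open>U_map\<close>, fall under the same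
  majorant.\<close>

lemma log_weight_lower_bound:
  fixes x :: "real^'n"
  assumes x: "x \<in> ball 0 1 - {0}" and n: "CARD('n) > 2" and T: "T \<ge> 1" and \<tau>: "\<tau> \<le> 2"
  shows "1 \<le> 4 * T\<^sup>2 * (norm x * log_weight T \<tau> x)"
proof -
  define r where "r = norm x"
  define y where "y = - ln r"
  have r: "0 < r" "r < 1" using x by (auto simp: r_def)
  then have y: "y > 0" by (simp add: y_def)
  have r_eq: "r = exp (- y)" using r by (simp add: y_def)
  have Ty: "T + y \<ge> 1" using T y by linarith
  have "y \<le> T * y" using T y mult_right_mono[of 1 T y] by simp
  then have "T + y \<le> 2 * T * (1 + y / 2)" using T by (simp add: algebra_simps)
  also have "\<dots> \<le> 2 * T * exp (y / 2)" using T exp_ge_add_one_self[of "y/2"] by (intro mult_left_mono) auto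
  finally have "(T + y)\<^sup>2 \<le> (2 * T * exp (y / 2))\<^sup>2" using Ty by (intro power_mono) auto
  also have "\<dots> = 4 * T\<^sup>2 * exp y" by (simp add: power_mult_distrib exp_double[symmetric])
  also have "\<dots> = 4 * T\<^sup>2 / r" by (simp add: r_eq exp_minus divide_inverse)
  finally have 1: "(T + y)\<^sup>2 \<le> 4 * T\<^sup>2 / r" .
  have "(T + y) powr \<tau> \<le> (T + y) powr 2" using Ty \<tau> by (intro powr_mono) auto
  also have "\<dots> = (T + y)\<^sup>2" using Ty by (simp add: powr_numeral)
  finally have 2: "(T + y) powr \<tau> \<le> 4 * T\<^sup>2 / r" using 1 by simp
  obtain k where k: "CARD('n) = k + 2" "k > 0" using n by (metis add.commute less_imp_add_positive)
  have "r ^ k \<le> r ^ 1" using r k by (intro power_decreasing) auto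
  then have "(T + y) powr \<tau> * r ^ (k + 1) \<le> (4 * T\<^sup>2 / r) * (r * r)"
    using 2 r by (intro mult_mono) (auto simp: mult_right_mono)
  also have "\<dots> = 4 * T\<^sup>2 * r" using r by simp
  also have "\<dots> \<le> 4 * T\<^sup>2" using r by (intro mult_left_le) auto
  finally have "1 \<le> 4 * T\<^sup>2 / ((T + y) powr \<tau> * r ^ (k + 1))"
    using Ty r by (subst le_divide_eq_1_pos) auto
  also have "\<dots> = 4 * T\<^sup>2 * (r * ((T + y) powr (- \<tau>) / r ^ (k + 2)))"
    using r Ty by (simp add: powr_minus field_simps)
  finally show ?thesis by (simp add: log_weight_def r_def y_def k)
qed

text \<open>Here j = n - 1, the power of r in |\<nabla>U|^(n-2) \<nabla>U. For this power
  t^(-\<tau>) / r^j is r times the weight itself, hence the constant 1.\<close>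

lemma punctured_adm_radial_top:
  fixes \<alpha> :: "'n::finite"
  assumes A: "log_symbol \<sigma> A A'" and T: "T \<ge> 1" and "\<tau> \<le> \<sigma>" and j: "CARD('n) = j + 1"
  shows "punctured_adm T \<tau> \<alpha> (\<lambda>x. A (T - ln (norm x)) / norm x ^ j)
    (\<lambda>x. (- A' (T - ln (norm x)) - real j * A (T - ln (norm x))) * x $ \<alpha> / norm x ^ (j + 2))"
  by (rule punctured_adm_radial[OF log_symbol_mono[OF A \<open>\<tau> \<le> \<sigma>\<close>] T, of 1]) (auto simp: log_weight_def j)

text \<open>The case j = 0, needed for the components of \<open>U_map\<close>;
  \<open>log_weight_lower_bound\<close> absorbs a bounded function into r times the weight.\<close>

lemma punctured_adm_radial_bounded:
  fixes \<alpha> :: "'n::finite"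
  assumes A: "log_symbol \<sigma> A A'" and T: "T \<ge> 1" and \<tau>: "\<tau> \<le> 2" and \<sigma>: "0 \<le> \<sigma>" and n: "CARD('n) > 2"
  shows "punctured_adm T \<tau> \<alpha> (\<lambda>x. A (T - ln (norm x))) (\<lambda>x. - A' (T - ln (norm x)) * x $ \<alpha> / (norm x)\<^sup>2)"
proof -
  have "punctured_adm T \<tau> \<alpha> (\<lambda>x. A (T - ln (norm x)) / norm x ^ 0)
    (\<lambda>x. (- A' (T - ln (norm x)) - real 0 * A (T - ln (norm x))) * x $ \<alpha> / norm x ^ (0 + 2))"
  proof (rule punctured_adm_radial[OF log_symbol_mono[OF A \<sigma>] T, of "4 * T\<^sup>2"])
    fix x :: "real^'n" assume x: "x \<in> ball 0 1 - {0}"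
    have "(T - ln (norm x)) powr - 0 / norm x ^ 0 \<le> 1" by simp
    also note log_weight_lower_bound[OF x n T \<tau>]
    finally show "(T - ln (norm x)) powr - 0 / norm x ^ 0 \<le> 4 * T\<^sup>2 * (norm x * log_weight T \<tau> x)" .
  qed simp
  then show ?thesis by (simp add: power2_eq_square)
qed

section \<open>Weak formulations\<close>

lemma borel_measurable_vecI:
  fixes f :: "'a \<Rightarrow> 'b::euclidean_space ^ 'n"
  assumes "\<And>i. (\<lambda>x. f x $ i) \<in> borel_measurable M"
  shows "f \<in> borel_measurable M"
proof -
  have "(\<lambda>x. f x $ i \<bullet> u) \<in> borel_measurable M" for i u
    using assms by (intro borel_measurable_inner) auto
  then show ?thesis
    by (subst borel_measurable_euclidean_space) (auto simp: Basis_vec_def inner_axis)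
qed

lemma norm_vec_le_sum:
  fixes x :: "'b::real_normed_vector ^ 'n"
  shows "norm x \<le> (\<Sum>i\<in>UNIV. norm (x $ i))"
  by (simp add: norm_vec_def L2_set_le_sum)

lemma vec_norm_boundI:
  fixes f :: "'a \<Rightarrow> 'b::real_normed_vector ^ 'n::finite"
  assumes "\<And>i. \<exists>C. \<forall>x\<in>S. norm (f x $ i) \<le> C * g x"
  shows "\<exists>C. \<forall>x\<in>S. norm (f x) \<le> C * (g x :: real)"
proof -
  from assms obtain C where C: "\<And>i x. x \<in> S \<Longrightarrow> norm (f x $ i) \<le> C i * g x" by metis
  have "norm (f x) \<le> sum C UNIV * g x" if "x \<in> S" for x
  proof -
    have "norm (f x) \<le> (\<Sum>i\<in>UNIV. norm (f x $ i))" by (rule norm_vec_le_sum)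
    also have "\<dots> \<le> (\<Sum>i\<in>UNIV. C i * g x)" using C that by (intro sum_mono) auto
    finally show ?thesis by (simp add: sum_distrib_right)
  qed
  then show ?thesis by blast
qed

lemma AE_lebesgue_neq_0: "AE x in lebesgue. x \<noteq> (0::'a::euclidean_space)"
  by (rule AE_completion) (rule AE_lborel_singleton)

lemma set_integrable_lebesgue_log_weight:
  assumes "T > 0" "\<tau> > 1"
  shows "set_integrable lebesgue (ball (0::'a::euclidean_space) 1) (log_weight T \<tau>)"
proof -
  have "(\<lambda>x::'a. indicator (ball 0 1) x *\<^sub>R log_weight T \<tau> x) \<in> borel_measurable borel"
    by (intro borel_measurable_scaleR borel_measurable_indicator) auto
  then show ?thesis
    using set_integrable_log_weight[OF assms, where 'a = 'a]
    by (simp add: set_integrable_def integrable_completion)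
qed

lemma absolutely_integrable_log_weight_bound:
  fixes f :: "'a::euclidean_space \<Rightarrow> 'b::euclidean_space"
  assumes f: "f \<in> borel_measurable borel"
    and bound: "\<exists>C. \<forall>x\<in>ball 0 1 - {0}. norm (f x) \<le> C * log_weight T \<tau> x"
    and T: "T > 0" "\<tau> > 1"
  shows "f absolutely_integrable_on ball 0 1"
proof -
  obtain C where C: "\<forall>x\<in>ball 0 1 - {0}. norm (f x) \<le> C * log_weight T \<tau> x" using bound by blast
  have "integrable lebesgue (\<lambda>x. indicator (ball 0 1) x *\<^sub>R (C * log_weight T \<tau> x))"
    using set_integrable_mult_right[OF set_integrable_lebesgue_log_weight[OF T], of C]
    by (simp add: set_integrable_def)
  then have "integrable lebesgue (\<lambda>x. indicator (ball 0 1) x *\<^sub>R f x)"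
  proof (rule Bochner_Integration.integrable_bound)
    have "(\<lambda>x. indicator (ball 0 1) x *\<^sub>R f x) \<in> borel_measurable borel"
      using f by (intro borel_measurable_scaleR borel_measurable_indicator) auto
    then show "(\<lambda>x. indicator (ball 0 1) x *\<^sub>R f x) \<in> borel_measurable lebesgue"
      by (simp add: measurable_completion)
    show "AE x in lebesgue. norm (indicator (ball 0 1) x *\<^sub>R f x) \<le> norm (indicator (ball 0 1) x *\<^sub>R (C * log_weight T \<tau> x))"
      using AE_lebesgue_neq_0
    proof eventually_elim
      case (elim x)
      show ?case
      proof (cases "x \<in> ball 0 1")
        case True
        then have "norm (f x) \<le> C * log_weight T \<tau> x" using C elim by blast
        then show ?thesis using True by (simp add: abs_le_iff)
      qed simp
    qed
  qed
  then show ?thesis by (simp add: set_integrable_def)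
qed

lemma locally_integrable_log_weight_bound:
  fixes f :: "'a::euclidean_space \<Rightarrow> 'b::euclidean_space"
  assumes "f \<in> borel_measurable borel"
    and "\<exists>C. \<forall>x\<in>ball 0 1 - {0}. norm (f x) \<le> C * log_weight T \<tau> x"
    and "T > 0" "\<tau> > 1"
  shows "f locally_integrable_on ball 0 1"
  unfolding locally_integrable_on_def
proof (intro allI impI)
  fix K :: "'a set" assume K: "compact K \<and> K \<subseteq> ball 0 1"
  then have "K \<in> sets lebesgue" by (simp add: borel_compact)
  then show "f absolutely_integrable_on K"
    using absolutely_integrable_log_weight_bound[OF assms] K by (blast intro: set_integrable_subset)
qed

text \<open>The functional \<open>L\<close> is the identity for scalar test functions and a
  coordinate for vector-valued ones, so both weak formulations draw on the same facts. Boundedness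
  follows from continuity and compact support, since the derivative vanishes off the support
  too.\<close>

lemma test_function_component:
  fixes \<phi> :: "'a::euclidean_space \<Rightarrow> 'b::real_normed_vector" and L :: "'b \<Rightarrow> real"
  assumes \<phi>: "test_function S \<phi>" and L: "bounded_linear L"
  shows "((\<lambda>s. L (\<phi> (x + s *\<^sub>R e))) has_real_derivative L (frechet_derivative \<phi> (at x) e)) (at 0)" (is ?der)
    and "(\<lambda>x. L (\<phi> x)) \<in> borel_measurable borel"
    and "(\<lambda>x. L (frechet_derivative \<phi> (at x) e)) \<in> borel_measurable borel"
    and "\<exists>M. \<forall>x. \<bar>L (\<phi> x)\<bar> \<le> M \<and> \<bar>L (frechet_derivative \<phi> (at x) e)\<bar> \<le> M"
    and "x \<notin> closure {x. \<phi> x \<noteq> 0} \<Longrightarrow> L (\<phi> x) = 0"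
proof -
  let ?K = "closure {x. \<phi> x \<noteq> 0}"
  interpret L: bounded_linear L by (rule L)
  have cd: "continuously_differentiable (Suc 0) \<phi>" "continuously_differentiable 0 \<phi>" and K: "compact ?K"
    using \<phi> unfolding test_function_def by blast+
  have der: "(\<phi> has_derivative frechet_derivative \<phi> (at x)) (at x)" for x
    using cd(1) by (simp add: frechet_derivative_works)
  have cont: "continuous_on UNIV \<phi>" "continuous_on UNIV (\<lambda>x. frechet_derivative \<phi> (at x) e)"
    using cd by auto
  have "((\<lambda>s. \<phi> (x + s *\<^sub>R e)) has_derivative (\<lambda>s. frechet_derivative \<phi> (at x) (s *\<^sub>R e))) (at 0)"
    using der[of x] by (intro has_derivative_compose[of "\<lambda>s. x + s *\<^sub>R e" "\<lambda>s. s *\<^sub>R e" 0 UNIV \<phi>])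
      (auto intro!: derivative_eq_intros)
  then have "((\<lambda>s. L (\<phi> (x + s *\<^sub>R e))) has_derivative (\<lambda>s. L (frechet_derivative \<phi> (at x) (s *\<^sub>R e)))) (at 0)"
    by (rule L.has_derivative)
  moreover have "(\<lambda>s. L (frechet_derivative \<phi> (at x) (s *\<^sub>R e))) = (*) (L (frechet_derivative \<phi> (at x) e))"
    using linear_frechet_derivative[OF differentiableI[OF der[of x]]]
    by (auto simp: fun_eq_iff linear_scale L.scaleR)
  ultimately show ?der by (simp add: has_field_derivative_def)
  have c: "continuous_on UNIV (\<lambda>x. L (\<phi> x))" "continuous_on UNIV (\<lambda>x. L (frechet_derivative \<phi> (at x) e))"
    using cont L.continuous_on by blast+
  then show "(\<lambda>x. L (\<phi> x)) \<in> borel_measurable borel"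
    "(\<lambda>x. L (frechet_derivative \<phi> (at x) e)) \<in> borel_measurable borel"
    by (auto intro: borel_measurable_continuous_onI)
  have off: "\<phi> y = 0" if "y \<notin> ?K" for y using that closure_subset[of "{x. \<phi> x \<noteq> 0}"] by blast
  show "L (\<phi> x) = 0" if "x \<notin> ?K" unfolding off[OF that] by (rule L.zero)
  have doff: "frechet_derivative \<phi> (at y) e = 0" if "y \<notin> ?K" for y
  proof -
    have "(\<phi> has_derivative (\<lambda>_. 0)) (at y)"
    proof (rule has_derivative_transform_within_open[OF has_derivative_const[of 0]])
      show "open (- ?K)" by (intro open_Compl closed_closure)
      show "y \<in> - ?K" using that by (simp only: Compl_iff not_False_eq_True)
      show "0 = \<phi> z" if "z \<in> - ?K" for z using off[of z] that by (metis ComplD)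
    qed
    from has_derivative_unique[OF der[of y] this] show ?thesis by (rule fun_cong)
  qed
  have "compact ((\<lambda>x. L (\<phi> x)) ` ?K)" "compact ((\<lambda>x. L (frechet_derivative \<phi> (at x) e)) ` ?K)"
    using K c by (auto intro!: compact_continuous_image intro: continuous_on_subset)
  then obtain M1 M2 where M: "\<forall>x\<in>?K. \<bar>L (\<phi> x)\<bar> \<le> M1" "\<forall>x\<in>?K. \<bar>L (frechet_derivative \<phi> (at x) e)\<bar> \<le> M2"
    by (auto dest!: compact_imp_bounded simp: bounded_iff)
  have "\<bar>L (\<phi> x)\<bar> \<le> max 0 (max M1 M2) \<and> \<bar>L (frechet_derivative \<phi> (at x) e)\<bar> \<le> max 0 (max M1 M2)" for x
  proof (cases "x \<in> ?K")
    case True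
    then show ?thesis using M by (auto simp: le_max_iff_disj)
  next
    case False
    show ?thesis unfolding off[OF False] doff[OF False] L.zero by simp
  qed
  then show "\<exists>M. \<forall>x. \<bar>L (\<phi> x)\<bar> \<le> M \<and> \<bar>L (frechet_derivative \<phi> (at x) e)\<bar> \<le> M" by blast
qed

lemma set_integral_lebesgue_lborel:
  fixes f :: "'a::euclidean_space \<Rightarrow> real"
  assumes "f \<in> borel_measurable borel" "S \<in> sets borel"
  shows "(LINT x:S|lebesgue. f x) = (LINT x:S|lborel. f x)"
  unfolding set_lebesgue_integral_def using assms
  by (intro integral_completion) (auto intro!: borel_measurable_scaleR borel_measurable_indicator)

lemma log_weight_bounded_away_0:
  fixes x :: "'a::euclidean_space"
  assumes "T \<ge> 1" "\<tau> > 0" "\<epsilon> > 0" "\<epsilon> \<le> norm x" "norm x < 1"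
  shows "log_weight T \<tau> x \<le> 1 / \<epsilon> ^ DIM('a)"
proof -
  have "x \<noteq> 0" using assms by auto
  then have "ln (norm x) \<le> 0" using assms by simp
  then have "T - ln (norm x) \<ge> 1" using assms by linarith
  then have "(T - ln (norm x)) powr (- \<tau>) \<le> (T - ln (norm x)) powr 0" using assms by (intro powr_mono) auto
  then have "(T - ln (norm x)) powr (- \<tau>) \<le> 1" using \<open>T - ln (norm x) \<ge> 1\<close> by simp
  then show ?thesis unfolding log_weight_def
    using assms by (intro frac_le power_mono) auto
qed

text \<open>A multiple of \<open>log_weight\<close> serves as the majorant \<open>w\<close>; it is
  integrable since \<tau> > 1 and bounded away from the origin. The two integrability claims are
  what later permits exchanging finite sums with integrals.\<close>

lemma punctured_adm_test_function:
  fixes \<phi> :: "real^'n \<Rightarrow> 'b::real_normed_vector"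
  assumes v: "punctured_adm T \<tau> \<alpha> v dv" and T: "T \<ge> 1" "\<tau> > 1"
    and \<phi>: "test_function (ball 0 1) \<phi>" and L: "bounded_linear L"
  shows "set_integrable lebesgue (ball 0 1) (\<lambda>x. v x * L (frechet_derivative \<phi> (at x) (axis \<alpha> 1)))"
    and "set_integrable lebesgue (ball 0 1) (\<lambda>x. dv x * L (\<phi> x))"
    and "(LINT x:ball 0 1|lebesgue. v x * L (frechet_derivative \<phi> (at x) (axis \<alpha> 1)))
      = - (LINT x:ball 0 1|lebesgue. dv x * L (\<phi> x))"
proof -
  let ?d = "\<lambda>x. L (frechet_derivative \<phi> (at x) (axis \<alpha> 1))"
  note tf = test_function_component[OF \<phi> L]
  have vm [measurable]: "v \<in> borel_measurable borel" "dv \<in> borel_measurable borel"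
    using v by (auto simp: punctured_adm_def)
  note [measurable] = tf(2,3)
  from v obtain C where C: "C \<ge> 0" "\<And>x. x \<in> ball 0 1 - {0} \<Longrightarrow> \<bar>v x\<bar> \<le> C * (norm x * log_weight T \<tau> x)"
    "\<And>x. x \<in> ball 0 1 - {0} \<Longrightarrow> \<bar>dv x\<bar> \<le> C * log_weight T \<tau> x" by (rule punctured_adm_boundE) blast
  obtain M where M: "\<And>x. \<bar>L (\<phi> x)\<bar> \<le> M" "\<And>x. \<bar>?d x\<bar> \<le> M" using tf(4) by metis
  have M0: "M \<ge> 0" using M(1)[of 0] by linarith
  show "set_integrable lebesgue (ball 0 1) (\<lambda>x. dv x * L (\<phi> x))"
  proof (rule absolutely_integrable_log_weight_bound)
    have "norm (dv x * L (\<phi> x)) \<le> C * M * log_weight T \<tau> x" if x: "x \<in> ball 0 1 - {0}" for x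
    proof -
      have "\<bar>dv x\<bar> * \<bar>L (\<phi> x)\<bar> \<le> (C * log_weight T \<tau> x) * M"
        using C(3)[OF x] M C(1) by (intro mult_mono) (auto simp: log_weight_nonneg)
      then show ?thesis by (simp add: abs_mult mult_ac)
    qed
    then show "\<exists>C. \<forall>x\<in>ball 0 1 - {0}. norm (dv x * L (\<phi> x)) \<le> C * log_weight T \<tau> x" by blast
  qed (use T in auto)
  show "set_integrable lebesgue (ball 0 1) (\<lambda>x. v x * ?d x)"
  proof (rule absolutely_integrable_log_weight_bound)
    have "norm (v x * ?d x) \<le> C * M * log_weight T \<tau> x" if x: "x \<in> ball 0 1 - {0}" for x
    proof -
      have "norm x * log_weight T \<tau> x \<le> log_weight T \<tau> x"
        using x by (intro mult_left_le_one_le) (auto simp: log_weight_nonneg)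
      then have "\<bar>v x\<bar> \<le> C * log_weight T \<tau> x"
        using C(2)[OF x] C(1) by (elim order_trans) (rule mult_left_mono)
      then have "\<bar>v x\<bar> * \<bar>?d x\<bar> \<le> (C * log_weight T \<tau> x) * M"
        using M C(1) by (intro mult_mono) (auto simp: log_weight_nonneg)
      then show ?thesis by (simp add: abs_mult mult_ac)
    qed
    then show "\<exists>C. \<forall>x\<in>ball 0 1 - {0}. norm (v x * ?d x) \<le> C * log_weight T \<tau> x" by blast
  qed (use T in auto)
  have "(LINT x:ball 0 1|lborel. v x * ?d x) = - (LINT x:ball 0 1|lborel. dv x * L (\<phi> x))"
  proof (rule punctured_ball_integration_by_parts[where e = "axis \<alpha> 1" and w = "\<lambda>x. C * log_weight T \<tau> x"
        and M = M and K = "closure {x. \<phi> x \<noteq> 0}"])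
    show "((\<lambda>s. v (x + s *\<^sub>R axis \<alpha> 1)) has_real_derivative dv x) (at 0)" if "x \<in> ball 0 1 - {0}" for x
      using v that by (auto simp: punctured_adm_def)
    show "\<bar>v x\<bar> \<le> norm x * (C * log_weight T \<tau> x)" if "x \<in> ball 0 1 - {0}" for x
      using C(2)[OF that] by (simp add: mult_ac)
    show "set_integrable lborel (ball 0 1) (\<lambda>x::real^'n. C * log_weight T \<tau> x)"
      using T by (intro set_integrable_mult_right set_integrable_log_weight) auto
    show "\<exists>D. \<forall>x::real^'n. \<epsilon> \<le> norm x \<and> norm x < 1 \<longrightarrow> C * log_weight T \<tau> x \<le> D" if "\<epsilon> > 0" for \<epsilon>
    proof (intro exI allI impI)
      fix x :: "real^'n" assume "\<epsilon> \<le> norm x \<and> norm x < 1"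
      then show "C * log_weight T \<tau> x \<le> C * (1 / \<epsilon> ^ DIM(real^'n))"
        using that T C(1) by (intro mult_left_mono log_weight_bounded_away_0) auto
    qed
    show "closure {x. \<phi> x \<noteq> 0} \<subseteq> ball 0 1" using \<phi> by (simp add: test_function_def)
  qed (use C M tf in auto)
  moreover have "(\<lambda>x. v x * ?d x) \<in> borel_measurable borel" "(\<lambda>x. dv x * L (\<phi> x)) \<in> borel_measurable borel"
    by (intro borel_measurable_times; fact)+
  note this[THEN set_integral_lebesgue_lborel[where S = "ball 0 1"]]
  ultimately show "(LINT x:ball 0 1|lebesgue. v x * ?d x) = - (LINT x:ball 0 1|lebesgue. dv x * L (\<phi> x))"
    by simp
qed

lemma punctured_admD:
  assumes "punctured_adm T \<tau> \<alpha> v dv"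
  shows "v \<in> borel_measurable borel" "dv \<in> borel_measurable borel"
    and "\<exists>C. \<forall>x\<in>ball 0 1 - {0}. norm (v x) \<le> C * log_weight T \<tau> x"
    and "\<exists>C. \<forall>x\<in>ball 0 1 - {0}. norm (dv x) \<le> C * log_weight T \<tau> x"
proof -
  show "v \<in> borel_measurable borel" "dv \<in> borel_measurable borel"
    using assms by (auto simp: punctured_adm_def)
  from assms obtain C where C: "C \<ge> 0" "\<And>x. x \<in> ball 0 1 - {0} \<Longrightarrow> \<bar>v x\<bar> \<le> C * (norm x * log_weight T \<tau> x)"
    "\<And>x. x \<in> ball 0 1 - {0} \<Longrightarrow> \<bar>dv x\<bar> \<le> C * log_weight T \<tau> x"
    by (rule punctured_adm_boundE) blast
  have "\<bar>v x\<bar> \<le> C * log_weight T \<tau> x" if "x \<in> ball 0 1 - {0}" for x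
    using C(2)[OF that]
  proof (rule order_trans)
    show "C * (norm x * log_weight T \<tau> x) \<le> C * log_weight T \<tau> x"
      using that C(1) by (intro mult_left_mono mult_left_le_one_le) (auto simp: log_weight_nonneg)
  qed
  then show "\<exists>C. \<forall>x\<in>ball 0 1 - {0}. norm (v x) \<le> C * log_weight T \<tau> x"
    by (intro exI[of _ C]) auto
  show "\<exists>C. \<forall>x\<in>ball 0 1 - {0}. norm (dv x) \<le> C * log_weight T \<tau> x"
    using C(3) by (intro exI[of _ C]) auto
qed

text \<open>Admissibility rules out any contribution of the origin, so the classical gradient off
  the origin is already the weak one on the whole ball.\<close>

lemma has_weak_gradient_on_punctured:
  fixes u :: "real^'n \<Rightarrow> real^'m" and G :: "real^'n \<Rightarrow> real^'n^'m"
  assumes adm: "\<And>i \<alpha>. punctured_adm T \<tau> \<alpha> (\<lambda>x. u x $ i) (\<lambda>x. G x $ i $ \<alpha>)"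
    and T: "T \<ge> 1" "\<tau> > 1"
  shows "has_weak_gradient_on u G (ball 0 1)"
  unfolding has_weak_gradient_on_def
proof (intro conjI allI impI)
  have "u \<in> borel_measurable borel" "G \<in> borel_measurable borel"
    by (intro borel_measurable_vecI punctured_admD(1,2)[OF adm])+
  moreover have "\<exists>C. \<forall>x\<in>ball 0 1 - {0}. norm (u x) \<le> C * log_weight T \<tau> x"
    "\<exists>C. \<forall>x\<in>ball 0 1 - {0}. norm (G x) \<le> C * log_weight T \<tau> x"
    by (intro vec_norm_boundI punctured_admD(3,4)[OF adm])+
  ultimately show "u locally_integrable_on ball 0 1" "G locally_integrable_on ball 0 1"
    using T by (auto intro!: locally_integrable_log_weight_bound[where T = T and \<tau> = \<tau>])
  fix \<phi> :: "real^'n \<Rightarrow> real" and i \<alpha>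
  assume "test_function (ball 0 1) \<phi>"
  from punctured_adm_test_function(3)[OF adm T this bounded_linear_ident]
  show "(LINT x:ball 0 1|lebesgue. u x $ i * frechet_derivative \<phi> (at x) (axis \<alpha> 1)) =
              - (LINT x:ball 0 1|lebesgue. G x $ i $ \<alpha> * \<phi> x)" .
qed

lemma set_integral_sum_real:
  fixes f :: "'i \<Rightarrow> 'a \<Rightarrow> real"
  assumes "\<And>i. i \<in> I \<Longrightarrow> set_integrable M A (f i)"
  shows "set_integrable M A (\<lambda>x. \<Sum>i\<in>I. f i x)"
    and "(LINT x:A|M. \<Sum>i\<in>I. f i x) = (\<Sum>i\<in>I. LINT x:A|M. f i x)"
  using assms unfolding set_integrable_def set_lebesgue_integral_def scaleR_sum_right
  by (auto intro!: Bochner_Integration.integrable_sum Bochner_Integration.integral_sum)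

text \<open>Every entry of \<open>V\<close> is integrated by parts on its own and the results are
  summed. The pointwise equation is required off the origin only, a null set being irrelevant to the
  integrals; for this reason measurability of \<open>F\<close> is a separate hypothesis, while its
  local integrability is inherited from the entries of \<open>dV\<close>.\<close>

lemma minus_div_eq_distrib_punctured:
  fixes V :: "real^'n \<Rightarrow> real^'n^'m" and F :: "real^'n \<Rightarrow> real^'m"
  assumes adm: "\<And>i \<alpha>. punctured_adm T \<tau> \<alpha> (\<lambda>x. V x $ i $ \<alpha>) (dV i \<alpha>)"
    and F: "\<And>x i. x \<in> ball 0 1 - {0} \<Longrightarrow> F x $ i = - (\<Sum>\<alpha>\<in>UNIV. dV i \<alpha> x)"
    and F_meas: "F \<in> borel_measurable borel"
    and T: "T \<ge> 1" "\<tau> > 1"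
  shows "minus_div_eq_distrib V F (ball 0 1)"
  unfolding minus_div_eq_distrib_def
proof (intro conjI allI impI)
  let ?B = "ball (0::real^'n) 1"
  have V_meas: "V \<in> borel_measurable borel"
    by (intro borel_measurable_vecI punctured_admD(1)[OF adm])
  have "\<exists>C. \<forall>x\<in>?B - {0}. norm (V x) \<le> C * log_weight T \<tau> x"
    by (intro vec_norm_boundI punctured_admD(3)[OF adm])
  then show "V locally_integrable_on ?B"
    using T V_meas by (intro locally_integrable_log_weight_bound[where T = T and \<tau> = \<tau>]) auto
  have "\<exists>C. \<forall>x\<in>?B - {0}. norm (F x $ i) \<le> C * log_weight T \<tau> x" for i
  proof -
    have "\<exists>C. \<forall>x\<in>?B - {0}. norm (dV i \<alpha> x) \<le> C * log_weight T \<tau> x" for \<alpha>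
      by (rule punctured_admD(4)[OF adm])
    then obtain C where C: "\<And>\<alpha> x. x \<in> ?B - {0} \<Longrightarrow> \<bar>dV i \<alpha> x\<bar> \<le> C \<alpha> * log_weight T \<tau> x"
      unfolding real_norm_def by metis
    have "norm (F x $ i) \<le> sum C UNIV * log_weight T \<tau> x" if x: "x \<in> ?B - {0}" for x
    proof -
      have "norm (F x $ i) \<le> (\<Sum>\<alpha>\<in>UNIV. \<bar>dV i \<alpha> x\<bar>)" using F[OF x] by (simp add: sum_abs)
      also have "\<dots> \<le> (\<Sum>\<alpha>\<in>UNIV. C \<alpha> * log_weight T \<tau> x)" using C x by (intro sum_mono) auto
      finally show ?thesis by (simp add: sum_distrib_right)
    qed
    then show ?thesis by blast
  qed
  then have "\<exists>C. \<forall>x\<in>?B - {0}. norm (F x) \<le> C * log_weight T \<tau> x"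
    by (intro vec_norm_boundI)
  then show "F locally_integrable_on ?B"
    using T F_meas by (intro locally_integrable_log_weight_bound[where T = T and \<tau> = \<tau>]) auto
  fix \<phi> :: "real^'n \<Rightarrow> real^'m" assume \<phi>: "test_function ?B \<phi>"
  have L: "bounded_linear (\<lambda>y::real^'m. y $ i)" for i by (rule bounded_linear_vec_nth)
  note tf = punctured_adm_test_function[OF adm T \<phi> L]
  let ?I = "\<lambda>f. (LINT x:?B|lebesgue. f x)"
  have neg: "?I (\<lambda>x. - f x) = - ?I f" for f :: "real^'n \<Rightarrow> real"
    by (simp only: set_lebesgue_integral_def scaleR_minus_right Bochner_Integration.integral_minus)
  have "?I (\<lambda>x. V x \<bullet> jacobian \<phi> (at x)) =
      ?I (\<lambda>x. \<Sum>i\<in>UNIV. \<Sum>\<alpha>\<in>UNIV. V x $ i $ \<alpha> * (frechet_derivative \<phi> (at x) (axis \<alpha> 1) $ i))"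
    by (simp add: inner_vec_def jacobian_def matrix_def)
  also have "\<dots> = (\<Sum>i\<in>UNIV. \<Sum>\<alpha>\<in>UNIV. ?I (\<lambda>x. V x $ i $ \<alpha> * (frechet_derivative \<phi> (at x) (axis \<alpha> 1) $ i)))"
    by (subst set_integral_sum_real; (intro set_integral_sum_real tf(1))?) (intro sum.cong refl set_integral_sum_real tf(1))
  also have "\<dots> = (\<Sum>i\<in>UNIV. \<Sum>\<alpha>\<in>UNIV. ?I (\<lambda>x. - (dV i \<alpha> x * (\<phi> x $ i))))"
    by (simp only: tf(3) neg)
  also have "\<dots> = ?I (\<lambda>x. \<Sum>i\<in>UNIV. \<Sum>\<alpha>\<in>UNIV. - (dV i \<alpha> x * (\<phi> x $ i)))"
  proof -
    have "set_integrable lebesgue ?B (\<lambda>x. - (dV i \<alpha> x * (\<phi> x $ i)))" for i \<alpha>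
      using tf(2) unfolding set_integrable_def scaleR_minus_right by (rule Bochner_Integration.integrable_minus)
    then show ?thesis
      by (subst set_integral_sum_real; (intro set_integral_sum_real)?) (auto intro!: sum.cong simp: set_integral_sum_real)
  qed
  also have "\<dots> = ?I (\<lambda>x. F x \<bullet> \<phi> x)"
  proof -
    have *: "(\<Sum>i\<in>UNIV. \<Sum>\<alpha>\<in>UNIV. - (dV i \<alpha> x * (\<phi> x $ i))) = F x \<bullet> \<phi> x" if "x \<in> ?B - {0}" for x
      using F[OF that] by (simp add: inner_vec_def sum_negf sum_distrib_right)
    note [measurable] = F_meas
    have [measurable]: "dV i \<alpha> \<in> borel_measurable borel" for i \<alpha>
      by (rule punctured_admD(2)[OF adm])
    have \<phi>i [measurable]: "(\<lambda>x. \<phi> x $ i) \<in> borel_measurable borel" for i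
      using test_function_component(2)[OF \<phi> L] .
    have [measurable]: "\<phi> \<in> borel_measurable borel" using \<phi>i by (rule borel_measurable_vecI)
    have 1: "(\<lambda>x. indicator ?B x *\<^sub>R (\<Sum>i\<in>UNIV. \<Sum>\<alpha>\<in>UNIV. - (dV i \<alpha> x * (\<phi> x $ i)))) \<in> borel_measurable borel"
      by (intro borel_measurable_scaleR borel_measurable_indicator) simp_all
    have 2: "(\<lambda>x. indicator ?B x *\<^sub>R (F x \<bullet> \<phi> x)) \<in> borel_measurable borel"
      by (intro borel_measurable_scaleR borel_measurable_indicator) simp_all
    show ?thesis unfolding set_lebesgue_integral_def
    proof (rule integral_cong_AE)
      show "AE x in lebesgue. indicator ?B x *\<^sub>R (\<Sum>i\<in>UNIV. \<Sum>\<alpha>\<in>UNIV. - (dV i \<alpha> x * (\<phi> x $ i)))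
          = indicator ?B x *\<^sub>R (F x \<bullet> \<phi> x)"
        using AE_lebesgue_neq_0 by eventually_elim (use * in \<open>auto simp: indicator_def\<close>)
    qed (use 1 2 in \<open>simp_all add: measurable_completion\<close>)
  qed
  finally show "?I (\<lambda>x. V x \<bullet> jacobian \<phi> (at x)) = ?I (\<lambda>x. F x \<bullet> \<phi> x)" .
qed

section \<open>The profile functions\<close>

text \<open>The partial derivative of A(t) / r^j in direction \<alpha>, where A' is the derivative
  of A. This formula and the next two keep the shape in which the product rule produces them, so
  that the admissibility lemmas match.\<close>

definition radial_deriv :: "(real \<Rightarrow> real) \<Rightarrow> (real \<Rightarrow> real) \<Rightarrow> nat \<Rightarrow> real \<Rightarrow> 'n \<Rightarrow> real^'n \<Rightarrow> real" where
  "radial_deriv A A' j T \<alpha> x =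
     (- A' (T - ln (norm x)) - real j * A (T - ln (norm x))) * x $ \<alpha> / norm x ^ (j + 2)"

text \<open>The \<alpha>-th summand in the divergence of the radial field A(t) r^(-j)
  \<omega>.\<close>

definition radial_field_deriv :: "(real \<Rightarrow> real) \<Rightarrow> (real \<Rightarrow> real) \<Rightarrow> nat \<Rightarrow> real \<Rightarrow> 'n \<Rightarrow> real^'n \<Rightarrow> real" where
  "radial_field_deriv A A' j T \<alpha> x = radial_deriv A A' j T \<alpha> x * (x $ \<alpha> / norm x)
     + A (T - ln (norm x)) / norm x ^ j * ((1 - x $ \<alpha> * x $ \<alpha> / (norm x)\<^sup>2) / norm x)"

text \<open>The \<alpha>-th summand in the divergence of row b of the rotation-equivariant matrix
  field r^(-j) (A(t) \<omega> \<otimes> \<omega> + B(t) I), I being the identity matrix.\<close>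

definition equivariant_field_deriv ::
  "(real \<Rightarrow> real) \<Rightarrow> (real \<Rightarrow> real) \<Rightarrow> (real \<Rightarrow> real) \<Rightarrow> (real \<Rightarrow> real) \<Rightarrow> nat \<Rightarrow> real \<Rightarrow> 'n \<Rightarrow> 'n \<Rightarrow> real^'n \<Rightarrow> real" where
  "equivariant_field_deriv A A' B B' j T b \<alpha> x =
     (radial_deriv A A' j T \<alpha> x * (x $ b / norm x)
       + A (T - ln (norm x)) / norm x ^ j * (((if b = \<alpha> then 1 else 0) - x $ b * x $ \<alpha> / (norm x)\<^sup>2) / norm x))
       * (x $ \<alpha> / norm x)
     + A (T - ln (norm x)) / norm x ^ j * (x $ b / norm x) * ((1 - x $ \<alpha> * x $ \<alpha> / (norm x)\<^sup>2) / norm x)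
     + (if b = \<alpha> then 1 else 0) * radial_deriv B B' j T \<alpha> x"

lemma punctured_adm_radial_field:
  fixes \<alpha> :: "'n::finite"
  assumes "log_symbol \<sigma> A A'" "T \<ge> 1" "\<tau> \<le> \<sigma>" "CARD('n) = j + 1"
  shows "punctured_adm T \<tau> \<alpha> (\<lambda>x. A (T - ln (norm x)) / norm x ^ j * (x $ \<alpha> / norm x))
    (radial_field_deriv A A' j T \<alpha>)"
  using punctured_adm_direction[OF punctured_adm_radial_top[OF assms], of \<alpha> \<alpha>]
  by (simp add: radial_field_deriv_def[abs_def] radial_deriv_def)

lemma punctured_adm_equivariant_field:
  fixes \<alpha> :: "'n::finite"
  assumes A: "log_symbol \<sigma> A A'" and B: "log_symbol \<sigma> B B'" and T: "T \<ge> 1" "\<tau> \<le> \<sigma>" "CARD('n) = j + 1"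
  shows "punctured_adm T \<tau> \<alpha>
    (\<lambda>x. A (T - ln (norm x)) / norm x ^ j * (x $ b / norm x) * (x $ \<alpha> / norm x)
       + (if b = \<alpha> then 1 else 0) * (B (T - ln (norm x)) / norm x ^ j))
    (equivariant_field_deriv A A' B B' j T b \<alpha>)"
  using punctured_adm_add[OF
      punctured_adm_direction[OF punctured_adm_direction[OF punctured_adm_radial_top[OF A T], of \<alpha> b], of \<alpha>]
      punctured_adm_cmult[OF punctured_adm_radial_top[OF B T], of \<alpha> "if b = \<alpha> then 1 else 0"]]
  by (simp only: equivariant_field_deriv_def[abs_def] radial_deriv_def if_True refl)

lemma sum_direction_squares:
  fixes x :: "real^'n"
  assumes "x \<noteq> 0"
  shows "(\<Sum>\<alpha>\<in>UNIV. (x $ \<alpha> / norm x)\<^sup>2) = 1"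
proof -
  have "(\<Sum>\<alpha>\<in>UNIV. (x $ \<alpha> / norm x)\<^sup>2) = (\<Sum>\<alpha>\<in>UNIV. (x $ \<alpha>)\<^sup>2) / (norm x)\<^sup>2"
    by (simp add: power_divide sum_divide_distrib)
  also have "(\<Sum>\<alpha>\<in>UNIV. (x $ \<alpha>)\<^sup>2) = (norm x)\<^sup>2"
    unfolding power2_norm_eq_inner inner_vec_def by (simp add: power2_eq_square)
  finally show ?thesis using assms by simp
qed

text \<open>For j = n - 1 the field r^(-j) \<omega> is divergence free, so only the derivative of A
  along the radius contributes, with dt/dr = -1/r.\<close>

lemma divergence_radial_field:
  fixes x :: "real^'n"
  assumes x: "x \<noteq> 0" and n: "CARD('n) = j + 1"
  shows "(\<Sum>\<alpha>\<in>UNIV. radial_field_deriv A A' j T \<alpha> x) = - A' (T - ln (norm x)) / norm x ^ (j + 1)"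
proof -
  define r t where "r = norm x" and "t = T - ln r"
  define w where "w \<alpha> = x $ \<alpha> / r" for \<alpha>
  have r: "r \<noteq> 0" using x by (simp add: r_def)
  have W: "(\<Sum>\<alpha>\<in>UNIV. (w \<alpha>)\<^sup>2) = 1" unfolding w_def r_def by (rule sum_direction_squares[OF x])
  have xw: "x $ \<alpha> = r * w \<alpha>" for \<alpha> using r by (simp add: w_def)
  have "radial_field_deriv A A' j T \<alpha> x = A t / r ^ (j + 1) + (- A' t - (real j + 1) * A t) / r ^ (j + 1) * (w \<alpha>)\<^sup>2" for \<alpha>
    unfolding radial_field_deriv_def radial_deriv_def r_def[symmetric] t_def[symmetric] xw
    using r by (simp add: field_simps power2_eq_square)
  then have "(\<Sum>\<alpha>\<in>UNIV. radial_field_deriv A A' j T \<alpha> x)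
      = real CARD('n) * (A t / r ^ (j + 1)) + (- A' t - (real j + 1) * A t) / r ^ (j + 1) * (\<Sum>\<alpha>\<in>UNIV. (w \<alpha>)\<^sup>2)"
    by (simp add: sum.distrib sum_distrib_left)
  also have "\<dots> = - A' t / r ^ (j + 1)"
    unfolding W n using r by (simp add: field_simps)
  finally show ?thesis by (simp add: r_def t_def)
qed

text \<open>The A-part is a radial field times \<omega>_b, which is constant along rays, so it
  behaves as in \<open>divergence_radial_field\<close>. The B-part is B(t) r^(-j) times a fixed
  coordinate vector, and its divergence is a single partial derivative; this is where the term with
  factor j arises.\<close>

lemma divergence_equivariant_field:
  fixes x :: "real^'n"
  assumes x: "x \<noteq> 0" and n: "CARD('n) = j + 1"
  shows "(\<Sum>\<alpha>\<in>UNIV. equivariant_field_deriv A A' B B' j T b \<alpha> x) =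
    (- A' (T - ln (norm x)) - B' (T - ln (norm x)) - real j * B (T - ln (norm x))) * (x $ b / norm x) / norm x ^ (j + 1)"
proof -
  define r t where "r = norm x" and "t = T - ln r"
  define w where "w \<alpha> = x $ \<alpha> / r" for \<alpha>
  have r: "r \<noteq> 0" using x by (simp add: r_def)
  have W: "(\<Sum>\<alpha>\<in>UNIV. (w \<alpha>)\<^sup>2) = 1" unfolding w_def r_def by (rule sum_direction_squares[OF x])
  have xw: "x $ \<alpha> = r * w \<alpha>" for \<alpha> using r by (simp add: w_def)
  define p q s u where "p = A t / r ^ (j + 1)" and "q = (- A' t - real j * A t) / r ^ (j + 1)"
    and "s = (- B' t - real j * B t) / r ^ (j + 1)" and "u = q - 2 * p"
  have "equivariant_field_deriv A A' B B' j T b \<alpha> x =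
      (q * w b * (w \<alpha>)\<^sup>2 + p * ((if b = \<alpha> then w \<alpha> else 0) - w b * (w \<alpha>)\<^sup>2) + p * w b * (1 - (w \<alpha>)\<^sup>2))
        + (if b = \<alpha> then s * w \<alpha> else 0)" for \<alpha>
    unfolding equivariant_field_deriv_def radial_deriv_def r_def[symmetric] t_def[symmetric] xw p_def q_def s_def
    using r by (simp add: field_simps power2_eq_square)
  also have "\<dots> \<alpha> = u * w b * (w \<alpha>)\<^sup>2 + p * w b + (if b = \<alpha> then (p + s) * w b else 0)" for \<alpha>
    by (auto simp: u_def algebra_simps)
  finally have "(\<Sum>\<alpha>\<in>UNIV. equivariant_field_deriv A A' B B' j T b \<alpha> x)
      = u * w b * (\<Sum>\<alpha>\<in>UNIV. (w \<alpha>)\<^sup>2) + real CARD('n) * (p * w b) + (p + s) * w b"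
    by (simp add: sum.distrib sum_distrib_left)
  also have "\<dots> = (q + real j * p + s) * w b"
    unfolding W n by (simp add: u_def algebra_simps)
  also have "\<dots> = (- A' t - B' t - real j * B t) * w b / r ^ (j + 1)"
    using r by (simp add: p_def q_def s_def field_simps)
  finally show ?thesis by (simp add: w_def r_def t_def)
qed

lemma sum_UNIV_2_plus:
  fixes g :: "2 + 'n::finite \<Rightarrow> 'b::comm_monoid_add"
  shows "(\<Sum>i\<in>UNIV. g i) = g (Inl 1) + g (Inl 2) + (\<Sum>b\<in>UNIV. g (Inr b))"
proof -
  have "(\<Sum>i\<in>UNIV. g i) = (\<Sum>k\<in>UNIV. g (Inl k)) + (\<Sum>b\<in>UNIV. g (Inr b))"
    unfolding UNIV_Plus_UNIV[symmetric] by (subst sum.Plus) auto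
  then show ?thesis by (simp add: sum_2)
qed

section \<open>The concrete profiles and their orders of decay\<close>

locale spiral_profile =
  fixes \<beta> :: real and m :: nat
  assumes beta: "1 / 2 < \<beta>" "\<beta> < 1" and m: "1 \<le> m"
begin

text \<open>Here \<open>m\<close> is \<open>n - 2\<close>. On \<open>t > 0\<close>, \<open>a\<^sub>1\<close> and \<open>a\<^sub>2\<close> are the derivatives of the phase, \<open>f\<^sub>1\<close> and \<open>f\<^sub>2\<close> those of \<open>f\<^sub>0\<close>, and
  \<open>\<kappa>\<close> is the logarithmic derivative of \<open>N\<close>.\<close>

definition phase :: "real \<Rightarrow> real" where "phase t = t powr (1 - \<beta>)"
definition a\<^sub>1 :: "real \<Rightarrow> real" where "a\<^sub>1 t = (1 - \<beta>) * t powr (- \<beta>)"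
definition a\<^sub>2 :: "real \<Rightarrow> real" where "a\<^sub>2 t = - \<beta> * a\<^sub>1 t / t"
definition f\<^sub>0 :: "real \<Rightarrow> real" where "f\<^sub>0 t = t powr (- (\<beta> + 1 / 2))"
definition f\<^sub>1 :: "real \<Rightarrow> real" where "f\<^sub>1 t = - (\<beta> + 1 / 2) * f\<^sub>0 t / t"
definition f\<^sub>2 :: "real \<Rightarrow> real" where "f\<^sub>2 t = - (\<beta> + 3 / 2) * f\<^sub>1 t / t"
definition Q :: "real \<Rightarrow> real" where "Q t = (a\<^sub>1 t)\<^sup>2 + (f\<^sub>1 t)\<^sup>2 + (real m + 1) * (f\<^sub>0 t)\<^sup>2"
definition N :: "real \<Rightarrow> real" where "N t = sqrt (Q t) ^ m"
definition \<kappa> :: "real \<Rightarrow> real" where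
  "\<kappa> t = - (real m / t) * (\<beta> * (a\<^sub>1 t)\<^sup>2 + (\<beta> + 3 / 2) * (f\<^sub>1 t)\<^sup>2 + (real m + 1) * (\<beta> + 1 / 2) * (f\<^sub>0 t)\<^sup>2) / Q t"

definition circ :: "2 \<Rightarrow> real \<Rightarrow> real" where
  "circ k t = (if k = 1 then cos (phase t) else sin (phase t))"
definition circ_rot :: "2 \<Rightarrow> real \<Rightarrow> real" where
  "circ_rot k t = (if k = 1 then - sin (phase t) else cos (phase t))"

lemma measurable_profiles [measurable]:
  "phase \<in> borel_measurable borel" "a\<^sub>1 \<in> borel_measurable borel" "a\<^sub>2 \<in> borel_measurable borel"
  "f\<^sub>0 \<in> borel_measurable borel" "f\<^sub>1 \<in> borel_measurable borel" "f\<^sub>2 \<in> borel_measurable borel"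
  "Q \<in> borel_measurable borel" "N \<in> borel_measurable borel" "\<kappa> \<in> borel_measurable borel"
proof -
  show [measurable]: "phase \<in> borel_measurable borel" unfolding phase_def[abs_def] by measurable
  show [measurable]: "a\<^sub>1 \<in> borel_measurable borel" unfolding a\<^sub>1_def[abs_def] by measurable
  show "a\<^sub>2 \<in> borel_measurable borel" unfolding a\<^sub>2_def[abs_def] by measurable
  show [measurable]: "f\<^sub>0 \<in> borel_measurable borel" unfolding f\<^sub>0_def[abs_def] by measurable
  show [measurable]: "f\<^sub>1 \<in> borel_measurable borel" unfolding f\<^sub>1_def[abs_def] by measurable
  show "f\<^sub>2 \<in> borel_measurable borel" unfolding f\<^sub>2_def[abs_def] by measurable
  show [measurable]: "Q \<in> borel_measurable borel" unfolding Q_def[abs_def] by measurable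
  show "N \<in> borel_measurable borel" unfolding N_def[abs_def] by measurable
  show "\<kappa> \<in> borel_measurable borel" unfolding \<kappa>_def[abs_def] by measurable
qed

lemma measurable_circ [measurable]:
  "circ k \<in> borel_measurable borel" "circ_rot k \<in> borel_measurable borel"
  unfolding circ_def[abs_def] circ_rot_def[abs_def] by measurable

lemma a\<^sub>1_pos: "t > 0 \<Longrightarrow> a\<^sub>1 t > 0" using beta by (simp add: a\<^sub>1_def)
lemma f\<^sub>0_pos: "t > 0 \<Longrightarrow> f\<^sub>0 t > 0" by (simp add: f\<^sub>0_def)
lemma Q_pos: "t > 0 \<Longrightarrow> Q t > 0"
  unfolding Q_def by (intro add_pos_nonneg) (use a\<^sub>1_pos[of t] in auto)

lemma a\<^sub>1_symbol: "log_symbol \<beta> a\<^sub>1 a\<^sub>2"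
proof -
  have "a\<^sub>1 = (\<lambda>t. (1 - \<beta>) * t powr (- \<beta>))" "a\<^sub>2 = (\<lambda>t. (1 - \<beta>) * (- \<beta> * t powr (- \<beta>) / t))"
    by (auto simp: a\<^sub>1_def a\<^sub>2_def)
  then show ?thesis using log_symbol_cmult[OF log_symbol_powr[of \<beta>], of "1 - \<beta>"] by simp
qed

lemma f\<^sub>0_symbol: "log_symbol (\<beta> + 1 / 2) f\<^sub>0 f\<^sub>1"
proof -
  have "f\<^sub>0 = (\<lambda>t. t powr (- (\<beta> + 1 / 2)))" "f\<^sub>1 = (\<lambda>t. - (\<beta> + 1 / 2) * t powr (- (\<beta> + 1 / 2)) / t)"
    by (auto simp: f\<^sub>0_def f\<^sub>1_def)
  then show ?thesis using log_symbol_powr[of "\<beta> + 1 / 2"] by simp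
qed

lemma abs_f\<^sub>1_le: "t \<ge> 1 \<Longrightarrow> \<bar>f\<^sub>1 t\<bar> \<le> 3 / 2 * f\<^sub>0 t"
proof -
  assume t: "t \<ge> 1"
  have "\<bar>f\<^sub>1 t\<bar> = (\<beta> + 1 / 2) * f\<^sub>0 t / t"
    using beta t f\<^sub>0_pos[of t] by (simp add: f\<^sub>1_def abs_mult)
  also have "\<dots> \<le> (\<beta> + 1 / 2) * f\<^sub>0 t / 1"
    using beta t f\<^sub>0_pos[of t] by (intro divide_left_mono) auto
  also have "\<dots> \<le> 3 / 2 * f\<^sub>0 t" using beta t f\<^sub>0_pos[of t] by simp
  finally show ?thesis .
qed

lemma abs_f\<^sub>2_le: "t \<ge> 1 \<Longrightarrow> \<bar>f\<^sub>2 t\<bar> \<le> 5 * f\<^sub>0 t"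
proof -
  assume t: "t \<ge> 1"
  have "\<bar>f\<^sub>2 t\<bar> = (\<beta> + 3 / 2) * \<bar>f\<^sub>1 t\<bar> / t"
    using beta t by (simp add: f\<^sub>2_def abs_mult)
  also have "\<dots> \<le> (\<beta> + 3 / 2) * \<bar>f\<^sub>1 t\<bar> / 1"
    using beta t by (intro divide_left_mono) auto
  \<comment> \<open>\<beta> + 3/2 is below 5/2, and the resulting 15/4 is rounded up to 5.\<close>
  also have "\<dots> \<le> 5 / 2 * (3 / 2 * f\<^sub>0 t)"
    unfolding div_by_1 using beta abs_f\<^sub>1_le[OF t] by (intro mult_mono) auto
  also have "\<dots> \<le> 5 * f\<^sub>0 t" using f\<^sub>0_pos[of t] t by simp
  finally show ?thesis .
qed

lemma f\<^sub>1_symbol: "log_symbol (\<beta> + 1 / 2) f\<^sub>1 f\<^sub>2"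
proof (rule log_symbolI[of _ _ "3/2" _ 5])
  fix t :: real assume t: "t \<ge> 1"
  have df: "(f\<^sub>0 has_real_derivative f\<^sub>1 t) (at t)" using f\<^sub>0_symbol t by (simp add: log_symbol_def)
  have "((\<lambda>t. - (\<beta> + 1 / 2) * f\<^sub>0 t / t) has_real_derivative
      (- (\<beta> + 1 / 2) * f\<^sub>1 t * t - - (\<beta> + 1 / 2) * f\<^sub>0 t * 1) / (t * t)) (at t)"
    by (intro DERIV_divide DERIV_cmult df DERIV_ident) (use t in auto)
  moreover have "(- (\<beta> + 1 / 2) * f\<^sub>1 t * t - - (\<beta> + 1 / 2) * f\<^sub>0 t * 1) / (t * t) = f\<^sub>2 t"
    using t by (simp add: f\<^sub>1_def f\<^sub>2_def field_simps)
  ultimately show "(f\<^sub>1 has_real_derivative f\<^sub>2 t) (at t)"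
    by (simp add: f\<^sub>1_def[abs_def])
  show "\<bar>f\<^sub>1 t\<bar> \<le> 3 / 2 * t powr - (\<beta> + 1 / 2)" "\<bar>f\<^sub>2 t\<bar> \<le> 5 * t powr - (\<beta> + 1 / 2)"
    using abs_f\<^sub>1_le[OF t] abs_f\<^sub>2_le[OF t] by (simp_all add: f\<^sub>0_def)
qed auto

lemma a\<^sub>1_le: "t \<ge> 1 \<Longrightarrow> a\<^sub>1 t \<le> t powr (- \<beta>)"
  using beta by (simp add: a\<^sub>1_def mult_left_le_one_le)

lemma a\<^sub>1_le_1: "t \<ge> 1 \<Longrightarrow> a\<^sub>1 t \<le> 1"
proof -
  assume t: "t \<ge> 1"
  have "t powr (- \<beta>) \<le> t powr 0" using t beta by (intro powr_mono) auto
  then show ?thesis using a\<^sub>1_le[OF t] t by simp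
qed

lemma f\<^sub>0_le: "t \<ge> 1 \<Longrightarrow> f\<^sub>0 t \<le> t powr (- \<beta>)"
  unfolding f\<^sub>0_def by (intro powr_mono) auto

lemma phase_deriv: "t \<ge> 1 \<Longrightarrow> (phase has_real_derivative a\<^sub>1 t) (at t)"
  unfolding phase_def[abs_def] a\<^sub>1_def by (auto intro!: derivative_eq_intros)

lemma circ_symbol: "log_symbol 0 (circ k) (\<lambda>t. a\<^sub>1 t * circ_rot k t)"
proof (rule log_symbolI[of _ _ 1 _ 1])
  fix t :: real assume t: "t \<ge> 1"
  show "(circ k has_real_derivative a\<^sub>1 t * circ_rot k t) (at t)"
    using phase_deriv[OF t] unfolding circ_def[abs_def] circ_rot_def
    by (cases "k = 1") (auto intro!: derivative_eq_intros)
  show "\<bar>circ k t\<bar> \<le> 1 * t powr - 0" using t by (simp add: circ_def)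
  have "\<bar>a\<^sub>1 t\<bar> * \<bar>circ_rot k t\<bar> \<le> 1 * 1"
    using a\<^sub>1_le_1[OF t] a\<^sub>1_pos[of t] t by (intro mult_mono) (auto simp: circ_rot_def)
  then show "\<bar>a\<^sub>1 t * circ_rot k t\<bar> \<le> 1 * t powr - 0" using t by (simp add: abs_mult)
qed measurable

lemma circ_rot_symbol: "log_symbol 0 (circ_rot k) (\<lambda>t. - (a\<^sub>1 t * circ k t))"
proof (rule log_symbolI[of _ _ 1 _ 1])
  fix t :: real assume t: "t \<ge> 1"
  show "(circ_rot k has_real_derivative - (a\<^sub>1 t * circ k t)) (at t)"
    using phase_deriv[OF t] unfolding circ_rot_def[abs_def] circ_def
    by (cases "k = 1") (auto intro!: derivative_eq_intros)
  show "\<bar>circ_rot k t\<bar> \<le> 1 * t powr - 0" using t by (simp add: circ_rot_def)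
  have "\<bar>a\<^sub>1 t\<bar> * \<bar>circ k t\<bar> \<le> 1 * 1"
    using a\<^sub>1_le_1[OF t] a\<^sub>1_pos[of t] t by (intro mult_mono) (auto simp: circ_def)
  then show "\<bar>- (a\<^sub>1 t * circ k t)\<bar> \<le> 1 * t powr - 0" using t by (simp add: abs_mult)
qed measurable

text \<open>All three profiles are bounded by multiples of t^(-\<beta>), with factors 1, 3/2 and 1,
  and (m + 4)^2 absorbs 1 + 9/4 + (m + 1).\<close>

lemma Q_le: "t \<ge> 1 \<Longrightarrow> sqrt (Q t) \<le> (real m + 4) * t powr (- \<beta>)"
proof -
  assume t: "t \<ge> 1"
  define z where "z = t powr (- \<beta>)"
  have z: "z \<ge> 0" by (simp add: z_def)
  have f0: "f\<^sub>0 t \<le> z" "0 \<le> f\<^sub>0 t" using f\<^sub>0_le[OF t] f\<^sub>0_pos[of t] t by (auto simp: z_def)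
  have "(a\<^sub>1 t)\<^sup>2 \<le> z\<^sup>2" using a\<^sub>1_le[OF t] a\<^sub>1_pos[of t] t by (intro power_mono) (auto simp: z_def)
  moreover have "\<bar>f\<^sub>1 t\<bar>\<^sup>2 \<le> (3 / 2 * z)\<^sup>2"
    using abs_f\<^sub>1_le[OF t] f0 by (intro power_mono) auto
  moreover have "(real m + 1) * (f\<^sub>0 t)\<^sup>2 \<le> (real m + 1) * z\<^sup>2"
    using f0 by (intro mult_left_mono power_mono) auto
  ultimately have "Q t \<le> z\<^sup>2 + (3 / 2 * z)\<^sup>2 + (real m + 1) * z\<^sup>2"
    unfolding Q_def power2_abs by linarith
  also have "\<dots> \<le> ((real m + 4) * z)\<^sup>2"
    using z by (simp add: power2_eq_square algebra_simps)
  finally show ?thesis using z by (simp add: z_def real_le_lsqrt)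
qed

text \<open>The three squares in \<open>Q\<close> are multiples of powers of t with exponents -2
  \<beta>, -2 (\<beta> + 3/2) and -2 (\<beta> + 1/2). Differentiation multiplies each by its
  exponent over t, which is the weighted sum in the definition of \<kappa>.\<close>

lemma Q_deriv: "t \<ge> 1 \<Longrightarrow> (Q has_real_derivative 2 * \<kappa> t / real m * Q t) (at t)"
proof -
  assume t: "t \<ge> 1"
  have d: "(a\<^sub>1 has_real_derivative a\<^sub>2 t) (at t)" "(f\<^sub>0 has_real_derivative f\<^sub>1 t) (at t)"
    "(f\<^sub>1 has_real_derivative f\<^sub>2 t) (at t)"
    using a\<^sub>1_symbol f\<^sub>0_symbol f\<^sub>1_symbol t by (auto simp: log_symbol_def)
  have "(Q has_real_derivative 2 * a\<^sub>1 t * a\<^sub>2 t + 2 * f\<^sub>1 t * f\<^sub>2 t + (real m + 1) * (2 * f\<^sub>0 t * f\<^sub>1 t)) (at t)"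
    unfolding Q_def[abs_def] by (auto intro!: derivative_eq_intros d)
  moreover have "2 * a\<^sub>1 t * a\<^sub>2 t + 2 * f\<^sub>1 t * f\<^sub>2 t + (real m + 1) * (2 * f\<^sub>0 t * f\<^sub>1 t) =
     - (2 / t) * (\<beta> * (a\<^sub>1 t)\<^sup>2 + (\<beta> + 3 / 2) * (f\<^sub>1 t)\<^sup>2 + (real m + 1) * (\<beta> + 1 / 2) * (f\<^sub>0 t)\<^sup>2)"
  proof -
    have e: "a\<^sub>1 t * a\<^sub>2 t = - (1 / t) * (\<beta> * (a\<^sub>1 t)\<^sup>2)"
      "f\<^sub>1 t * f\<^sub>2 t = - (1 / t) * ((\<beta> + 3 / 2) * (f\<^sub>1 t)\<^sup>2)"
      "f\<^sub>0 t * f\<^sub>1 t = - (1 / t) * ((\<beta> + 1 / 2) * (f\<^sub>0 t)\<^sup>2)"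
      using t by (simp_all add: a\<^sub>2_def f\<^sub>2_def, simp_all add: f\<^sub>1_def power2_eq_square field_simps)
    have "2 * a\<^sub>1 t * a\<^sub>2 t + 2 * f\<^sub>1 t * f\<^sub>2 t + (real m + 1) * (2 * f\<^sub>0 t * f\<^sub>1 t) =
        2 * (a\<^sub>1 t * a\<^sub>2 t) + 2 * (f\<^sub>1 t * f\<^sub>2 t) + 2 * (real m + 1) * (f\<^sub>0 t * f\<^sub>1 t)"
      by (simp add: algebra_simps)
    also have "\<dots> = - (2 / t) * (\<beta> * (a\<^sub>1 t)\<^sup>2 + (\<beta> + 3 / 2) * (f\<^sub>1 t)\<^sup>2 + (real m + 1) * (\<beta> + 1 / 2) * (f\<^sub>0 t)\<^sup>2)"
      unfolding e using t by (simp add: field_simps)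
    finally show ?thesis .
  qed
  moreover have "\<dots> = 2 * \<kappa> t / real m * Q t"
    using Q_pos[of t] t m by (simp add: \<kappa>_def)
  ultimately show ?thesis by simp
qed

text \<open>Up to the factor -m / t, \<kappa> is a weighted mean of \<beta>, \<beta> + 3/2 and
  \<beta> + 1/2 with the summands of \<open>Q\<close> as weights, and each of the three is below
  5/2.\<close>

lemma abs_\<kappa>_le: "t \<ge> 1 \<Longrightarrow> \<bar>\<kappa> t\<bar> \<le> 5 / 2 * real m / t"
proof -
  assume t: "t \<ge> 1"
  define S where "S = \<beta> * (a\<^sub>1 t)\<^sup>2 + (\<beta> + 3 / 2) * (f\<^sub>1 t)\<^sup>2 + (real m + 1) * (\<beta> + 1 / 2) * (f\<^sub>0 t)\<^sup>2"
  have S0: "S \<ge> 0" using beta by (auto simp: S_def intro!: add_nonneg_nonneg mult_nonneg_nonneg)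
  have "S \<le> 5 / 2 * (a\<^sub>1 t)\<^sup>2 + 5 / 2 * (f\<^sub>1 t)\<^sup>2 + (real m + 1) * (5 / 2) * (f\<^sub>0 t)\<^sup>2"
    unfolding S_def using beta by (intro add_mono mult_right_mono mult_left_mono) auto
  also have "\<dots> = 5 / 2 * Q t" by (simp add: Q_def algebra_simps)
  finally have S: "S \<le> 5 / 2 * Q t" .
  have "\<bar>\<kappa> t\<bar> = real m / t * S / Q t"
    using S0 Q_pos[of t] t by (simp add: \<kappa>_def S_def[symmetric] abs_mult)
  also have "\<dots> \<le> real m / t * (5 / 2 * Q t) / Q t"
    using S S0 Q_pos[of t] t by (intro divide_right_mono mult_left_mono) auto
  also have "\<dots> = 5 / 2 * real m / t" using Q_pos[of t] t by simp
  finally show ?thesis .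
qed

lemma abs_\<kappa>_le_const: "t \<ge> 1 \<Longrightarrow> \<bar>\<kappa> t\<bar> \<le> 5 / 2 * real m"
  using abs_\<kappa>_le[of t] divide_left_mono[of 1 t "5 / 2 * real m"] by simp

text \<open>The order of sqrt Q is \<beta>, and N is its m-th power. Since \<kappa> is bounded, the
  derivative \<kappa> N has the same order.\<close>

lemma N_symbol: "log_symbol (\<beta> * real m) N (\<lambda>t. \<kappa> t * N t)"
proof (rule log_symbolI[of _ _ "(real m + 4) ^ m" _ "5 / 2 * real m * (real m + 4) ^ m"])
  fix t :: real assume t: "t \<ge> 1"
  have Q: "Q t > 0" using Q_pos[of t] t by simp
  have "((\<lambda>t. sqrt (Q t)) has_real_derivative inverse (sqrt (Q t)) / 2 * (2 * \<kappa> t / real m * Q t)) (at t)"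
    by (rule DERIV_chain2[OF DERIV_real_sqrt[OF Q] Q_deriv[OF t]])
  then have "(N has_real_derivative real m * (inverse (sqrt (Q t)) / 2 * (2 * \<kappa> t / real m * Q t) * sqrt (Q t) ^ (m - 1))) (at t)"
    unfolding N_def[abs_def] by (rule DERIV_cong[OF DERIV_power]) simp
  moreover have "real m * (inverse (sqrt (Q t)) / 2 * (2 * \<kappa> t / real m * Q t) * sqrt (Q t) ^ (m - 1)) = \<kappa> t * N t"
  proof -
    have "Q t = sqrt (Q t) * sqrt (Q t)" using Q by simp
    then have "inverse (sqrt (Q t)) * Q t = sqrt (Q t)" using Q by (metis inverse_eq_divide less_irrefl nonzero_divide_eq_eq real_sqrt_gt_zero mult.commute mult.left_commute mult_1)
    moreover have "real m * (inverse (sqrt (Q t)) / 2 * (2 * \<kappa> t / real m * Q t) * sqrt (Q t) ^ (m - 1))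
        = \<kappa> t * (inverse (sqrt (Q t)) * Q t) * sqrt (Q t) ^ (m - 1)"
      using m by simp
    moreover have "sqrt (Q t) * sqrt (Q t) ^ (m - 1) = sqrt (Q t) ^ m"
      using power_minus_mult[of m "sqrt (Q t)"] m by (simp add: mult.commute)
    ultimately show ?thesis by (simp add: N_def)
  qed
  ultimately show "(N has_real_derivative \<kappa> t * N t) (at t)" by simp
  have "N t \<le> ((real m + 4) * t powr (- \<beta>)) ^ m"
    unfolding N_def using Q_le[OF t] Q by (intro power_mono) auto
  also have "\<dots> = (real m + 4) ^ m * t powr (- (\<beta> * real m))"
    using t by (simp add: power_mult_distrib powr_power mult.commute)
  finally have Nle: "N t \<le> (real m + 4) ^ m * t powr (- (\<beta> * real m))" .
  have N0: "N t \<ge> 0" using Q by (simp add: N_def)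
  show "\<bar>N t\<bar> \<le> (real m + 4) ^ m * t powr (- (\<beta> * real m))" using Nle N0 by simp
  have "\<bar>\<kappa> t\<bar> * \<bar>N t\<bar> \<le> 5 / 2 * real m * ((real m + 4) ^ m * t powr (- (\<beta> * real m)))"
    using abs_\<kappa>_le_const[OF t] Nle N0 by (intro mult_mono) auto
  then show "\<bar>\<kappa> t * N t\<bar> \<le> 5 / 2 * real m * (real m + 4) ^ m * t powr (- (\<beta> * real m))"
    by (simp add: abs_mult mult_ac)
qed measurable

section \<open>The gradient and the potential\<close>


text \<open>The solution of the triangular system announced in the overview, with m + 1 = n - 1. The
  \<omega>-component reads -\<gamma> a' = (n - 1) f - f'' - \<kappa> f' and determines \<gamma>; the
  \<theta>-component reads \<gamma> f' + (n - 1) f \<delta> = -(a'' + \<kappa> a') and then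
  determines \<delta>.\<close>

definition \<gamma> :: "real \<Rightarrow> real" where
  "\<gamma> t = - ((real m + 1) * f\<^sub>0 t - f\<^sub>2 t - \<kappa> t * f\<^sub>1 t) / a\<^sub>1 t"
definition \<delta> :: "real \<Rightarrow> real" where
  "\<delta> t = - (a\<^sub>2 t + \<kappa> t * a\<^sub>1 t + \<gamma> t * f\<^sub>1 t) / ((real m + 1) * f\<^sub>0 t)"

lemma measurable_coefficients [measurable]:
  "\<gamma> \<in> borel_measurable borel" "\<delta> \<in> borel_measurable borel"
proof -
  show [measurable]: "\<gamma> \<in> borel_measurable borel" unfolding \<gamma>_def[abs_def] by measurable
  show "\<delta> \<in> borel_measurable borel" unfolding \<delta>_def[abs_def] by measurable
qed

text \<open>With h = t^(-1/2) the profiles satisfy f = h a' / (1 - \<beta>) and a' / t = (1 -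
  \<beta>) h f. The numerator of \<gamma> is of order f and is divided by a'; that of \<delta> is of
  order a' / t + \<gamma> f and is divided by f. Both quotients are of order h. The bound a' <= h
  holds because \<beta> > 1/2.\<close>

lemma coefficients_bounded: "\<exists>C. \<forall>t\<ge>1. a\<^sub>1 t + \<bar>\<gamma> t\<bar> + \<bar>\<delta> t\<bar> \<le> C * t powr (- (1 / 2))"
proof -
  \<comment> \<open>5 m + 6 adds up m + 1 for f, 5 for f'' and 4 m for \<kappa> f', where 4 m rounds
    up 15/4 m. Below, \<open>Cd\<close> collects a'', \<kappa> a' and \<gamma> f' in this
    order.\<close>
  define Cg where "Cg = (5 * real m + 6) / (1 - \<beta>)"
  have Cg: "Cg \<ge> 0" using beta by (simp add: Cg_def)
  define Cd where "Cd = 1 + 5 / 2 * real m + 3 / 2 * Cg"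
  have "a\<^sub>1 t + \<bar>\<gamma> t\<bar> + \<bar>\<delta> t\<bar> \<le> (1 + Cg + Cd) * t powr (- (1 / 2))" if t: "t \<ge> 1" for t
  proof -
    define h where "h = t powr (- (1 / 2))"
    have h: "h > 0" using t by (simp add: h_def)
    have pos: "a\<^sub>1 t > 0" "f\<^sub>0 t > 0" using a\<^sub>1_pos f\<^sub>0_pos t by auto
    have f0_eq: "f\<^sub>0 t = h * a\<^sub>1 t / (1 - \<beta>)"
    proof -
      have "f\<^sub>0 t = h * t powr (- \<beta>)"
        unfolding f\<^sub>0_def h_def powr_add[symmetric] by (simp add: algebra_simps)
      then show ?thesis using beta by (simp add: a\<^sub>1_def)
    qed
    have hh: "h * h * t = 1"
    proof -
      have "h * h = t powr (- 1)" unfolding h_def powr_add[symmetric] by simp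
      then show ?thesis using t by (simp add: powr_minus)
    qed
    \<comment> \<open>Inserting h h t = 1 turns the decay of a' / t relative to f into the same
      factor h as that of f relative to a'.\<close>
    have a1_eq: "a\<^sub>1 t / t = (1 - \<beta>) * h * f\<^sub>0 t"
    proof -
      have "a\<^sub>1 t / t = a\<^sub>1 t * (h * h * t) / t" by (simp add: hh)
      then show ?thesis using t beta by (simp add: f0_eq)
    qed
    have 1: "a\<^sub>1 t \<le> h"
      using a\<^sub>1_le[OF t] powr_mono[of "- \<beta>" "- (1/2)" t] t beta by (simp add: h_def)
    have f1: "\<bar>f\<^sub>1 t\<bar> \<le> 3 / 2 * f\<^sub>0 t" "\<bar>f\<^sub>2 t\<bar> \<le> 5 * f\<^sub>0 t" "\<bar>\<kappa> t\<bar> \<le> 5 / 2 * real m"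
      using abs_f\<^sub>1_le abs_f\<^sub>2_le abs_\<kappa>_le_const t by auto
    have "\<bar>\<kappa> t * f\<^sub>1 t\<bar> \<le> 5 / 2 * real m * (3 / 2 * f\<^sub>0 t)"
      unfolding abs_mult using f1 by (intro mult_mono) auto
    also have "\<dots> \<le> 4 * real m * f\<^sub>0 t" using pos by simp
    finally have "\<bar>(real m + 1) * f\<^sub>0 t - f\<^sub>2 t - \<kappa> t * f\<^sub>1 t\<bar> \<le> (real m + 1) * f\<^sub>0 t + 5 * f\<^sub>0 t + 4 * real m * f\<^sub>0 t"
    proof -
      assume "\<bar>\<kappa> t * f\<^sub>1 t\<bar> \<le> 4 * real m * f\<^sub>0 t"
      moreover have "(real m + 1) * f\<^sub>0 t \<ge> 0" using pos by simp
      ultimately show ?thesis using f1(2) by linarith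
    qed
    also have "\<dots> = (5 * real m + 6) * f\<^sub>0 t" by (simp add: algebra_simps)
    finally have "\<bar>\<gamma> t\<bar> \<le> (5 * real m + 6) * f\<^sub>0 t / a\<^sub>1 t"
      using pos by (simp add: \<gamma>_def divide_right_mono abs_minus_commute)
    also have "\<dots> = Cg * h" using pos by (simp add: f0_eq Cg_def)
    finally have 2: "\<bar>\<gamma> t\<bar> \<le> Cg * h" .
    have "\<bar>a\<^sub>2 t\<bar> \<le> a\<^sub>1 t / t"
    proof -
      have "\<bar>a\<^sub>2 t\<bar> = \<beta> * (a\<^sub>1 t / t)" using pos t beta by (simp add: a\<^sub>2_def abs_mult)
      also have "\<dots> \<le> 1 * (a\<^sub>1 t / t)" using beta pos t by (intro mult_right_mono) auto
      finally show ?thesis by simp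
    qed
    moreover have "\<bar>\<kappa> t * a\<^sub>1 t\<bar> \<le> 5 / 2 * real m * (a\<^sub>1 t / t)"
    proof -
      have "\<bar>\<kappa> t * a\<^sub>1 t\<bar> \<le> 5 / 2 * real m / t * a\<^sub>1 t"
        unfolding abs_mult using abs_\<kappa>_le[OF t] pos by (intro mult_mono) auto
      then show ?thesis by simp
    qed
    moreover have "\<bar>\<gamma> t * f\<^sub>1 t\<bar> \<le> 3 / 2 * Cg * (h * f\<^sub>0 t)"
    proof -
      have "\<bar>\<gamma> t * f\<^sub>1 t\<bar> \<le> (Cg * h) * (3 / 2 * f\<^sub>0 t)"
        unfolding abs_mult using 2 f1 Cg h by (intro mult_mono) auto
      then show ?thesis by simp
    qed
    moreover have "a\<^sub>1 t / t \<le> h * f\<^sub>0 t"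
    proof -
      have "(1 - \<beta>) * (h * f\<^sub>0 t) \<le> 1 * (h * f\<^sub>0 t)" using beta h pos by (intro mult_right_mono) auto
      then show ?thesis by (simp add: a1_eq)
    qed
    moreover then have "5 / 2 * real m * (a\<^sub>1 t / t) \<le> 5 / 2 * real m * (h * f\<^sub>0 t)"
      by (intro mult_left_mono) auto
    ultimately have "\<bar>a\<^sub>2 t + \<kappa> t * a\<^sub>1 t + \<gamma> t * f\<^sub>1 t\<bar>
        \<le> h * f\<^sub>0 t + 5 / 2 * real m * (h * f\<^sub>0 t) + 3 / 2 * Cg * (h * f\<^sub>0 t)" by linarith
    also have "\<dots> = Cd * h * f\<^sub>0 t" by (simp add: Cd_def algebra_simps)
    finally have num: "\<bar>a\<^sub>2 t + \<kappa> t * a\<^sub>1 t + \<gamma> t * f\<^sub>1 t\<bar> \<le> Cd * h * f\<^sub>0 t" .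
    have Cd0: "Cd \<ge> 0" using Cg by (simp add: Cd_def)
    have "\<bar>\<delta> t\<bar> = \<bar>a\<^sub>2 t + \<kappa> t * a\<^sub>1 t + \<gamma> t * f\<^sub>1 t\<bar> / ((real m + 1) * f\<^sub>0 t)"
      unfolding \<delta>_def abs_divide abs_minus_cancel using pos by simp
    also have "\<dots> \<le> (Cd * h * f\<^sub>0 t) / (1 * f\<^sub>0 t)"
      using num pos Cd0 h by (intro frac_le) auto
    finally have 3: "\<bar>\<delta> t\<bar> \<le> Cd * h" using pos by simp
    show ?thesis unfolding h_def[symmetric] distrib_right using 1 2 3 by simp
  qed
  then show ?thesis by blast
qed

text \<open>The entries are written as the product rule of \<open>punctured_adm_direction\<close>
  delivers them; \<open>U_gradient_polar\<close> regroups them. Division by zero makes the whole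
  matrix vanish at the origin.\<close>

definition U_gradient :: "real \<Rightarrow> real^'n \<Rightarrow> real^'n^(2 + 'n)" where
  "U_gradient T x = (\<chi> i \<alpha>. case i of
      Inl k \<Rightarrow> - (a\<^sub>1 (T - ln (norm x)) * circ_rot k (T - ln (norm x))) * x $ \<alpha> / (norm x)\<^sup>2
    | Inr b \<Rightarrow> - f\<^sub>1 (T - ln (norm x)) * x $ \<alpha> / (norm x)\<^sup>2 * (x $ b / norm x)
        + f\<^sub>0 (T - ln (norm x)) * (((if b = \<alpha> then 1 else 0) - x $ b * x $ \<alpha> / (norm x)\<^sup>2) / norm x))"

lemma U_map_nth:
  "U_map \<beta> T x $ Inl k = circ k (T - ln (norm x))"
  "U_map \<beta> T x $ Inr b = f\<^sub>0 (T - ln (norm x)) * (x $ b / norm x)"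
proof -
  have "T + ln (1 / norm x) = T - ln (norm x)" by (cases "x = 0") (auto simp: ln_div)
  then show "U_map \<beta> T x $ Inl k = circ k (T - ln (norm x))"
    "U_map \<beta> T x $ Inr b = f\<^sub>0 (T - ln (norm x)) * (x $ b / norm x)"
    by (simp_all add: U_map_def Let_def circ_def phase_def f\<^sub>0_def)
qed

lemma punctured_adm_U_map:
  fixes \<alpha> :: "'n::finite"
  assumes n: "CARD('n) > 2" and T: "T \<ge> 1"
  shows "punctured_adm T (2 * \<beta>) \<alpha> (\<lambda>x. U_map \<beta> T x $ i) (\<lambda>x. U_gradient T x $ i $ \<alpha>)"
proof (cases i)
  case (Inl k)
  have "punctured_adm T (2 * \<beta>) \<alpha> (\<lambda>x. circ k (T - ln (norm x)))
      (\<lambda>x. - (a\<^sub>1 (T - ln (norm x)) * circ_rot k (T - ln (norm x))) * x $ \<alpha> / (norm x)\<^sup>2)"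
    using beta by (intro punctured_adm_radial_bounded[OF circ_symbol T _ _ n]) auto
  then show ?thesis by (simp add: Inl U_map_nth U_gradient_def)
next
  case (Inr b)
  have "punctured_adm T (2 * \<beta>) \<alpha> (\<lambda>x. f\<^sub>0 (T - ln (norm x))) (\<lambda>x. - f\<^sub>1 (T - ln (norm x)) * x $ \<alpha> / (norm x)\<^sup>2)"
    using beta by (intro punctured_adm_radial_bounded[OF f\<^sub>0_symbol T _ _ n]) auto
  from punctured_adm_direction[OF this, of b] show ?thesis
    by (simp only: Inr U_map_nth U_gradient_def vec_lambda_beta sum.case)
qed

lemma U_gradient_polar:
  fixes x :: "real^'n" and T :: real
  defines "r \<equiv> norm x" and "t \<equiv> T - ln (norm x)" and "w \<equiv> \<lambda>\<alpha>. x $ \<alpha> / norm x"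
  assumes x: "x \<noteq> 0"
  shows "U_gradient T x $ Inl k $ \<alpha> = - (a\<^sub>1 t * circ_rot k t) * w \<alpha> / r"
    and "U_gradient T x $ Inr b $ \<alpha> = (- (f\<^sub>1 t + f\<^sub>0 t) * w b * w \<alpha> + (if b = \<alpha> then f\<^sub>0 t else 0)) / r"
  using x by (simp_all add: U_gradient_def r_def t_def w_def field_simps power2_eq_square)

lemma U_gradient_0: "U_gradient T (0::real^'n) = 0"
proof -
  have "U_gradient T (0::real^'n) $ i $ \<alpha> = 0" for i \<alpha> by (cases i) (simp_all add: U_gradient_def)
  then show ?thesis by (simp add: vec_eq_iff)
qed

lemma circ_squares: "(circ_rot 1 t)\<^sup>2 + (circ_rot 2 t)\<^sup>2 = 1" "circ 1 t * circ_rot 1 t + circ 2 t * circ_rot 2 t = 0"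
  by (simp_all add: circ_def circ_rot_def)

text \<open>The gradient is a sum of mutually orthogonal matrices along \<theta> \<otimes> \<omega>,
  \<omega> \<otimes> \<omega> and the projection onto the complement of \<omega>, whose squared
  norms are 1, 1 and n - 1. At the origin both sides are 0.\<close>

lemma norm_U_gradient:
  fixes x :: "real^'n"
  assumes n: "CARD('n) = m + 2"
  shows "norm (U_gradient T x) = sqrt (Q (T - ln (norm x))) / norm x"
proof (cases "x = 0")
  case False
  define r t where "r = norm x" and "t = T - ln r"
  define w where "w \<alpha> = x $ \<alpha> / r" for \<alpha>
  have r: "r > 0" using False by (simp add: r_def)
  have W: "(\<Sum>\<alpha>\<in>UNIV. (w \<alpha>)\<^sup>2) = 1" unfolding w_def r_def by (rule sum_direction_squares[OF False])
  note J = U_gradient_polar[OF False, of T, folded r_def, folded t_def w_def]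
  have sq: "(norm (U_gradient T x))\<^sup>2 = (\<Sum>i\<in>UNIV. \<Sum>\<alpha>\<in>UNIV. (U_gradient T x $ i $ \<alpha>)\<^sup>2)"
    unfolding power2_norm_eq_inner inner_vec_def by (simp add: power2_eq_square)
  have L: "(\<Sum>\<alpha>\<in>UNIV. (U_gradient T x $ Inl k $ \<alpha>)\<^sup>2) = (a\<^sub>1 t)\<^sup>2 * (circ_rot k t)\<^sup>2 / r\<^sup>2" for k
  proof -
    have "(\<Sum>\<alpha>\<in>UNIV. (U_gradient T x $ Inl k $ \<alpha>)\<^sup>2) = (\<Sum>\<alpha>\<in>UNIV. (a\<^sub>1 t)\<^sup>2 * (circ_rot k t)\<^sup>2 / r\<^sup>2 * (w \<alpha>)\<^sup>2)"
      unfolding J by (intro sum.cong) (simp_all add: power2_eq_square)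
    then show ?thesis unfolding sum_distrib_left[symmetric] W by simp
  qed
  have R: "(\<Sum>\<alpha>\<in>UNIV. (U_gradient T x $ Inr b $ \<alpha>)\<^sup>2)
      = (((f\<^sub>1 t)\<^sup>2 - (f\<^sub>0 t)\<^sup>2) * (w b)\<^sup>2 + (f\<^sub>0 t)\<^sup>2) / r\<^sup>2" for b
  proof -
    have "(\<Sum>\<alpha>\<in>UNIV. (U_gradient T x $ Inr b $ \<alpha>)\<^sup>2) =
      (\<Sum>\<alpha>\<in>UNIV. (f\<^sub>1 t + f\<^sub>0 t)\<^sup>2 * (w b)\<^sup>2 / r\<^sup>2 * (w \<alpha>)\<^sup>2
         + (if b = \<alpha> then ((f\<^sub>0 t)\<^sup>2 - 2 * (f\<^sub>1 t + f\<^sub>0 t) * f\<^sub>0 t * (w b)\<^sup>2) / r\<^sup>2 else 0))"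
      unfolding J using r by (intro sum.cong) (auto simp: power2_eq_square field_simps)
    also have "\<dots> = (f\<^sub>1 t + f\<^sub>0 t)\<^sup>2 * (w b)\<^sup>2 / r\<^sup>2 + ((f\<^sub>0 t)\<^sup>2 - 2 * (f\<^sub>1 t + f\<^sub>0 t) * f\<^sub>0 t * (w b)\<^sup>2) / r\<^sup>2"
      unfolding sum.distrib sum_distrib_left[symmetric] W by simp
    also have "\<dots> = (((f\<^sub>1 t)\<^sup>2 - (f\<^sub>0 t)\<^sup>2) * (w b)\<^sup>2 + (f\<^sub>0 t)\<^sup>2) / r\<^sup>2"
      using r by (simp add: power2_eq_square field_simps)
    finally show ?thesis .
  qed
  have "(norm (U_gradient T x))\<^sup>2 = (a\<^sub>1 t)\<^sup>2 * ((circ_rot 1 t)\<^sup>2 + (circ_rot 2 t)\<^sup>2) / r\<^sup>2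
      + (((f\<^sub>1 t)\<^sup>2 - (f\<^sub>0 t)\<^sup>2) * (\<Sum>b\<in>UNIV. (w b)\<^sup>2) + real CARD('n) * (f\<^sub>0 t)\<^sup>2) / r\<^sup>2"
    unfolding sq sum_UNIV_2_plus L R
    by (simp add: sum_divide_distrib[symmetric] sum.distrib sum_distrib_left[symmetric] add_divide_distrib distrib_left)
  also have "\<dots> = Q t / r\<^sup>2"
    unfolding W circ_squares n Q_def using r by (simp add: field_simps)
  finally have "norm (U_gradient T x) = sqrt (Q t / r\<^sup>2)"
    by (metis norm_ge_zero real_sqrt_abs abs_of_nonneg)
  then show ?thesis using r by (simp add: real_sqrt_divide r_def t_def)
qed (simp add: U_gradient_0)

section \<open>The moving frame and the antisymmetric potential\<close>

definition rotation_normal :: "2 + 'n \<Rightarrow> real \<Rightarrow> real" where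
  "rotation_normal i t = (case i of Inl k \<Rightarrow> circ k t | Inr b \<Rightarrow> 0)"
definition rotation_tangent :: "2 + 'n \<Rightarrow> real \<Rightarrow> real" where
  "rotation_tangent i t = (case i of Inl k \<Rightarrow> circ_rot k t | Inr b \<Rightarrow> 0)"
definition sphere_normal :: "2 + 'n \<Rightarrow> real^'n \<Rightarrow> real" where
  "sphere_normal i x = (case i of Inl k \<Rightarrow> 0 | Inr b \<Rightarrow> x $ b / norm x)"
definition sphere_tangent :: "'n \<Rightarrow> 2 + 'n \<Rightarrow> real^'n \<Rightarrow> real" where
  "sphere_tangent \<alpha> i x = (case i of Inl k \<Rightarrow> 0
     | Inr b \<Rightarrow> (if b = \<alpha> then 1 else 0) - (x $ b / norm x) * (x $ \<alpha> / norm x))"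

lemma measurable_frame [measurable]:
  "rotation_normal i \<in> borel_measurable borel" "rotation_tangent i \<in> borel_measurable borel"
  "sphere_normal i \<in> borel_measurable borel" "sphere_tangent \<alpha> i \<in> borel_measurable borel"
  unfolding rotation_normal_def[abs_def] rotation_tangent_def[abs_def] sphere_normal_def[abs_def] sphere_tangent_def[abs_def]
  by (cases i; simp)+

lemma frame_bounds:
  "\<bar>rotation_normal i t\<bar> \<le> 1" "\<bar>rotation_tangent i t\<bar> \<le> 1"
  "\<bar>sphere_normal i x\<bar> \<le> 1" "\<bar>sphere_tangent \<alpha> i x\<bar> \<le> 2"
proof -
  have d: "\<bar>x $ b / norm x\<bar> \<le> 1" for b
    using component_le_norm_cart[of x b] by (cases "x = 0") auto
  show "\<bar>rotation_normal i t\<bar> \<le> 1" "\<bar>rotation_tangent i t\<bar> \<le> 1"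
    by (cases i; simp add: rotation_normal_def rotation_tangent_def circ_def circ_rot_def)+
  show "\<bar>sphere_normal i x\<bar> \<le> 1" using d by (cases i) (auto simp: sphere_normal_def)
  have kron: "\<bar>(if P then 1 else 0) - z\<bar> \<le> 2" if "\<bar>z\<bar> \<le> 1" for P and z :: real
    using that by (cases P) auto
  have "\<bar>(x $ b / norm x) * (x $ \<alpha> / norm x)\<bar> \<le> 1" for b
    using mult_mono[OF d[of b] d[of \<alpha>]] by (simp only: abs_mult) simp
  note * = kron[OF this]
  show "\<bar>sphere_tangent \<alpha> i x\<bar> \<le> 2"
  proof (cases i)
    case (Inr b)
    show ?thesis unfolding Inr sphere_tangent_def sum.case by (rule *)
  qed (simp add: sphere_tangent_def)
qed

text \<open>The wedge u \<and> v stands for the matrix with entries u_i v_j - v_i u_j, which maps y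
  to (v \<bullet> y) u - (u \<bullet> y) v; antisymmetry is therefore built in.\<close>

definition U_potential :: "real \<Rightarrow> real^'n \<Rightarrow> (real^(2 + 'n)^(2 + 'n))^'n" where
  "U_potential T x = (let t = T - ln (norm x); \<nu> = (\<lambda>i. rotation_normal i t); \<theta> = (\<lambda>i. rotation_tangent i t);
       \<omega> = (\<lambda>i. sphere_normal i x); P = (\<lambda>\<alpha> i. sphere_tangent \<alpha> i x)
     in \<chi> \<alpha> i j. 1 / norm x * (x $ \<alpha> / norm x * (- a\<^sub>1 t * (\<nu> i * \<theta> j - \<theta> i * \<nu> j) + \<gamma> t * (\<omega> i * \<theta> j - \<theta> i * \<omega> j))
         + \<delta> t * (\<theta> i * P \<alpha> j - P \<alpha> i * \<theta> j)))"

lemma U_potential_antisymmetric: "U_potential T x $ \<alpha> \<in> so_matrices"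
  by (simp add: so_matrices_def U_potential_def Let_def transpose_def vec_eq_iff algebra_simps)

lemma U_potential_measurable: "U_potential T \<in> borel_measurable borel"
  unfolding U_potential_def[abs_def] Let_def
  by (intro borel_measurable_vecI) (simp only: vec_lambda_beta, measurable)

lemma U_potential_bound:
  assumes T: "T \<ge> 1"
  shows "\<exists>C. \<forall>x\<in>ball (0::real^'n) 1. norm (U_potential T x) \<le> C * ((T - ln (norm x)) powr (- (1 / 2)) / norm x)"
proof (intro vec_norm_boundI)
  fix \<alpha> :: 'n and i j :: "2 + 'n"
  obtain C where C: "\<And>t. t \<ge> 1 \<Longrightarrow> a\<^sub>1 t + \<bar>\<gamma> t\<bar> + \<bar>\<delta> t\<bar> \<le> C * t powr (- (1 / 2))"
    using coefficients_bounded by blast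
  have "norm (U_potential T x $ \<alpha> $ i $ j) \<le> 4 * C * ((T - ln (norm x)) powr (- (1 / 2)) / norm x)"
    if x: "x \<in> ball 0 1" for x
  proof (cases "x = 0")
    case True
    then show ?thesis by (simp add: U_potential_def)
  next
    case False
    define t where "t = T - ln (norm x)"
    have "ln (norm x) \<le> 0" using x False by simp
    then have t: "t \<ge> 1" using T unfolding t_def by linarith
    define \<nu> \<theta> :: "2 + 'n \<Rightarrow> real" where "\<nu> = (\<lambda>i. rotation_normal i t)" and "\<theta> = (\<lambda>i. rotation_tangent i t)"
    define \<omega> P where "\<omega> = (\<lambda>i. sphere_normal i x)" and "P = (\<lambda>i. sphere_tangent \<alpha> i x)"
    note frame_defs = \<nu>_def \<theta>_def \<omega>_def P_def
    have wedge: "\<bar>a * b - c * d\<bar> \<le> A * B + A * B" if "\<bar>a\<bar> \<le> A" "\<bar>b\<bar> \<le> B" "\<bar>c\<bar> \<le> B" "\<bar>d\<bar> \<le> A" for a b c d A B :: real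
    proof -
      have "\<bar>a * b\<bar> \<le> A * B" "\<bar>c * d\<bar> \<le> B * A"
        unfolding abs_mult using that by (intro mult_mono; auto)+
      then show ?thesis by (simp add: mult.commute abs_le_iff)
    qed
    \<comment> \<open>The entries of P_\<alpha> are bounded only by 2, whence 4 for the last wedge;
      the entry bound becomes 4 times the sum in \<open>coefficients_bounded\<close>.\<close>
    have W: "\<bar>\<nu> i * \<theta> j - \<theta> i * \<nu> j\<bar> \<le> 2" "\<bar>\<omega> i * \<theta> j - \<theta> i * \<omega> j\<bar> \<le> 2" "\<bar>\<theta> i * P j - P i * \<theta> j\<bar> \<le> 4"
      using wedge[of "\<nu> i" 1 "\<theta> j" 1 "\<theta> i" "\<nu> j"] wedge[of "\<omega> i" 1 "\<theta> j" 1 "\<theta> i" "\<omega> j"]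
        wedge[of "\<theta> i" 1 "P j" 2 "P i" "\<theta> j"]
      by (simp_all add: frame_defs frame_bounds)
    have d: "\<bar>x $ \<alpha> / norm x\<bar> \<le> 1" using component_le_norm_cart[of x \<alpha>] False by simp
    define Z1 where "Z1 = - a\<^sub>1 t * (\<nu> i * \<theta> j - \<theta> i * \<nu> j) + \<gamma> t * (\<omega> i * \<theta> j - \<theta> i * \<omega> j)"
    define Z2 where "Z2 = \<delta> t * (\<theta> i * P j - P i * \<theta> j)"
    have a1: "a\<^sub>1 t > 0" using a\<^sub>1_pos t by simp
    have "\<bar>- a\<^sub>1 t * (\<nu> i * \<theta> j - \<theta> i * \<nu> j)\<bar> \<le> a\<^sub>1 t * 2" "\<bar>\<gamma> t * (\<omega> i * \<theta> j - \<theta> i * \<omega> j)\<bar> \<le> \<bar>\<gamma> t\<bar> * 2"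
      unfolding abs_mult using W a1 by (auto intro!: mult_mono)
    then have Z1: "\<bar>Z1\<bar> \<le> 2 * a\<^sub>1 t + 2 * \<bar>\<gamma> t\<bar>" unfolding Z1_def by linarith
    have Z2: "\<bar>Z2\<bar> \<le> \<bar>\<delta> t\<bar> * 4" unfolding Z2_def abs_mult using W by (intro mult_mono) auto
    have "\<bar>x $ \<alpha> / norm x * Z1\<bar> \<le> \<bar>Z1\<bar>" unfolding abs_mult[of _ Z1] using d by (intro mult_left_le_one_le) auto
    then have "\<bar>x $ \<alpha> / norm x * Z1 + Z2\<bar> \<le> (2 * a\<^sub>1 t + 2 * \<bar>\<gamma> t\<bar>) + \<bar>\<delta> t\<bar> * 4"
      using Z1 Z2 by (intro order_trans[OF abs_triangle_ineq] add_mono) auto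
    also have "\<dots> \<le> 4 * (a\<^sub>1 t + \<bar>\<gamma> t\<bar> + \<bar>\<delta> t\<bar>)" using a1 by simp
    also have "\<dots> \<le> 4 * (C * t powr (- (1 / 2)))" using C[OF t] by simp
    finally have "\<bar>1 / norm x * (x $ \<alpha> / norm x * Z1 + Z2)\<bar> \<le> 1 / norm x * (4 * (C * t powr (- (1 / 2))))"
      unfolding abs_mult[of "1 / norm x"] by (intro mult_mono) auto
    moreover have "U_potential T x $ \<alpha> $ i $ j = 1 / norm x * (x $ \<alpha> / norm x * Z1 + Z2)"
      by (simp add: U_potential_def Let_def Z1_def Z2_def frame_defs t_def)
    ultimately show ?thesis by (simp add: t_def)
  qed
  then show "\<exists>C. \<forall>x\<in>ball 0 1. norm (U_potential T x $ \<alpha> $ i $ j) \<le> C * ((T - ln (norm x)) powr (- (1 / 2)) / norm x)"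
    by blast
qed

text \<open>Each wedge acts through the pairings of the gradient columns with the frame. Columns are
  orthogonal to \<nu>, because the first two components of U run on the unit circle, and they pair
  with \<theta>, \<omega> and P_\<alpha> through a', f' and f respectively. Summing over \<alpha>
  and inserting \<gamma> and \<delta> gives the divergence side, up to the scalar c, later the power
  of the gradient norm.\<close>

lemma potential_apply_U_potential:
  fixes x :: "real^'n" and T :: real
  defines "r \<equiv> norm x" and "t \<equiv> T - ln (norm x)"
  assumes x: "x \<noteq> 0" and n: "CARD('n) = m + 2" and t1: "t \<ge> 1"
  shows "potential_apply (U_potential T x) (c *\<^sub>R U_gradient T x) $ i = c / r\<^sup>2 *
    ((a\<^sub>1 t)\<^sup>2 * rotation_normal i t + ((real m + 1) * f\<^sub>0 t - f\<^sub>2 t - \<kappa> t * f\<^sub>1 t) * sphere_normal i x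
      - (a\<^sub>2 t + \<kappa> t * a\<^sub>1 t) * rotation_tangent i t)"
proof -
  define w where "w \<alpha> = x $ \<alpha> / r" for \<alpha>
  have r: "r > 0" using x by (simp add: r_def)
  have pos: "a\<^sub>1 t > 0" "f\<^sub>0 t > 0" using a\<^sub>1_pos f\<^sub>0_pos t1 by auto
  have W: "(\<Sum>\<alpha>\<in>UNIV. (w \<alpha>)\<^sup>2) = 1" unfolding w_def r_def by (rule sum_direction_squares[OF x])
  note J = U_gradient_polar[OF x, of T, folded r_def t_def, folded w_def]
  define \<nu> \<theta> :: "2 + 'n \<Rightarrow> real" where "\<nu> = (\<lambda>i. rotation_normal i t)" and "\<theta> = (\<lambda>i. rotation_tangent i t)"
  define \<omega> P where "\<omega> = (\<lambda>i. sphere_normal i x)" and "P = (\<lambda>\<alpha> i. sphere_tangent \<alpha> i x)"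
  have frame: "\<nu> (Inl k) = circ k t" "\<nu> (Inr b) = 0" "\<theta> (Inl k) = circ_rot k t" "\<theta> (Inr b) = 0"
    "\<omega> (Inl k) = 0" "\<omega> (Inr b) = w b" "P \<alpha> (Inl k) = 0" "P \<alpha> (Inr b) = (if b = \<alpha> then 1 else 0) - w b * w \<alpha>" for k b \<alpha>
    by (simp_all add: \<nu>_def \<theta>_def \<omega>_def P_def rotation_normal_def rotation_tangent_def sphere_normal_def
        sphere_tangent_def w_def r_def)
  have E1: "(\<Sum>j\<in>UNIV. \<theta> j * U_gradient T x $ j $ \<alpha>) = - a\<^sub>1 t * w \<alpha> / r" for \<alpha>
  proof -
    have "(\<Sum>j\<in>UNIV. \<theta> j * U_gradient T x $ j $ \<alpha>) = - a\<^sub>1 t * w \<alpha> / r * ((circ_rot 1 t)\<^sup>2 + (circ_rot 2 t)\<^sup>2)"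
      unfolding sum_UNIV_2_plus frame J using r by (simp add: field_simps power2_eq_square)
    then show ?thesis by (simp add: circ_squares)
  qed
  have E2: "(\<Sum>j\<in>UNIV. \<nu> j * U_gradient T x $ j $ \<alpha>) = 0" for \<alpha>
  proof -
    have "(\<Sum>j\<in>UNIV. \<nu> j * U_gradient T x $ j $ \<alpha>) = - a\<^sub>1 t * w \<alpha> / r * (circ 1 t * circ_rot 1 t + circ 2 t * circ_rot 2 t)"
      unfolding sum_UNIV_2_plus frame J using r by (simp add: field_simps)
    then show ?thesis by (simp add: circ_squares)
  qed
  have E3: "(\<Sum>j\<in>UNIV. \<omega> j * U_gradient T x $ j $ \<alpha>) = - f\<^sub>1 t * w \<alpha> / r" for \<alpha>
  proof -
    have "(\<Sum>j\<in>UNIV. \<omega> j * U_gradient T x $ j $ \<alpha>) =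
      (\<Sum>b\<in>UNIV. - (f\<^sub>1 t + f\<^sub>0 t) * w \<alpha> / r * (w b)\<^sup>2 + (if b = \<alpha> then f\<^sub>0 t * w \<alpha> / r else 0))"
      unfolding sum_UNIV_2_plus frame J using r by (auto simp: field_simps power2_eq_square intro!: sum.cong)
    also have "\<dots> = - (f\<^sub>1 t + f\<^sub>0 t) * w \<alpha> / r + f\<^sub>0 t * w \<alpha> / r"
      unfolding sum.distrib sum_distrib_left[symmetric] W by simp
    finally show ?thesis using r by (simp add: field_simps)
  qed
  have E4: "(\<Sum>j\<in>UNIV. P \<alpha> j * U_gradient T x $ j $ \<alpha>) = f\<^sub>0 t / r * (1 - (w \<alpha>)\<^sup>2)" for \<alpha>
  proof -
    have "(\<Sum>j\<in>UNIV. P \<alpha> j * U_gradient T x $ j $ \<alpha>) =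
      (\<Sum>b\<in>UNIV. (f\<^sub>1 t + f\<^sub>0 t) * (w \<alpha>)\<^sup>2 / r * (w b)\<^sup>2
         + (if b = \<alpha> then (f\<^sub>0 t - (f\<^sub>1 t + 2 * f\<^sub>0 t) * (w \<alpha>)\<^sup>2) / r else 0))"
      unfolding sum_UNIV_2_plus frame J using r by (auto simp: field_simps power2_eq_square intro!: sum.cong)
    also have "\<dots> = (f\<^sub>1 t + f\<^sub>0 t) * (w \<alpha>)\<^sup>2 / r + (f\<^sub>0 t - (f\<^sub>1 t + 2 * f\<^sub>0 t) * (w \<alpha>)\<^sup>2) / r"
      unfolding sum.distrib sum_distrib_left[symmetric] W by simp
    also have "\<dots> = f\<^sub>0 t / r * (1 - (w \<alpha>)\<^sup>2)" using r by (simp add: field_simps)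
    finally show ?thesis .
  qed
  \<comment> \<open>The wedge \<theta> \<and> P_\<alpha> also produces a multiple of
    \<omega>_\<alpha> P_\<alpha>; it sums to 0 because the projection annihilates \<omega>.\<close>
  have PW: "(\<Sum>\<alpha>\<in>UNIV. P \<alpha> i * w \<alpha>) = 0"
  proof (cases i)
    case (Inr b)
    have "(\<Sum>\<alpha>\<in>UNIV. P \<alpha> i * w \<alpha>) = (\<Sum>\<alpha>\<in>UNIV. (if b = \<alpha> then w b else 0) + (- w b) * (w \<alpha>)\<^sup>2)"
      unfolding Inr frame by (intro sum.cong) (auto simp: algebra_simps power2_eq_square)
    also have "\<dots> = 0" unfolding sum.distrib sum_distrib_left[symmetric] W by simp
    finally show ?thesis .
  qed (simp add: frame)
  have row: "(\<Sum>j\<in>UNIV. U_potential T x $ \<alpha> $ i $ j * (c *\<^sub>R U_gradient T x) $ j $ \<alpha>) =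
     c / r\<^sup>2 * (((a\<^sub>1 t)\<^sup>2 * \<nu> i - \<gamma> t * a\<^sub>1 t * \<omega> i + (\<gamma> t * f\<^sub>1 t - \<delta> t * f\<^sub>0 t) * \<theta> i) * (w \<alpha>)\<^sup>2
        + \<delta> t * f\<^sub>0 t * \<theta> i + \<delta> t * a\<^sub>1 t * (P \<alpha> i * w \<alpha>))" for \<alpha>
  proof -
    have entry: "U_potential T x $ \<alpha> $ i $ j = 1 / r * (w \<alpha> * (- a\<^sub>1 t * (\<nu> i * \<theta> j - \<theta> i * \<nu> j) + \<gamma> t * (\<omega> i * \<theta> j - \<theta> i * \<omega> j))
         + \<delta> t * (\<theta> i * P \<alpha> j - P \<alpha> i * \<theta> j))" for j
      by (simp add: U_potential_def Let_def \<nu>_def \<theta>_def \<omega>_def P_def w_def r_def t_def)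
    have "U_potential T x $ \<alpha> $ i $ j * (c *\<^sub>R U_gradient T x) $ j $ \<alpha> =
        c / r * (- w \<alpha> * a\<^sub>1 t * \<nu> i + w \<alpha> * \<gamma> t * \<omega> i - \<delta> t * P \<alpha> i) * (\<theta> j * U_gradient T x $ j $ \<alpha>)
        + c / r * (w \<alpha> * a\<^sub>1 t * \<theta> i) * (\<nu> j * U_gradient T x $ j $ \<alpha>)
        + c / r * (- w \<alpha> * \<gamma> t * \<theta> i) * (\<omega> j * U_gradient T x $ j $ \<alpha>)
        + c / r * (\<delta> t * \<theta> i) * (P \<alpha> j * U_gradient T x $ j $ \<alpha>)" for j
      unfolding entry vector_scaleR_component real_scaleR_def using r by (simp add: field_simps)
    then have *: "(\<Sum>j\<in>UNIV. U_potential T x $ \<alpha> $ i $ j * (c *\<^sub>R U_gradient T x) $ j $ \<alpha>) =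
        c / r * (- w \<alpha> * a\<^sub>1 t * \<nu> i + w \<alpha> * \<gamma> t * \<omega> i - \<delta> t * P \<alpha> i) * (- a\<^sub>1 t * w \<alpha> / r)
        + c / r * (w \<alpha> * a\<^sub>1 t * \<theta> i) * 0
        + c / r * (- w \<alpha> * \<gamma> t * \<theta> i) * (- f\<^sub>1 t * w \<alpha> / r)
        + c / r * (\<delta> t * \<theta> i) * (f\<^sub>0 t / r * (1 - (w \<alpha>)\<^sup>2))"
      by (simp only: sum.distrib sum_distrib_left[symmetric] E1 E2 E3 E4)
    show ?thesis unfolding * using r by (simp add: field_simps power2_eq_square)
  qed
  \<comment> \<open>Of the n = m + 2 copies of \<delta> f \<theta> one is removed by the squares of
    the direction components, which sum to 1. The factor m + 1 is the trace of the
    projection.\<close>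
  have "potential_apply (U_potential T x) (c *\<^sub>R U_gradient T x) $ i = c / r\<^sup>2 *
     (((a\<^sub>1 t)\<^sup>2 * \<nu> i - \<gamma> t * a\<^sub>1 t * \<omega> i + (\<gamma> t * f\<^sub>1 t - \<delta> t * f\<^sub>0 t) * \<theta> i)
        + (real m + 2) * (\<delta> t * f\<^sub>0 t * \<theta> i))"
    unfolding potential_apply_def vec_lambda_beta row sum_distrib_left[symmetric] sum.distrib W PW
    by (simp add: n)
  also have "\<dots> = c / r\<^sup>2 * ((a\<^sub>1 t)\<^sup>2 * \<nu> i - \<gamma> t * a\<^sub>1 t * \<omega> i + (\<gamma> t * f\<^sub>1 t + \<delta> t * ((real m + 1) * f\<^sub>0 t)) * \<theta> i)"
    by (simp add: algebra_simps)
  also have "\<gamma> t * a\<^sub>1 t = - ((real m + 1) * f\<^sub>0 t - f\<^sub>2 t - \<kappa> t * f\<^sub>1 t)"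
    using pos by (simp add: \<gamma>_def)
  also have "\<delta> t * ((real m + 1) * f\<^sub>0 t) = - (a\<^sub>2 t + \<kappa> t * a\<^sub>1 t + \<gamma> t * f\<^sub>1 t)"
    using pos by (simp add: \<delta>_def)
  finally show ?thesis by (simp add: \<nu>_def \<theta>_def \<omega>_def algebra_simps)
qed


section \<open>The field |\<nabla>U|^(n-2) \<nabla>U and the equation away from the origin\<close>

lemma power_field_rotation_symbol:
  "log_symbol (2 * \<beta>) (\<lambda>t. - 1 * (N t * (a\<^sub>1 t * circ_rot k t)))
    (\<lambda>t. - 1 * (\<kappa> t * N t * (a\<^sub>1 t * circ_rot k t) + N t * (a\<^sub>2 t * circ_rot k t + a\<^sub>1 t * - (a\<^sub>1 t * circ k t))))"
proof (rule log_symbol_mono)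
  show "log_symbol (\<beta> * real m + (\<beta> + 0)) (\<lambda>t. - 1 * (N t * (a\<^sub>1 t * circ_rot k t)))
    (\<lambda>t. - 1 * (\<kappa> t * N t * (a\<^sub>1 t * circ_rot k t) + N t * (a\<^sub>2 t * circ_rot k t + a\<^sub>1 t * - (a\<^sub>1 t * circ k t))))"
    by (intro log_symbol_cmult log_symbol_mult N_symbol a\<^sub>1_symbol circ_rot_symbol)
  \<comment> \<open>Here m >= 1 matters: the field is of order \<beta> (m + 1), hence at least 2
    \<beta>, the exponent of the integrable weight.\<close>
  have "\<beta> * 1 \<le> \<beta> * real m" using beta m by (intro mult_left_mono) auto
  then show "2 * \<beta> \<le> \<beta> * real m + (\<beta> + 0)" by simp
qed

lemma power_field_sphere_symbols:
  "log_symbol (2 * \<beta>) (\<lambda>t. - 1 * (N t * (f\<^sub>1 t + f\<^sub>0 t)))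
    (\<lambda>t. - 1 * (\<kappa> t * N t * (f\<^sub>1 t + f\<^sub>0 t) + N t * (f\<^sub>2 t + f\<^sub>1 t)))"
  "log_symbol (2 * \<beta>) (\<lambda>t. N t * f\<^sub>0 t) (\<lambda>t. \<kappa> t * N t * f\<^sub>0 t + N t * f\<^sub>1 t)"
proof -
  have "\<beta> * 1 \<le> \<beta> * real m" using beta m by (intro mult_left_mono) auto
  then have le: "2 * \<beta> \<le> \<beta> * real m + (\<beta> + 1 / 2)" by simp
  show "log_symbol (2 * \<beta>) (\<lambda>t. - 1 * (N t * (f\<^sub>1 t + f\<^sub>0 t)))
    (\<lambda>t. - 1 * (\<kappa> t * N t * (f\<^sub>1 t + f\<^sub>0 t) + N t * (f\<^sub>2 t + f\<^sub>1 t)))"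
    by (rule log_symbol_mono[OF _ le]) (intro log_symbol_cmult log_symbol_mult log_symbol_add N_symbol f\<^sub>1_symbol f\<^sub>0_symbol)
  show "log_symbol (2 * \<beta>) (\<lambda>t. N t * f\<^sub>0 t) (\<lambda>t. \<kappa> t * N t * f\<^sub>0 t + N t * f\<^sub>1 t)"
    by (rule log_symbol_mono[OF _ le]) (intro log_symbol_mult N_symbol f\<^sub>0_symbol)
qed

definition power_field_deriv :: "real \<Rightarrow> 2 + 'n \<Rightarrow> 'n \<Rightarrow> real^'n \<Rightarrow> real" where
  "power_field_deriv T i \<alpha> = (case i of
      Inl k \<Rightarrow> radial_field_deriv (\<lambda>t. - 1 * (N t * (a\<^sub>1 t * circ_rot k t)))
        (\<lambda>t. - 1 * (\<kappa> t * N t * (a\<^sub>1 t * circ_rot k t) + N t * (a\<^sub>2 t * circ_rot k t + a\<^sub>1 t * - (a\<^sub>1 t * circ k t))))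
        (m + 1) T \<alpha>
    | Inr b \<Rightarrow> equivariant_field_deriv (\<lambda>t. - 1 * (N t * (f\<^sub>1 t + f\<^sub>0 t)))
        (\<lambda>t. - 1 * (\<kappa> t * N t * (f\<^sub>1 t + f\<^sub>0 t) + N t * (f\<^sub>2 t + f\<^sub>1 t)))
        (\<lambda>t. N t * f\<^sub>0 t) (\<lambda>t. \<kappa> t * N t * f\<^sub>0 t + N t * f\<^sub>1 t) (m + 1) T b \<alpha>)"

text \<open>The power of the norm contributes N / r^m, which raises the power of 1/r in the gradient
  to m + 1 = n - 1. The identity includes the origin, so it can be used to rewrite the field as a
  function on the whole space.\<close>

lemma power_field_polar:
  fixes x :: "real^'n"
  assumes n: "CARD('n) = m + 2"
  shows "(norm (U_gradient T x) ^ m *\<^sub>R U_gradient T x) $ i $ \<alpha> = (case i of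
      Inl k \<Rightarrow> - 1 * (N (T - ln (norm x)) * (a\<^sub>1 (T - ln (norm x)) * circ_rot k (T - ln (norm x)))) / norm x ^ (m + 1) * (x $ \<alpha> / norm x)
    | Inr b \<Rightarrow> - 1 * (N (T - ln (norm x)) * (f\<^sub>1 (T - ln (norm x)) + f\<^sub>0 (T - ln (norm x)))) / norm x ^ (m + 1) * (x $ b / norm x) * (x $ \<alpha> / norm x)
        + (if b = \<alpha> then 1 else 0) * (N (T - ln (norm x)) * f\<^sub>0 (T - ln (norm x)) / norm x ^ (m + 1)))"
proof (cases "x = 0")
  case True
  then show ?thesis by (cases i) (simp_all add: U_gradient_0)
next
  case False
  define r t where "r = norm x" and "t = T - ln r"
  define w where "w \<alpha> = x $ \<alpha> / r" for \<alpha>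
  have r: "r > 0" using False by (simp add: r_def)
  note J = U_gradient_polar[OF False, of T, folded r_def, folded t_def w_def]
  have c: "norm (U_gradient T x) ^ m = N t / r ^ m"
    by (simp add: norm_U_gradient[OF n] N_def power_divide r_def t_def)
  show ?thesis
    unfolding vector_scaleR_component real_scaleR_def c r_def[symmetric] t_def[symmetric] w_def[symmetric]
    using r by (cases i) (simp_all add: J field_simps)
qed

lemma punctured_adm_power_field:
  fixes \<alpha> :: "'n::finite"
  assumes n: "CARD('n) = m + 2" and T: "T \<ge> 1"
  shows "punctured_adm T (2 * \<beta>) \<alpha> (\<lambda>x. (norm (U_gradient T x) ^ m *\<^sub>R U_gradient T x) $ i $ \<alpha>) (power_field_deriv T i \<alpha>)"
proof (cases i)
  case (Inl k)
  have "CARD('n) = (m + 1) + 1" using n by simp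
  from punctured_adm_radial_field[OF power_field_rotation_symbol T order_refl this, of \<alpha> k]
  show ?thesis unfolding power_field_polar[OF n] Inl sum.case power_field_deriv_def .
next
  case (Inr b)
  have "CARD('n) = (m + 1) + 1" using n by simp
  from punctured_adm_equivariant_field[OF power_field_sphere_symbols T order_refl this, of \<alpha> b]
  show ?thesis unfolding power_field_polar[OF n] Inr sum.case power_field_deriv_def .
qed

text \<open>Both sides have been computed in the frame: the potential side by
  \<open>potential_apply_U_potential\<close>, the divergence by the lemmas on radial and equivariant
  fields with j = n - 1.\<close>

lemma potential_apply_power_field:
  fixes x :: "real^'n"
  assumes n: "CARD('n) = m + 2" and T: "T \<ge> 1" and x: "x \<in> ball 0 1 - {0}"
  shows "potential_apply (U_potential T x) (norm (U_gradient T x) ^ m *\<^sub>R U_gradient T x) $ i = - (\<Sum>\<alpha>\<in>UNIV. power_field_deriv T i \<alpha> x)"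
proof -
  define r t where "r = norm x" and "t = T - ln r"
  have x0: "x \<noteq> 0" and r: "r > 0" using x by (auto simp: r_def)
  have "ln r \<le> 0" using x by (simp add: r_def)
  then have t1: "t \<ge> 1" using T unfolding t_def by linarith
  have n': "CARD('n) = (m + 1) + 1" using n by simp
  have c: "norm (U_gradient T x) ^ m = N t / r ^ m"
    by (simp add: norm_U_gradient[OF n] N_def power_divide r_def t_def)
  have "potential_apply (U_potential T x) (norm (U_gradient T x) ^ m *\<^sub>R U_gradient T x) $ i = N t / r ^ m / r\<^sup>2 *
    ((a\<^sub>1 t)\<^sup>2 * rotation_normal i t + ((real m + 1) * f\<^sub>0 t - f\<^sub>2 t - \<kappa> t * f\<^sub>1 t) * sphere_normal i x
      - (a\<^sub>2 t + \<kappa> t * a\<^sub>1 t) * rotation_tangent i t)"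
    unfolding c using potential_apply_U_potential[OF x0 n, of T "N t / r ^ m" i] t1 by (simp add: r_def t_def)
  also have "\<dots> = - (\<Sum>\<alpha>\<in>UNIV. power_field_deriv T i \<alpha> x)"
  proof (cases i)
    case (Inl k)
    show ?thesis
      unfolding Inl power_field_deriv_def sum.case divergence_radial_field[OF x0 n'] r_def[symmetric] t_def[symmetric]
      using r by (simp add: rotation_normal_def rotation_tangent_def sphere_normal_def field_simps power2_eq_square)
  next
    case (Inr b)
    \<comment> \<open>With A = -N (f' + f) and B = N f, the terms \<kappa> N f and N f' cancel in A'
      + B', and the term j B supplies (n - 1) N f.\<close>
    show ?thesis
      unfolding Inr power_field_deriv_def sum.case divergence_equivariant_field[OF x0 n'] r_def[symmetric] t_def[symmetric]
      using r by (simp add: rotation_normal_def rotation_tangent_def sphere_normal_def r_def[symmetric] field_simps power2_eq_square)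
  qed
  finally show ?thesis .
qed

section \<open>Lorentz membership, boundedness and discontinuity\<close>

lemma U_gradient_lorentz:
  assumes n: "CARD('n::finite) = m + 2" and T: "T \<ge> 1" and p: "p = \<infinity> \<or> 1 < \<beta> * enn2real p"
  shows "(U_gradient T :: real^'n \<Rightarrow> real^'n^(2 + 'n)) \<in> lorentz_space (real CARD('n)) p (ball 0 1)"
proof -
  have n2: "CARD('n) > 2" using n m by simp
  have "U_gradient T \<in> borel_measurable (borel :: (real^'n) measure)"
    by (intro borel_measurable_vecI punctured_admD(2)[OF punctured_adm_U_map[OF n2 T]])
  then have "(U_gradient T :: real^'n \<Rightarrow> _) \<in> borel_measurable (lebesgue_on (ball 0 1))"
    by (intro measurable_restrict_space1) (simp add: measurable_completion)
  moreover have "norm (U_gradient T x) \<le> (real m + 4) * ((T - ln (norm x)) powr (- \<beta>) / norm x)" if x: "x \<in> ball 0 1" for x :: "real^'n"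
  proof (cases "x = 0")
    case False
    have "ln (norm x) \<le> 0" using x False by simp
    then have "T - ln (norm x) \<ge> 1" using T by linarith
    from divide_right_mono[OF Q_le[OF this], of "norm x"] show ?thesis by (simp add: norm_U_gradient[OF n])
  qed (simp add: U_gradient_0)
  ultimately have "(U_gradient T :: real^'n \<Rightarrow> real^'n^(2 + 'n)) \<in> lorentz_space (real DIM(real^'n)) p (ball 0 1)"
    using beta T p by (intro lorentz_space_log_bound[where C = "real m + 4" and T = T and \<sigma> = \<beta>]) auto
  then show ?thesis by simp
qed

lemma U_potential_lorentz:
  assumes T: "T \<ge> 1" and q: "q > 2"
  shows "(U_potential T :: real^'n::finite \<Rightarrow> (real^(2 + 'n)^(2 + 'n))^'n) \<in> lorentz_space (real CARD('n)) q (ball 0 1)"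
proof -
  have "(U_potential T :: real^'n \<Rightarrow> _) \<in> borel_measurable (lebesgue_on (ball 0 1))"
    by (intro measurable_restrict_space1) (simp add: measurable_completion U_potential_measurable)
  moreover obtain C where C: "\<And>x. x \<in> ball (0::real^'n) 1 \<Longrightarrow> norm (U_potential T x) \<le> C * ((T - ln (norm x)) powr (- (1 / 2)) / norm x)"
    using U_potential_bound[OF T] by blast
  \<comment> \<open>The constant obtained is not known to be nonnegative.\<close>
  moreover have "C * ((T - ln (norm x)) powr (- (1 / 2)) / norm x) \<le> max C 0 * ((T - ln (norm x)) powr (- (1 / 2)) / norm x)" for x :: "real^'n"
    by (intro mult_right_mono) auto
  moreover have "q = \<infinity> \<or> 1 < 1 / 2 * enn2real q"
  proof (cases q)
    case (real r)
    then have "2 < r" using q by (simp add: ennreal_less_iff flip: ennreal_numeral)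
    then show ?thesis using real by simp
  qed simp
  ultimately have "(U_potential T :: real^'n \<Rightarrow> (real^(2 + 'n)^(2 + 'n))^'n) \<in> lorentz_space (real DIM(real^'n)) q (ball 0 1)"
    using T by (intro lorentz_space_log_bound[where C = "max C 0" and T = T and \<sigma> = "1 / 2"])
      (auto intro: order_trans)
  then show ?thesis by simp
qed

lemma U_map_L_infinity:
  assumes T: "T \<ge> 1" and n: "CARD('n::finite) > 2"
  shows "(U_map \<beta> T :: real^'n \<Rightarrow> real^(2 + 'n)) \<in> L_infinity (ball 0 1)"
proof -
  have "U_map \<beta> T \<in> borel_measurable (borel :: (real^'n) measure)"
    by (intro borel_measurable_vecI punctured_admD(1)[OF punctured_adm_U_map[OF n T]])
  then have "(U_map \<beta> T :: real^'n \<Rightarrow> _) \<in> borel_measurable (lebesgue_on (ball 0 1))"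
    by (intro measurable_restrict_space1) (simp add: measurable_completion)
  moreover have "\<exists>C. \<forall>x\<in>ball (0::real^'n) 1. norm (U_map \<beta> T x) \<le> C * 1"
  proof (intro vec_norm_boundI exI ballI)
    fix i and x :: "real^'n" assume x: "x \<in> ball 0 1"
    show "norm (U_map \<beta> T x $ i) \<le> 1 * 1"
    proof (cases i)
      case (Inl k)
      then show ?thesis by (simp add: U_map_nth circ_def)
    next
      case (Inr b)
      show ?thesis
      proof (cases "x = 0")
        case False
        define t where "t = T - ln (norm x)"
        have "ln (norm x) \<le> 0" using x False by simp
        then have t: "t \<ge> 1" using T unfolding t_def by linarith
        have "f\<^sub>0 t \<le> t powr 0" unfolding f\<^sub>0_def using t beta by (intro powr_mono) auto
        then have "\<bar>f\<^sub>0 t\<bar> * \<bar>x $ b / norm x\<bar> \<le> 1 * 1"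
          using t f\<^sub>0_pos[of t] component_le_norm_cart[of x b] False by (intro mult_mono) auto
        then show ?thesis unfolding Inr U_map_nth t_def[symmetric] real_norm_def abs_mult .
      qed (simp add: Inr U_map_nth)
    qed
  qed
  then have "\<exists>C. AE x in lebesgue_on (ball (0::real^'n) 1). norm (U_map \<beta> T x) \<le> C"
    by (metis AE_I2 space_lebesgue_on mult.right_neutral)
  ultimately show ?thesis by (simp add: L_infinity_def)
qed

text \<open>The phase is unbounded near the origin: along points where it equals k \<pi>, the first
  component is (-1)^k and does not converge.\<close>

lemma U_map_discontinuous: "\<not> (\<exists>L. ((U_map \<beta> T :: real^'n::finite \<Rightarrow> real^(2 + 'n)) \<longlongrightarrow> L) (at 0))"
proof
  assume "\<exists>L. ((U_map \<beta> T :: real^'n \<Rightarrow> real^(2 + 'n)) \<longlongrightarrow> L) (at 0)"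
  then obtain L where L: "((U_map \<beta> T :: real^'n \<Rightarrow> real^(2 + 'n)) \<longlongrightarrow> L) (at 0)" by blast
  \<comment> \<open>\<open>s k\<close> is the value of t with phase k \<pi>, and |y k| = exp(T - s
    k) makes t equal to it at \<open>y k\<close>.\<close>
  define s where "s k = (real k * pi) powr (1 / (1 - \<beta>))" for k
  define y :: "nat \<Rightarrow> real^'n" where "y k = exp (T - s k) *\<^sub>R axis undefined 1" for k
  have norm_y: "norm (y k) = exp (T - s k)" for k by (simp add: y_def)
  have "filterlim (\<lambda>k. real k * pi) at_top sequentially"
    by (rule filterlim_at_top_mult_tendsto_pos[OF tendsto_const _ filterlim_real_sequentially]) simp
  then have "filterlim s at_top sequentially"
  proof (rule filterlim_at_top_mono)
    \<comment> \<open>The exponent 1 / (1 - \<beta>) exceeds 1 and k \<pi> >= 1, so \<open>s\<close>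
      grows at least linearly.\<close>
    show "\<forall>\<^sub>F k in sequentially. real k * pi \<le> s k"
      using eventually_ge_at_top[of 1]
    proof eventually_elim
      case (elim k)
      have "1 * 1 \<le> real k * pi" using elim pi_ge_two by (intro mult_mono) auto
      then have "(real k * pi) powr 1 \<le> s k"
        unfolding s_def using beta by (intro powr_mono) auto
      then show ?case by simp
    qed
  qed
  then have "filterlim (\<lambda>k. - T + s k) at_top sequentially"
    by (rule filterlim_tendsto_add_at_top[OF tendsto_const])
  then have "filterlim (\<lambda>k. - (- T + s k)) at_bot sequentially"
    unfolding filterlim_uminus_at_top by simp
  then have "(\<lambda>k. exp (- (- T + s k))) \<longlonglongrightarrow> 0"
    by (rule filterlim_compose[OF exp_at_bot])
  then have "(\<lambda>k. exp (T - s k)) \<longlonglongrightarrow> 0" by simp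
  then have "y \<longlonglongrightarrow> 0"
    by (subst tendsto_norm_zero_iff[symmetric]) (simp add: norm_y)
  moreover have "y k \<noteq> 0" for k using norm_y[of k] by (metis exp_not_eq_zero norm_zero)
  ultimately have "filterlim y (at 0) sequentially" by (simp add: filterlim_at)
  from filterlim_compose[OF L this] have "(\<lambda>k. U_map \<beta> T (y k) $ Inl 1) \<longlonglongrightarrow> L $ Inl 1"
    by (rule tendsto_vec_nth)
  moreover have "U_map \<beta> T (y k) $ Inl 1 = (- 1) ^ k" for k
  proof -
    have "phase (s k) = real k * pi" using beta by (simp add: phase_def s_def powr_powr)
    then show ?thesis by (simp add: U_map_nth norm_y circ_def)
  qed
  ultimately have lim: "(\<lambda>k. (- 1) ^ k) \<longlonglongrightarrow> L $ Inl 1" by simp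
  \<comment> \<open>Shifting the index flips the sign, forcing the limit to be 0, while its absolute
    value is 1.\<close>
  have "(\<lambda>k. - ((- 1) ^ k)) \<longlonglongrightarrow> L $ Inl 1" using LIMSEQ_Suc[OF lim] by simp
  from LIMSEQ_unique[OF this tendsto_minus[OF lim]] have "L $ Inl 1 = 0" by simp
  moreover have "(\<lambda>k. \<bar>(- 1 :: real) ^ k\<bar>) \<longlonglongrightarrow> \<bar>L $ Inl 1\<bar>" using lim by (rule tendsto_rabs)
  then have "\<bar>L $ Inl 1\<bar> = 1" by (simp add: LIMSEQ_const_iff power_abs)
  ultimately show False by simp
qed

end

theorem theorem1p2:
  fixes p :: ennreal and \<beta> :: real
  assumes "CARD('n::finite) > 2"
    and "1 < p"
    and "max (1 / 2) (inverse p) < ennreal \<beta>" and "\<beta> < 1"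
  shows "\<exists>T\<^sub>0>0. \<forall>T\<ge>T\<^sub>0. \<exists>G :: real^'n \<Rightarrow> real^'n^(2 + 'n).
    let B = ball (0 :: real^'n) 1; n = CARD('n); U = (U_map \<beta> T :: real^'n \<Rightarrow> real^(2 + 'n))
    in has_weak_gradient_on U G B \<and>
       G \<in> lorentz_space (real n) p B \<and>
       U \<in> L_infinity B \<and>
       \<not> (\<exists>L. (U \<longlongrightarrow> L) (at 0)) \<and>
       (\<exists>\<Omega> :: real^'n \<Rightarrow> (real^(2 + 'n)^(2 + 'n))^'n.
          (\<forall>x\<in>B. \<forall>\<alpha>. \<Omega> x $ \<alpha> \<in> so_matrices) \<and>
          \<Omega> \<in> (\<Inter>q\<in>{2<..}. lorentz_space (real n) q B) \<and>
          minus_div_eq_distrib (\<lambda>x. norm (G x) ^ (n - 2) *\<^sub>R G x)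
            (\<lambda>x. potential_apply (\<Omega> x) (norm (G x) ^ (n - 2) *\<^sub>R G x)) B)"
proof -
  define m where "m = CARD('n) - 2"
  have dim: "1 \<le> m" "CARD('n) = m + 2" "CARD('n) - 2 = m" using assms(1) by (auto simp: m_def)
  have half: "1 / 2 < \<beta>"
  proof -
    have "ennreal (1 / 2) = 1 / 2"
      by (metis divide_ennreal ennreal_1 ennreal_numeral zero_le_numeral zero_le_one zero_less_numeral)
    then have "ennreal (1 / 2) < ennreal \<beta>" using assms(3) by (metis max_less_iff_conj)
    then show ?thesis by (subst (asm) ennreal_less_iff) simp_all
  qed
  \<comment> \<open>The condition 1/p < \<beta> in product form over the reals; p = \<infinity> is
    kept apart because \<open>enn2real\<close> sends it to 0.\<close>
  have p: "p = \<infinity> \<or> 1 < \<beta> * enn2real p"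
  proof (cases p)
    case (real r)
    have r: "r > 1" using assms(2) real by (simp add: ennreal_less_iff flip: ennreal_1)
    have "inverse p < ennreal \<beta>" using assms(3) by simp
    then have "inverse r < \<beta>" using real r by (simp add: inverse_ennreal ennreal_less_iff)
    then have "1 < \<beta> * r" using r by (simp add: field_simps)
    then show ?thesis using real by simp
  qed simp
  interpret spiral_profile \<beta> m by unfold_locales (use half assms(4) dim in auto)
  show ?thesis
  \<comment> \<open>With T >= 1 the variable t = T - ln r stays at least 1 on the punctured ball,
    the range in which all bounds on the profiles hold.\<close>
  proof (intro exI[of _ "1::real"] conjI allI impI)
    fix T :: real assume T: "T \<ge> 1"
    have \<tau>: "2 * \<beta> > 1" using half by simp
    show "\<exists>G :: real^'n \<Rightarrow> real^'n^(2 + 'n).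
      let B = ball (0 :: real^'n) 1; n = CARD('n); U = (U_map \<beta> T :: real^'n \<Rightarrow> real^(2 + 'n))
      in has_weak_gradient_on U G B \<and>
       G \<in> lorentz_space (real n) p B \<and>
       U \<in> L_infinity B \<and>
       \<not> (\<exists>L. (U \<longlongrightarrow> L) (at 0)) \<and>
       (\<exists>\<Omega> :: real^'n \<Rightarrow> (real^(2 + 'n)^(2 + 'n))^'n.
          (\<forall>x\<in>B. \<forall>\<alpha>. \<Omega> x $ \<alpha> \<in> so_matrices) \<and>
          \<Omega> \<in> (\<Inter>q\<in>{2<..}. lorentz_space (real n) q B) \<and>
          minus_div_eq_distrib (\<lambda>x. norm (G x) ^ (n - 2) *\<^sub>R G x)
            (\<lambda>x. potential_apply (\<Omega> x) (norm (G x) ^ (n - 2) *\<^sub>R G x)) B)"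
      unfolding Let_def dim(3)
    proof (intro exI[of _ "U_gradient T"] conjI exI[of _ "U_potential T"])
      show "has_weak_gradient_on (U_map \<beta> T) (U_gradient T) (ball (0 :: real^'n) 1)"
        by (rule has_weak_gradient_on_punctured[OF punctured_adm_U_map[OF assms(1) T] T \<tau>])
      show "(U_gradient T :: real^'n \<Rightarrow> _) \<in> lorentz_space (real CARD('n)) p (ball 0 1)"
        by (rule U_gradient_lorentz[OF dim(2) T p])
      show "(U_map \<beta> T :: real^'n \<Rightarrow> _) \<in> L_infinity (ball 0 1)"
        by (rule U_map_L_infinity[OF T assms(1)])
      show "\<not> (\<exists>L. ((U_map \<beta> T :: real^'n \<Rightarrow> real^(2 + 'n)) \<longlongrightarrow> L) (at 0))"
        by (rule U_map_discontinuous)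
      show "\<forall>x\<in>ball (0::real^'n) 1. \<forall>\<alpha>. U_potential T x $ \<alpha> \<in> so_matrices"
        using U_potential_antisymmetric by blast
      show "(U_potential T :: real^'n \<Rightarrow> _) \<in> (\<Inter>q\<in>{2<..}. lorentz_space (real CARD('n)) q (ball 0 1))"
        using U_potential_lorentz[OF T] by blast
      show "minus_div_eq_distrib (\<lambda>x::real^'n. norm (U_gradient T x) ^ m *\<^sub>R U_gradient T x)
          (\<lambda>x. potential_apply (U_potential T x) (norm (U_gradient T x) ^ m *\<^sub>R U_gradient T x)) (ball 0 1)"
      proof (rule minus_div_eq_distrib_punctured[OF punctured_adm_power_field[OF dim(2) T] potential_apply_power_field[OF dim(2) T] _ T \<tau>])
        have [measurable]: "(\<lambda>x::real^'n. (norm (U_gradient T x) ^ m *\<^sub>R U_gradient T x) $ j $ \<alpha>) \<in> borel_measurable borel" for j \<alpha>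
          by (rule punctured_admD(1)[OF punctured_adm_power_field[OF dim(2) T]])
        have [measurable]: "(\<lambda>x::real^'n. U_potential T x $ \<alpha> $ i $ j) \<in> borel_measurable borel" for \<alpha> i j
          unfolding U_potential_def Let_def by (simp only: vec_lambda_beta) measurable
        show "(\<lambda>x::real^'n. potential_apply (U_potential T x) (norm (U_gradient T x) ^ m *\<^sub>R U_gradient T x)) \<in> borel_measurable borel"
        proof (rule borel_measurable_vecI)
          fix i
          show "(\<lambda>x::real^'n. potential_apply (U_potential T x) (norm (U_gradient T x) ^ m *\<^sub>R U_gradient T x) $ i) \<in> borel_measurable borel"
            unfolding potential_apply_def vec_lambda_beta by measurable
        qed
      qed
    qed
  qed simp
qed

end
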